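(* Let $1<p<\infty$, let $\nu\in W^{1,\infty}(\mathbb{D})$ be real-valued with $\|\nu\|_{L^\infty(\mathbb{D})}\le\kappa$ for some $\kappa\in(0,1)$, and let $\phi:\mathbb{D}\to\mathbb{D}$ be a function in $W^{1,\infty}(\mathbb{D})$, analytic in $\mathbb{D}$. If the composition operator $C_\phi:f\mapsto f\circ\phi$ is an isometry from $H^p_\nu(\mathbb{D})$ to $H^p_{\nu\circ\phi}(\mathbb{D})$, then $\phi(\mathbb{T})\subset\mathbb{T}$ and $\phi(0)=0$.
   Context: $\mathbb{D}$ is the open unit disc and $\mathbb{T}=\partial\mathbb{D}$. $H^p_\nu(\mathbb{D})$ is the real vector space of measurable $f:\mathbb{D}\to\mathbb{C}$ solving $\overline\partial f=\nu\,\overline{\partial f}$ in the sense of distributions on $\mathbb{D}$ with $\operatorname{ess\,sup}_{0<r<1}\frac1{2\pi}\int_0^{2\pi}|f(re^{it})|^p\,dt<\infty$. Such $f$ are continuous in $\mathbb{D}$ and have a nontangential limit $\operatorname{tr}f\in L^p(\mathbb{T})$ a.e. on $\mathbb{T}$; here $H^p_\nu(\mathbb{D})$ is equipped with the norm $\|\operatorname{tr}f\|_{L^p(\mathbb{T})}$, and likewise for $H^p_{\nu\circ\phi}(\mathbb{D})$. Since $\phi$ is Lipschitz it extends continuously to $\overline{\mathbb{D}}$, and $\phi(\mathbb{T})$ refers to this extension. An isometry is a linear map $T$ with $\|Tx\|=\|x\|$ for all $x$ (not necessarily onto). *)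

theory Defs
  imports "HOL-Analysis.Analysis"
begin

text \<open>
  Elements of \<open>W\<^sup>1\<^sup>,\<^sup>\<infinity>\<close> and \<open>H\<^sup>p\<^sub>\<nu>\<close> are a.e.-classes with a unique continuous representative on the
  disc. As compositions and boundary limits are taken pointwise, both spaces are rendered by these
  representatives. Functions are total on the complex plane; their values outside the open unit
  disc are never used.
\<close>

abbreviation disc :: "complex set" where
  "disc \<equiv> ball 0 1"

abbreviation circle :: "complex set" where
  "circle \<equiv> sphere 0 1"


subsection \<open>Weak derivatives\<close>

abbreviation ddir :: "complex \<Rightarrow> (complex \<Rightarrow> complex) \<Rightarrow> complex \<Rightarrow> complex" where
  "ddir v \<psi> z \<equiv> frechet_derivative \<psi> (at z) v"

text \<open>\<open>C\<^sup>k\<close> in the real sense (\<open>differentiable_on\<close> refers to the real Frechet derivative).\<close>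

primrec Ck :: "nat \<Rightarrow> (complex \<Rightarrow> complex) \<Rightarrow> bool" where
  "Ck 0 \<psi> \<longleftrightarrow> continuous_on UNIV \<psi>"
| "Ck (Suc k) \<psi> \<longleftrightarrow> \<psi> differentiable_on UNIV \<and> (\<forall>v. Ck k (ddir v \<psi>))"

definition test_function :: "(complex \<Rightarrow> complex) \<Rightarrow> bool" where
  "test_function \<psi> \<longleftrightarrow>
     (\<forall>k. Ck k \<psi>) \<and> (\<exists>K. compact K \<and> K \<subseteq> disc \<and> (\<forall>z. z \<notin> K \<longrightarrow> \<psi> z = 0))"

definition Linf :: "(complex \<Rightarrow> complex) \<Rightarrow> bool" where
  "Linf u \<longleftrightarrow> u \<in> borel_measurable (lebesgue_on disc) \<and>
     (\<exists>C. AE z in lebesgue_on disc. cmod (u z) \<le> C)"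

definition weak_deriv :: "complex \<Rightarrow> (complex \<Rightarrow> complex) \<Rightarrow> (complex \<Rightarrow> complex) \<Rightarrow> bool" where
  "weak_deriv v u g \<longleftrightarrow>
     (\<forall>\<psi>. test_function \<psi> \<longrightarrow>
        (LINT z|lebesgue_on disc. u z * ddir v \<psi> z) = - (LINT z|lebesgue_on disc. g z * \<psi> z))"

text \<open>The partial derivatives with respect to \<open>x\<close> and \<open>y\<close> are those in directions \<open>1\<close> and \<open>\<i>\<close>.\<close>

definition W1inf :: "(complex \<Rightarrow> complex) set" where
  "W1inf = {u. continuous_on disc u \<and> Linf u \<and>
     (\<exists>ux uy. Linf ux \<and> Linf uy \<and> weak_deriv 1 u ux \<and> weak_deriv \<i> u uy)}"


subsection \<open>Generalized Hardy spaces\<close>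

definition dbar :: "(complex \<Rightarrow> complex) \<Rightarrow> complex \<Rightarrow> complex" where
  "dbar \<psi> z = (ddir 1 \<psi> z + \<i> * ddir \<i> \<psi> z) / 2"

text \<open>
  The equation \<open>dbar f = \<nu> * cnj (d f)\<close> in the sense of distributions on the disc, for real \<open>\<nu>\<close> in
  \<open>W\<^sup>1\<^sup>,\<^sup>\<infinity>\<close>. By definition of distributional derivative and conjugate,
  \<open>\<langle>dbar f, \<psi>\<rangle> = - \<integral> f * dbar \<psi>\<close>, \<open>\<langle>cnj (d f), \<psi>\<rangle> = - \<integral> cnj f * dbar \<psi>\<close>, and the product with \<open>\<nu>\<close> is
  \<open>\<langle>\<nu> * cnj (d f), \<psi>\<rangle> = \<langle>cnj (d f), \<nu> * \<psi>\<rangle> = - \<integral> cnj f * (\<nu> * dbar \<psi> + dbar \<nu> * \<psi>)\<close>.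
  Here \<open>dbar \<nu> = (\<nu>x + \<i> * \<nu>y) / 2\<close> is the weak derivative, which is unique a.e.
\<close>

definition conj_beltrami :: "(complex \<Rightarrow> real) \<Rightarrow> (complex \<Rightarrow> complex) \<Rightarrow> bool" where
  "conj_beltrami \<nu> f \<longleftrightarrow>
     (\<exists>\<nu>x \<nu>y. Linf \<nu>x \<and> Linf \<nu>y \<and>
        weak_deriv 1 (\<lambda>z. complex_of_real (\<nu> z)) \<nu>x \<and> weak_deriv \<i> (\<lambda>z. complex_of_real (\<nu> z)) \<nu>y \<and>
        (\<forall>\<psi>. test_function \<psi> \<longrightarrow>
          (LINT z|lebesgue_on disc. f z * dbar \<psi> z) =
          (LINT z|lebesgue_on disc.
             cnj (f z) * (complex_of_real (\<nu> z) * dbar \<psi> z + (\<nu>x z + \<i> * \<nu>y z) / 2 * \<psi> z))))"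

definition Hp :: "real \<Rightarrow> (complex \<Rightarrow> real) \<Rightarrow> (complex \<Rightarrow> complex) set" where
  "Hp p \<nu> = {f. continuous_on disc f \<and> conj_beltrami \<nu> f \<and>
     (\<exists>C. AE r in lebesgue_on {0<..<1}.
        1 / (2 * pi) * (LINT t|lebesgue_on {0..2 * pi}. cmod (f (complex_of_real r * cis t)) powr p)
          \<le> C)}"


subsection \<open>Boundary traces and the norm\<close>

definition stolz :: "real \<Rightarrow> complex \<Rightarrow> complex set" where
  "stolz \<beta> \<zeta> = {z \<in> disc. cmod (z - \<zeta>) < \<beta> * (1 - cmod z)}"

definition nontangential_limit :: "(complex \<Rightarrow> complex) \<Rightarrow> complex \<Rightarrow> complex \<Rightarrow> bool" where
  "nontangential_limit f \<zeta> l \<longleftrightarrow> (\<forall>\<beta>>1. (f \<longlongrightarrow> l) (at \<zeta> within stolz \<beta> \<zeta>))"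

text \<open>
  Arbitrary where the nontangential limit does not exist, which for \<open>f \<in> Hp p \<nu>\<close> is a null set
  when \<open>\<nu>\<close> is as in the theorem.
\<close>

definition tr :: "(complex \<Rightarrow> complex) \<Rightarrow> complex \<Rightarrow> complex" where
  "tr f \<zeta> = (THE l. nontangential_limit f \<zeta> l)"

definition tr_norm :: "real \<Rightarrow> (complex \<Rightarrow> complex) \<Rightarrow> real" where
  "tr_norm p f =
     (1 / (2 * pi) * (LINT t|lebesgue_on {0..2 * pi}. cmod (tr f (cis t)) powr p)) powr (1 / p)"


subsection \<open>Composition operators and isometries\<close>

definition comp_op ::
  "(complex \<Rightarrow> complex) \<Rightarrow> (complex \<Rightarrow> complex) \<Rightarrow> (complex \<Rightarrow> complex)" where
  "comp_op \<phi> f = f \<circ> \<phi>"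

text \<open>Real-linear, norm-preserving, not necessarily onto.\<close>

definition isometry_between ::
  "(complex \<Rightarrow> complex) set \<Rightarrow> ((complex \<Rightarrow> complex) \<Rightarrow> real) \<Rightarrow>
   (complex \<Rightarrow> complex) set \<Rightarrow> ((complex \<Rightarrow> complex) \<Rightarrow> real) \<Rightarrow>
   ((complex \<Rightarrow> complex) \<Rightarrow> (complex \<Rightarrow> complex)) \<Rightarrow> bool" where
  "isometry_between X nX Y nY T \<longleftrightarrow>
     (\<forall>f\<in>X. T f \<in> Y) \<and>
     (\<forall>f\<in>X. \<forall>g\<in>X. T (\<lambda>z. f z + g z) = (\<lambda>z. T f z + T g z)) \<and>
     (\<forall>c::real. \<forall>f\<in>X. T (\<lambda>z. c *\<^sub>R f z) = (\<lambda>z. c *\<^sub>R T f z)) \<and>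
     (\<forall>f\<in>X. nY (T f) = nX f)"

end

theory Submission
  imports Defs "HOL-Complex_Analysis.Complex_Analysis" "HOL-Real_Asymp.Real_Asymp"
begin

text \<open>
  Write \<open>m\<close> for normalised arc length on the circle, \<open>a = \<phi> 0\<close>, and \<open>\<Phi>\<close>, \<open>N\<close> for the continuous
  extensions of \<open>\<phi>\<close>, \<open>\<nu>\<close> to the closed disc. The idea is to test the isometry on solutions that
  concentrate at a single boundary point \<open>\<zeta>0\<close>. Near \<open>\<zeta>0\<close> the Lipschitz coefficient \<open>\<nu>\<close> is almost
  the constant \<open>N \<zeta>0\<close>, and for a constant coefficient \<open>c\<close> the equation is solved by the harmonic
  functions \<open>F = (h + c * cnj h) / (1 - c\<^sup>2)\<close> with \<open>h\<close> holomorphic.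

  For harmonic \<open>F\<close>, Jensen's inequality for the Poisson kernel gives
  \<open>|F b|\<^sup>p \<le> \<integral> |F|\<^sup>p * poisson b dm\<close>, and averaging over \<open>b = \<phi> (r * \<zeta>)\<close> gives
  \<open>\<integral> |F \<circ> \<Phi>|\<^sup>p dm \<le> \<integral> |F|\<^sup>p * poisson a dm\<close>. Suppose now that the conclusion fails. If \<open>a \<noteq> 0\<close>, then
  \<open>poisson a\<close> is smaller than 1 at the boundary point \<open>\<zeta>0\<close> opposite to \<open>a\<close>. If \<open>a = 0\<close>, then
  \<open>poisson a = 1\<close>, but an arc of the circle is mapped into a smaller disc, where a concentrated \<open>F\<close>
  is negligible while its Poisson average is not. Either way there is \<open>q < 1\<close> such that
  \<open>\<integral> |F \<circ> \<Phi>|\<^sup>p dm \<le> q * \<integral> |F|\<^sup>p dm\<close> up to an error that vanishes as \<open>F\<close> concentrates at \<open>\<zeta>0\<close>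
  (lemma \<open>composition_loses_mass\<close>). An isometry cannot lose mass in this way once \<open>F\<close> is uniformly
  close to an element \<open>f\<close> of the Hardy space.

  To find \<open>f\<close>, put \<open>W = f - \<nu> * cnj f\<close>. The equation for \<open>f\<close> says that, weakly,
  \<open>dbar W = - dbar \<nu> * cnj f\<close>, and \<open>f = (W + \<nu> * cnj W) / (1 - \<nu>\<^sup>2)\<close>; no derivative of \<open>W\<close> occurs on
  the right. So it suffices to solve \<open>W = h + S (- dbar \<nu> * cnj f)\<close>, where \<open>S\<close> is a right inverse of
  \<open>dbar\<close>. The plain Cauchy transform need not make this a contraction, but the kernel
  \<open>exp (t * (z - \<zeta>) * cnj \<zeta>) / (z - \<zeta>)\<close> also inverts \<open>dbar\<close>, and measured with the weight
  \<open>exp (- t * |z|\<^sup>2 / 2)\<close> it is bounded by \<open>exp (- t * |z - \<zeta>|\<^sup>2 / 2) / |z - \<zeta>|\<close>. Its norm tends to 0 as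
  \<open>t\<close> grows, so Banach's fixed point theorem solves the equation for every \<open>h\<close>, with \<open>W - h\<close>
  controlled by the potential \<open>\<integral> |h \<zeta>| / |z - \<zeta>| d\<zeta>\<close> (lemma \<open>solve_conj_beltrami\<close>).
  For \<open>h\<close> of unit \<open>L\<^sup>p\<close> mass concentrated at scale \<open>\<delta>\<close>, both this potential and \<open>|z - \<zeta>0| * |h z|\<close> are
  powers of \<open>\<delta>\<close> with positive exponent because \<open>p > 1\<close>. Hence \<open>f - F\<close> is uniformly small
  (lemma \<open>peak_solutions\<close>).
\<close>

section \<open>Smooth bump functions\<close>

lemma ddir_eq:
  assumes "(f has_derivative f') (at z)"
  shows "ddir v f z = f' v"
  using frechet_derivative_at[OF assms] by simp

lemma has_derivative_ddir:
  assumes "f differentiable (at z)"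
  shows "(f has_derivative (\<lambda>v. ddir v f z)) (at z)"
  using assms frechet_derivative_works by blast

lemma ddir_add:
  assumes "f differentiable (at z)" "g differentiable (at z)"
  shows "ddir v (\<lambda>z. f z + g z) z = ddir v f z + ddir v g z"
  by (rule ddir_eq[OF has_derivative_add]) (intro has_derivative_ddir assms)+

lemma ddir_mult:
  assumes "f differentiable (at z)" "g differentiable (at z)"
  shows "ddir v (\<lambda>z. f z * g z) z = f z * ddir v g z + ddir v f z * g z"
  by (rule ddir_eq[OF has_derivative_mult]) (intro has_derivative_ddir assms)+

lemma Ck_Suc_imp_Ck: "Ck (Suc k) f \<Longrightarrow> Ck k f"
proof (induction k arbitrary: f)
  case 0
  then show ?case by (auto intro: differentiable_imp_continuous_on)
next
  case (Suc k)
  then show ?case by auto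
qed

lemma Ck_const: "Ck k (\<lambda>z. c)"
proof (induction k arbitrary: c)
  case (Suc k)
  have "ddir v (\<lambda>z. c) = (\<lambda>z. 0)" for v
    by (rule ext) (rule ddir_eq, rule has_derivative_const)
  then show ?case using Suc[of 0] by simp
qed simp

lemma Ck_inner: "Ck k (\<lambda>z. complex_of_real ((z - a) \<bullet> v))"
proof (cases k)
  case (Suc j)
  have d: "((\<lambda>z. complex_of_real ((z - a) \<bullet> v)) has_derivative (\<lambda>w. complex_of_real (w \<bullet> v))) (at z)" for z
    by (auto intro!: derivative_eq_intros)
  have "ddir w (\<lambda>z. complex_of_real ((z - a) \<bullet> v)) = (\<lambda>z. complex_of_real (w \<bullet> v))" for w
    by (rule ext) (rule ddir_eq[OF d])
  then show ?thesis using Suc d by (auto simp: Ck_const differentiable_on_def differentiable_def)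
qed (auto intro!: continuous_intros)

lemma Ck_add: "Ck k f \<Longrightarrow> Ck k g \<Longrightarrow> Ck k (\<lambda>z. f z + g z)"
proof (induction k arbitrary: f g)
  case (Suc k)
  then have "ddir v (\<lambda>z. f z + g z) = (\<lambda>z. ddir v f z + ddir v g z)" for v
    by (intro ext ddir_add) (auto simp: differentiable_on_def)
  then show ?case using Suc by auto
qed (auto intro!: continuous_intros)

lemma Ck_mult: "Ck k f \<Longrightarrow> Ck k g \<Longrightarrow> Ck k (\<lambda>z. f z * g z)"
proof (induction k arbitrary: f g)
  case (Suc k)
  then have "ddir v (\<lambda>z. f z * g z) = (\<lambda>z. f z * ddir v g z + ddir v f z * g z)" for v
    by (intro ext ddir_mult) (auto simp: differentiable_on_def)
  moreover have "Ck k f" "Ck k g" using Suc.prems Ck_Suc_imp_Ck by blast+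
  ultimately show ?case using Suc by (auto intro!: Ck_add)
qed (auto intro!: continuous_intros)

text \<open>
  The bump functions are built from \<open>exp (- 1 / s) / s ^ m\<close>, extended by 0. Keeping the exponent
  \<open>m\<close> makes the family closed under differentiation, so smoothness of all orders follows by one
  induction.
\<close>

definition flat :: "nat \<Rightarrow> real \<Rightarrow> real" where
  "flat m s = (if s > 0 then exp (- 1 / s) / s ^ m else 0)"

lemma flat_nonneg: "flat m s \<ge> 0"
  by (simp add: flat_def)

lemma flat_tendsto_0: "(flat m \<longlongrightarrow> 0) (at 0)"
proof -
  have "((\<lambda>s. exp (- 1 / s) / s ^ m) \<longlongrightarrow> 0) (at_right (0::real))"
    by real_asymp
  then have "(flat m \<longlongrightarrow> 0) (at_right 0)"
    by (rule Lim_transform_eventually) (auto simp: flat_def eventually_at_filter)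
  moreover have "(flat m \<longlongrightarrow> 0) (at_left 0)"
    by (rule Lim_transform_eventually[OF tendsto_const]) (auto simp: flat_def eventually_at_filter)
  ultimately show ?thesis by (simp add: filterlim_split_at)
qed

lemma flat_has_derivative:
  "(flat m has_real_derivative (flat (m + 2) s - m * flat (m + 1) s)) (at s)"
proof -
  consider "s > 0" | "s < 0" | "s = 0" by linarith
  then show ?thesis
  proof cases
    case 1
    have "((\<lambda>s. exp (- 1 / s) / s ^ m) has_real_derivative (flat (m + 2) s - m * flat (m + 1) s)) (at s)"
    proof (cases "m = 0")
      case False
      then have "s ^ m = s * s ^ (m - 1)" by (cases m) auto
      then show ?thesis
        using 1 by (auto intro!: derivative_eq_intros simp: flat_def field_simps power2_eq_square)
    qed (use 1 in \<open>auto intro!: derivative_eq_intros simp: flat_def field_simps power2_eq_square\<close>)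
    then show ?thesis
      by (rule has_field_derivative_transform_within_open[where S="{0<..}"])
         (use 1 in \<open>auto simp: flat_def\<close>)
  next
    case 2
    have "((\<lambda>s. 0) has_real_derivative (flat (m + 2) s - m * flat (m + 1) s)) (at s)"
      using 2 by (simp add: flat_def)
    then show ?thesis
      by (rule has_field_derivative_transform_within_open[where S="{..<0}"])
         (use 2 in \<open>auto simp: flat_def\<close>)
  next
    case 3
    have "(\<lambda>h. (flat m (0 + h) - flat m 0) / h) = flat (Suc m)"
      by (auto simp: flat_def fun_eq_iff)
    then show ?thesis
      using flat_tendsto_0[of "Suc m"] 3 unfolding DERIV_def by (simp add: flat_def[of _ 0])
  qed
qed

definition bump :: "nat \<Rightarrow> complex \<Rightarrow> real \<Rightarrow> complex \<Rightarrow> complex" where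
  "bump m a e z = complex_of_real (flat m (e\<^sup>2 - (cmod (z - a))\<^sup>2))"

lemma bump_has_derivative:
  "(bump m a e has_derivative (\<lambda>v. (of_nat m * bump (m + 1) a e z - bump (m + 2) a e z)
     * complex_of_real (2 * ((z - a) \<bullet> v)))) (at z)"
proof -
  have 1: "((\<lambda>z. e\<^sup>2 - (z - a) \<bullet> (z - a)) has_derivative (\<lambda>v. - 2 * ((z - a) \<bullet> v))) (at z)"
    by (auto intro!: derivative_eq_intros simp: inner_commute)
  have "((\<lambda>z. flat m (e\<^sup>2 - (z - a) \<bullet> (z - a))) has_derivative
     (\<lambda>v. (- 2 * ((z - a) \<bullet> v)) * (flat (m + 2) (e\<^sup>2 - (z - a) \<bullet> (z - a)) - m * flat (m + 1) (e\<^sup>2 - (z - a) \<bullet> (z - a))))) (at z)"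
    using has_derivative_compose[OF 1 flat_has_derivative[unfolded has_field_derivative_def]]
    by (simp add: mult.commute)
  from has_derivative_of_real[OF this]
  show ?thesis
    unfolding bump_def power2_norm_eq_inner
    by (rule has_derivative_eq_rhs) (auto simp: fun_eq_iff algebra_simps)
qed

text \<open>
  A directional derivative of \<open>bump m\<close> is a combination of \<open>bump (m + 1)\<close> and \<open>bump (m + 2)\<close> with
  affine coefficients, so the induction on \<open>k\<close> runs for all \<open>m\<close> at once.
\<close>

lemma Ck_bump: "Ck k (bump m a e)"
proof (induction k arbitrary: m)
  case 0
  show ?case using bump_has_derivative[THEN has_derivative_continuous]
    by (auto simp: continuous_on_eq_continuous_at)
next
  case (Suc k)
  have "ddir v (bump m a e) = (\<lambda>z. (of_nat m * bump (m + 1) a e z + (-1) * bump (m + 2) a e z)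
     * (2 * complex_of_real ((z - a) \<bullet> v)))" for v
    by (rule ext) (subst ddir_eq[OF bump_has_derivative], simp)
  moreover have "Ck k (\<lambda>z. (of_nat m * bump (m + 1) a e z + (-1) * bump (m + 2) a e z)
     * (2 * complex_of_real ((z - a) \<bullet> v)))" for v
    by (intro Ck_mult Ck_add Ck_const Ck_inner Suc)
  moreover have "bump m a e differentiable_on UNIV"
    using bump_has_derivative[of m a e] unfolding differentiable_on_def differentiable_def by blast
  ultimately show ?case by simp
qed

lemma bump_eq_0: "0 \<le> e \<Longrightarrow> e \<le> cmod (z - a) \<Longrightarrow> bump m a e z = 0"
proof -
  assume "0 \<le> e" "e \<le> cmod (z - a)"
  then have "\<not> 0 < e\<^sup>2 - (cmod (z - a))\<^sup>2"
    using power_mono[of e "cmod (z - a)" 2] by linarith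
  then show ?thesis unfolding bump_def flat_def by simp
qed

lemma test_function_bump:
  assumes "0 \<le> e" "cball a e \<subseteq> disc"
  shows "test_function (bump m a e)"
  unfolding test_function_def
proof (intro conjI allI exI[of _ "cball a e"] Ck_bump)
  show "z \<notin> cball a e \<longrightarrow> bump m a e z = 0" for z
    using bump_eq_0[of e z a m] assms by (auto simp: dist_norm norm_minus_commute)
qed (use assms in auto)

section \<open>Riesz potentials of the disc\<close>

lemma ball_in_borel [measurable]: "ball (a::complex) r \<in> sets borel"
  by simp

lemma dyadic_shell:
  assumes "0 < (x::real)" "x < 1"
  obtains k :: nat where "x < (1/2) ^ k" "(1/2) ^ Suc k \<le> x"
proof -
  have ex: "\<exists>n. (1/2) ^ n \<le> x"
    using real_arch_pow_inv[of x "1/2"] assms by (auto intro: less_imp_le)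
  define n where "n = (LEAST n. (1/2) ^ n \<le> x)"
  have n: "(1/2) ^ n \<le> x" unfolding n_def using ex by (rule LeastI_ex)
  have "n \<noteq> 0" using n assms by (intro notI) auto
  then obtain k where k: "n = Suc k" by (cases n) auto
  have "\<not> (1/2) ^ k \<le> x" using not_less_Least[of k "\<lambda>n. (1/2) ^ n \<le> x"] k n_def by auto
  then show ?thesis using that[of k] n k by auto
qed

text \<open>
  On the dyadic shell \<open>2\<^sup>-\<^sup>k\<^sup>-\<^sup>1 \<le> |w| < 2\<^sup>-\<^sup>k\<close> the integrand is at most \<open>2 powr (s * (k + 1))\<close> and the
  area at most \<open>\<pi> * 4\<^sup>-\<^sup>k\<close>; the resulting geometric series converges because \<open>2 powr s < 4\<close>.
\<close>

lemma nn_integral_powr_ball_finite: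
  fixes s :: real
  assumes "0 < s" "s < 2"
  shows "(\<integral>\<^sup>+w. ennreal (cmod w powr (- s)) * indicator (ball 0 1) w \<partial>lborel) < \<infinity>"
proof -
  define q :: real where "q = 2 powr s / 4"
  have q: "0 < q" "q < 1"
    using powr_less_mono[of s 2 2] assms by (auto simp: q_def)
  have V: "emeasure lborel (ball (0::complex) ((1/2)^k)) = ennreal (pi * (1/4)^k)" for k :: nat
    using emeasure_ball[of "(1/2)^k" "0::complex"]
    using power_mult[of "2::real" 2 k] by (simp add: unit_ball_vol_2 power_divide mult.commute flip: power_mult)
  define g where "g k w = ennreal (2 powr (s * real (Suc k))) * indicator (ball 0 ((1/2)^k)) w" for k :: nat and w :: complex
  have le: "ennreal (cmod w powr (- s)) * indicator (ball 0 1) w \<le> (\<Sum>k. g k w)" for w :: complex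
  proof (cases "w \<in> ball 0 1 - {0}")
    case True
    then obtain k where k: "cmod w < (1/2)^k" "(1/2)^Suc k \<le> cmod w"
      using dyadic_shell[of "cmod w"] by auto
    have "cmod w powr (- s) \<le> ((1/2)^Suc k) powr (- s)"
      using k(2) assms by (intro powr_mono2') auto
    also have "(1/2::real)^Suc k = 2 powr (- real (Suc k))"
      by (subst powr_minus, subst powr_realpow) (simp_all add: power_one_over inverse_eq_divide)
    also have "(2 powr (- real (Suc k))) powr (- s) = 2 powr (s * real (Suc k))"
      by (simp add: powr_powr algebra_simps)
    finally have "ennreal (cmod w powr (- s)) * indicator (ball 0 1) w \<le> g k w"
      using k True by (auto simp: g_def intro!: ennreal_leI)
    also have "g k w \<le> (\<Sum>k. g k w)"
      using sum_le_suminf[of "\<lambda>k. g k w" "{k}"] by auto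
    finally show ?thesis .
  qed (auto simp: indicator_def)
  have "(\<integral>\<^sup>+w. ennreal (cmod w powr (- s)) * indicator (ball 0 1) w \<partial>lborel) \<le> (\<integral>\<^sup>+w. (\<Sum>k. g k w) \<partial>lborel)"
    by (intro nn_integral_mono le)
  also have "\<dots> = (\<Sum>k. \<integral>\<^sup>+w. g k w \<partial>lborel)"
    by (rule nn_integral_suminf) (auto simp: g_def)
  also have "\<dots> = (\<Sum>k. ennreal (2 powr s * pi * q ^ k))"
  proof (rule suminf_cong)
    fix k
    have "(\<integral>\<^sup>+w. g k w \<partial>lborel) = ennreal (2 powr (s * real (Suc k))) * ennreal (pi * (1/4)^k)"
      unfolding g_def by (subst nn_integral_cmult_indicator) (auto simp: V)
    also have "\<dots> = ennreal (2 powr (s * real (Suc k)) * (pi * (1/4)^k))"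
      by (simp add: ennreal_mult)
    also have "2 powr (s * real (Suc k)) = 2 powr s * (2 powr s) ^ k"
      by (simp add: powr_realpow[symmetric] powr_powr powr_add[symmetric] algebra_simps)
    also have "2 powr s * (2 powr s) ^ k * (pi * (1/4)^k) = 2 powr s * pi * q ^ k"
      by (simp add: q_def power_divide)
    finally show "(\<integral>\<^sup>+w. g k w \<partial>lborel) = ennreal (2 powr s * pi * q ^ k)" .
  qed
  also have "\<dots> < \<infinity>"
    using q by (subst suminf_ennreal2) (auto intro!: summable_mult summable_geometric)
  finally show ?thesis .
qed

text \<open>
  A bound, uniform in \<open>z\<close>, for the potential \<open>\<integral> |z - w|\<^sup>-\<^sup>s dw\<close> over the disc: where \<open>|z - w| < 1\<close> the
  integral is at most that over the unit ball around \<open>z\<close>, and elsewhere the integrand is at most 1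
  on a set of area at most \<open>\<pi>\<close>.
\<close>

definition riesz_bound :: "real \<Rightarrow> real" where
  "riesz_bound s = enn2real (\<integral>\<^sup>+w. ennreal (cmod w powr (- s)) * indicator (ball 0 1) w \<partial>lborel) + pi"

lemma riesz_bound_pos: "riesz_bound s > 0"
  unfolding riesz_bound_def by (intro add_nonneg_pos) auto

lemma nn_integral_riesz_le:
  fixes s :: real and z :: complex
  assumes s: "0 < s" "s < 2"
  shows "(\<integral>\<^sup>+w. ennreal (cmod (z - w) powr (- s)) * indicator disc w \<partial>lborel) \<le> ennreal (riesz_bound s)"
proof -
  let ?I = "\<integral>\<^sup>+w. ennreal (cmod w powr (- s)) * indicator (ball 0 1) w \<partial>lborel"
  have "(\<integral>\<^sup>+w. ennreal (cmod (z - w) powr (- s)) * indicator disc w \<partial>lborel)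
     \<le> (\<integral>\<^sup>+w. ennreal (cmod (- z + w) powr (- s)) * indicator (ball 0 1) (- z + w) + indicator disc w \<partial>lborel)"
  proof (rule nn_integral_mono)
    fix w
    have [simp]: "cmod (- z + w) = cmod (z - w)" by (simp add: norm_minus_commute)
    have "cmod (z - w) powr (- s) \<le> 1" if "\<not> cmod (z - w) < 1"
      using that s powr_mono2'[of "- s" 1 "cmod (z - w)"] by simp
    then show "ennreal (cmod (z - w) powr (- s)) * indicator disc w
      \<le> ennreal (cmod (- z + w) powr (- s)) * indicator (ball 0 1) (- z + w) + indicator disc w"
      by (cases "cmod (z - w) < 1") (auto simp: indicator_def norm_minus_commute[of w z])
  qed
  also have "\<dots> = (\<integral>\<^sup>+w. ennreal (cmod (- z + w) powr (- s)) * indicator (ball 0 1) (- z + w) \<partial>lborel)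
      + (\<integral>\<^sup>+w. indicator disc w \<partial>lborel)"
    by (rule nn_integral_add) measurable
  also have "(\<integral>\<^sup>+w. ennreal (cmod (- z + w) powr (- s)) * indicator (ball 0 1) (- z + w) \<partial>lborel)
      = (\<integral>\<^sup>+w. ennreal (cmod w powr (- s)) * indicator (ball 0 1) w \<partial>distr lborel borel ((+) (- z)))"
    by (subst nn_integral_distr) auto
  also have "\<dots> = ?I" by (simp add: lborel_distr_plus)
  also have "(\<integral>\<^sup>+w. indicator disc w \<partial>lborel) = ennreal pi"
    using emeasure_ball[of 1 "0::complex"] by (simp add: unit_ball_vol_2)
  also have "?I = ennreal (enn2real ?I)"
    using nn_integral_powr_ball_finite[OF s] by simp
  also have "\<dots> + ennreal pi = ennreal (riesz_bound s)"
    by (simp add: riesz_bound_def)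
  finally show ?thesis .
qed

lemma integrable_riesz:
  assumes "0 < s" "s < 2"
  shows "integrable lborel (\<lambda>w::complex. indicator disc w * cmod (z - w) powr (- s))"
    and "(LINT w|lborel. indicator disc w * cmod (z - w) powr (- s)) \<le> riesz_bound s"
proof -
  have eq: "(\<integral>\<^sup>+w. ennreal (indicator disc w * cmod (z - w) powr (- s)) \<partial>lborel)
     = (\<integral>\<^sup>+w. ennreal (cmod (z - w) powr (- s)) * indicator disc w \<partial>lborel)"
    by (intro nn_integral_cong) (auto simp: indicator_def)
  show "integrable lborel (\<lambda>w::complex. indicator disc w * cmod (z - w) powr (- s))"
  proof (rule integrableI_nonneg)
    show "(\<integral>\<^sup>+w. ennreal (indicator disc w * cmod (z - w) powr (- s)) \<partial>lborel) < \<infinity>"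
      using nn_integral_riesz_le[OF assms, of z] eq
      by (metis ennreal_less_top infinity_ennreal_def le_less_trans)
    show "(\<lambda>w::complex. indicator disc w * cmod (z - w) powr (- s)) \<in> borel_measurable lborel"
      by measurable
  qed auto
  show "(LINT w|lborel. indicator disc w * cmod (z - w) powr (- s)) \<le> riesz_bound s"
    using nn_integral_riesz_le[OF assms, of z] riesz_bound_pos[of s] unfolding eq[symmetric]
    by (subst integral_eq_nn_integral) (measurable, auto intro!: enn2real_leI)
qed

section \<open>Integration by parts for compactly supported functions\<close>

text \<open>
  The difference quotients are dominated by \<open>2 * w\<close> by the mean value inequality, so dominated
  convergence applies to the remainder of the derivative.
\<close>

lemma has_vector_derivative_lborel_integral:
  fixes f f' :: "real \<Rightarrow> complex \<Rightarrow> complex"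
  assumes r: "0 < r"
    and d: "\<And>s z. s \<in> ball s0 r \<Longrightarrow> ((\<lambda>s. f s z) has_vector_derivative f' s z) (at s)"
    and int: "\<And>s. s \<in> ball s0 r \<Longrightarrow> integrable lborel (f s)"
    and m: "f' s0 \<in> borel_measurable borel"
    and w: "integrable lborel w" "\<And>s z. s \<in> ball s0 r \<Longrightarrow> cmod (f' s z) \<le> w z"
  shows "((\<lambda>s. LINT z|lborel. f s z) has_vector_derivative (LINT z|lborel. f' s0 z)) (at s0)"
proof -
  define R where "R h z = norm (f (s0 + h) z - f s0 z - h *\<^sub>R f' s0 z) / \<bar>h\<bar>" for h z
  have s0: "s0 \<in> ball s0 r" using r by simp
  have int': "integrable lborel (f' s0)"
  proof (rule Bochner_Integration.integrable_bound[OF w(1)])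
    show "AE z in lborel. cmod (f' s0 z) \<le> norm (w z)"
    proof (rule AE_I2)
      show "cmod (f' s0 z) \<le> norm (w z)" for z using w(2)[OF s0, of z] by simp
    qed
  qed (use m in simp)
  have meas: "f (s0 + h) \<in> borel_measurable borel" if "\<bar>h\<bar> < r" for h
    using int[of "s0 + h"] that by (auto simp: dist_norm dest: borel_measurable_integrable)
  have Rle: "R h z \<le> 2 * w z" if h: "\<bar>h\<bar> < r" "h \<noteq> 0" for h z
  proof -
    have "norm (f (s0 + h) z - f s0 z) \<le> w z * norm ((s0 + h) - s0)"
    proof (rule differentiable_bound[where S = "ball s0 r" and f = "\<lambda>s. f s z" and f' = "\<lambda>s h. h *\<^sub>R f' s z"])
      fix s assume s: "s \<in> ball s0 r"
      show "((\<lambda>s. f s z) has_derivative (\<lambda>h. h *\<^sub>R f' s z)) (at s within ball s0 r)"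
        using d[OF s] unfolding has_vector_derivative_def by (rule has_derivative_at_withinI)
      show "onorm (\<lambda>h. h *\<^sub>R f' s z) \<le> w z"
        using w(2)[OF s, of z] order.trans[OF norm_ge_zero w(2)[OF s, of z]]
        by (intro onorm_bound) (auto simp: mult.commute intro: mult_left_mono)
    qed (use h in \<open>auto simp: dist_norm\<close>)
    moreover have "norm (h *\<^sub>R f' s0 z) \<le> w z * \<bar>h\<bar>"
      using w(2)[OF s0, of z] by (simp add: mult.commute mult_left_mono)
    ultimately have "norm (f (s0 + h) z - f s0 z - h *\<^sub>R f' s0 z) \<le> 2 * w z * \<bar>h\<bar>"
      using norm_triangle_ineq4[of "f (s0 + h) z - f s0 z" "h *\<^sub>R f' s0 z"] by simp
    then show ?thesis using h by (simp add: R_def field_simps)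
  qed
  have bl: "bounded_linear (\<lambda>h. h *\<^sub>R (LINT z|lborel. f' s0 z))"
    by (rule bounded_linear_scaleR_left)
  have "((\<lambda>h. norm ((LINT z|lborel. f (s0 + h) z) - (LINT z|lborel. f s0 z) - h *\<^sub>R (LINT z|lborel. f' s0 z)) / norm h)
     \<longlongrightarrow> 0) (at 0)"
    unfolding tendsto_at_iff_sequentially
  proof safe
    fix X :: "nat \<Rightarrow> real"
    assume X: "\<forall>i. X i \<in> UNIV - {0}" "X \<longlonglongrightarrow> 0"
    from X(2) r have "\<forall>\<^sub>F i in sequentially. \<bar>X i\<bar> < r"
      by (auto simp: tendsto_iff dist_norm)
    then obtain N where N: "\<And>i. i \<ge> N \<Longrightarrow> \<bar>X i\<bar> < r"
      by (auto simp: eventually_sequentially)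
    define Y where "Y i = X (i + N)" for i
    have Y: "\<bar>Y i\<bar> < r" "Y i \<noteq> 0" for i using N X(1) by (auto simp: Y_def)
    have Y0: "Y \<longlonglongrightarrow> 0" unfolding Y_def using X(2) by (rule LIMSEQ_ignore_initial_segment)
    have lim: "(\<lambda>i. LINT z|lborel. R (Y i) z) \<longlonglongrightarrow> (LINT (z::complex)|lborel. 0 :: real)"
    proof (rule integral_dominated_convergence[where f = "\<lambda>_. 0" and s = "\<lambda>i. R (Y i)" and w = "\<lambda>z. 2 * w z"])
      show "integrable lborel (\<lambda>z. 2 * w z)" using w(1) by simp
      show "AE z in lborel. (\<lambda>i. R (Y i) z) \<longlonglongrightarrow> 0"
      proof (rule AE_I2)
        fix z
        have "((\<lambda>h. R h z) \<longlongrightarrow> 0) (at 0)"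
          using d[OF s0, of z] unfolding has_vector_derivative_def has_derivative_at R_def by simp
        then show "(\<lambda>i. R (Y i) z) \<longlonglongrightarrow> 0"
          using Y Y0 unfolding tendsto_at_iff_sequentially by (auto simp: o_def)
      qed
      show "AE z in lborel. norm (R (Y i) z) \<le> 2 * w z" for i
        using Rle[OF Y[of i]] by (auto simp: R_def)
      show "R (Y i) \<in> borel_measurable lborel" for i
        using meas[OF Y(1)[of i]] meas[of 0] m r unfolding R_def by simp
    qed auto
    have bd: "norm ((LINT z|lborel. f (s0 + Y i) z) - (LINT z|lborel. f s0 z) - Y i *\<^sub>R (LINT z|lborel. f' s0 z)) / norm (Y i)
       \<le> (LINT z|lborel. R (Y i) z)" for i
    proof -
      have 1: "integrable lborel (f (s0 + Y i))" "integrable lborel (f s0)"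
        using int Y(1)[of i] r by (auto simp: dist_norm)
      have "(LINT z|lborel. f (s0 + Y i) z) - (LINT z|lborel. f s0 z) - Y i *\<^sub>R (LINT z|lborel. f' s0 z)
        = (LINT z|lborel. f (s0 + Y i) z - f s0 z - Y i *\<^sub>R f' s0 z)"
        using 1 int' by simp
      also have "norm \<dots> \<le> (LINT z|lborel. norm (f (s0 + Y i) z - f s0 z - Y i *\<^sub>R f' s0 z))"
        by (rule integral_norm_bound)
      finally show ?thesis using Y(2)[of i] by (simp add: R_def divide_right_mono)
    qed
    have "(\<lambda>i. norm ((LINT z|lborel. f (s0 + Y i) z) - (LINT z|lborel. f s0 z) - Y i *\<^sub>R (LINT z|lborel. f' s0 z)) / norm (Y i)) \<longlonglongrightarrow> 0"
      by (rule tendsto_sandwich[OF _ _ tendsto_const lim[unfolded integral_zero]]) (use bd in auto)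
    then show "((\<lambda>h. norm ((LINT z|lborel. f (s0 + h) z) - (LINT z|lborel. f s0 z) - h *\<^sub>R (LINT z|lborel. f' s0 z)) / norm h) \<circ> X) \<longlonglongrightarrow> 0"
      unfolding Y_def o_def by (rule LIMSEQ_offset)
  qed
  then show ?thesis
    unfolding has_vector_derivative_def has_derivative_at using bl by blast
qed

lemma integral_pos_of_continuous:
  fixes k :: "complex \<Rightarrow> real"
  assumes "integrable lborel k" "continuous_on UNIV k" "\<And>z. 0 \<le> k z" "0 < k z0"
  shows "0 < (LINT z|lborel. k z)"
proof -
  have "(LINT z|lborel. k z) \<noteq> 0"
  proof
    assume "(LINT z|lborel. k z) = 0"
    then have "AE z in lborel. k z = 0"
      using integral_nonneg_eq_0_iff_AE[of lborel k] assms by auto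
    then have "AE z in lborel. z \<notin> {z. 0 < k z}"
      by (rule eventually_mono) auto
    then have "AE z in lebesgue. z \<notin> {z. 0 < k z}"
      by (rule AE_completion)
    then have "negligible {z. 0 < k z}"
      using AE_iff_null_sets[of "{z. 0 < k z}" lebesgue] open_Collect_less[OF continuous_on_const assms(2)]
      by (simp add: negligible_iff_null_sets)
    moreover have "open {z. 0 < k z}" using assms(2) by (intro open_Collect_less) auto
    ultimately show False using open_not_negligible assms(4) by blast
  qed
  moreover have "0 \<le> (LINT z|lborel. k z)" using assms(3) by simp
  ultimately show ?thesis by linarith
qed

text \<open>
  Test functions are multiplied below by kernels and by holomorphic functions. For the products, this
  class asks for what integration by parts needs instead of smoothness of all orders.
\<close>

definition C1_supported :: "(complex \<Rightarrow> complex) \<Rightarrow> real \<Rightarrow> bool" where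
  "C1_supported \<Psi> R \<longleftrightarrow> (\<forall>z. \<Psi> differentiable (at z)) \<and> (\<forall>v. continuous_on UNIV (ddir v \<Psi>))
     \<and> (\<forall>z. R \<le> cmod z \<longrightarrow> \<Psi> z = 0)"

lemma C1_supported_continuous:
  assumes "C1_supported \<Psi> R"
  shows "continuous_on UNIV \<Psi>"
  using assms unfolding C1_supported_def
  by (auto simp: continuous_on_eq_continuous_at intro: differentiable_imp_continuous_within)

lemma ddir_eq_0_off_cball:
  assumes "C1_supported \<Psi> R" "R < cmod z"
  shows "ddir v \<Psi> z = 0"
proof -
  have "((\<lambda>z. 0) has_derivative (\<lambda>v. 0)) (at z)" by simp
  then have "(\<Psi> has_derivative (\<lambda>v. 0)) (at z)"
    by (rule has_derivative_transform_within_open[OF _ open_Compl[OF closed_cball[of 0 R]]])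
       (use assms in \<open>auto simp: C1_supported_def\<close>)
  then show ?thesis by (rule ddir_eq)
qed

text \<open>
  On the boundary sphere the derivative vanishes by continuity.
\<close>

lemma ddir_eq_0_off_ball:
  assumes "C1_supported \<Psi> R" "R \<le> cmod z"
  shows "ddir v \<Psi> z = 0"
proof -
  have "closed {z. ddir v \<Psi> z = 0}"
    using assms by (intro closed_Collect_eq continuous_on_const) (auto simp: C1_supported_def)
  moreover have "- cball 0 R \<subseteq> {z. ddir v \<Psi> z = 0}"
    using ddir_eq_0_off_cball[OF assms(1)] by auto
  ultimately have "closure (- cball 0 R) \<subseteq> {z. ddir v \<Psi> z = 0}"
    by (rule closure_minimal[rotated])
  moreover have "z \<in> closure (- cball 0 R)"
    using assms(2) by (simp add: closure_complement)
  ultimately show ?thesis by blast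
qed

lemma bounded_integrable_supported:
  fixes f :: "complex \<Rightarrow> 'a :: {banach, second_countable_topology}"
  assumes "f \<in> borel_measurable borel" "\<And>z. norm (f z) \<le> C" "\<And>z. R < cmod z \<Longrightarrow> f z = 0"
  shows "integrable lborel f"
proof (rule Bochner_Integration.integrable_bound)
  show "integrable lborel (\<lambda>z::complex. indicator (cball 0 R) z * C)"
    by (intro integrable_mult_left integrable_real_indicator)
       (simp, use emeasure_bounded_finite[of "cball (0::complex) R"] in simp)
  show "AE z in lborel. norm (f z) \<le> norm (indicator (cball 0 R) z * C)"
  proof (rule AE_I2)
    fix z
    show "norm (f z) \<le> norm (indicator (cball 0 R) z * C)"
      using assms(2)[of z] assms(3)[of z] norm_ge_zero[of "f z"] by (cases "R < cmod z") (simp_all add: indicator_def)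
  qed
qed (use assms in auto)

lemma continuous_supported_bounded:
  fixes f :: "complex \<Rightarrow> complex"
  assumes "continuous_on UNIV f" "\<And>z. R < cmod z \<Longrightarrow> f z = 0"
  obtains C where "0 \<le> C" "\<And>z. cmod (f z) \<le> C"
proof -
  have "bounded (f ` cball 0 R)"
    by (intro compact_imp_bounded compact_continuous_image continuous_on_subset[OF assms(1)]) auto
  then obtain C where C: "0 < C" "\<And>z. z \<in> cball 0 R \<Longrightarrow> cmod (f z) \<le> C"
    by (auto simp: bounded_pos)
  show ?thesis
  proof (rule that)
    show "0 \<le> C" using C(1) by simp
    show "cmod (f z) \<le> C" for z
      using C(1) C(2)[of z] assms(2)[of z] by (cases "R < cmod z") auto
  qed
qed

lemma continuous_supported_integrable:
  fixes f :: "complex \<Rightarrow> complex"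
  assumes "continuous_on UNIV f" "\<And>z. R < cmod z \<Longrightarrow> f z = 0"
  shows "integrable lborel f"
proof -
  obtain C where "\<And>z. cmod (f z) \<le> C" using continuous_supported_bounded[OF assms] by metis
  then show ?thesis
    using bounded_integrable_supported[of f C R] assms borel_measurable_continuous_onI by blast
qed

text \<open>
  By translation invariance \<open>\<integral> \<Psi> (z + s * v) dz\<close> does not depend on \<open>s\<close>; differentiate at
  \<open>s = 0\<close>.
\<close>

lemma integral_ddir_eq_0:
  assumes "C1_supported \<Psi> R"
  shows "(LINT z|lborel. ddir v \<Psi> z) = 0"
proof -
  have cont: "continuous_on UNIV (ddir v \<Psi>)" "continuous_on UNIV \<Psi>"
    using assms C1_supported_continuous by (auto simp: C1_supported_def)
  obtain C where C: "0 \<le> C" "\<And>z. cmod (ddir v \<Psi> z) \<le> C"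
    using continuous_supported_bounded[OF cont(1)] ddir_eq_0_off_cball[OF assms] by metis
  have "((\<lambda>s. LINT z|lborel. \<Psi> (z + s *\<^sub>R v)) has_vector_derivative (LINT z|lborel. ddir v \<Psi> (z + 0 *\<^sub>R v))) (at 0)"
  proof (rule has_vector_derivative_lborel_integral[where r = 1 and w = "\<lambda>z. indicator (cball 0 (R + cmod v)) z * C"])
    fix s :: real and z
    assume s: "s \<in> ball 0 1"
    have "((\<lambda>s. z + s *\<^sub>R v) has_derivative (\<lambda>h. h *\<^sub>R v)) (at s)"
      by (auto intro!: derivative_eq_intros)
    moreover have D: "(\<Psi> has_derivative (\<lambda>v. ddir v \<Psi> (z + s *\<^sub>R v'))) (at (z + s *\<^sub>R v'))" for v'
      using assms has_derivative_ddir by (auto simp: C1_supported_def)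
    ultimately have "((\<lambda>s. \<Psi> (z + s *\<^sub>R v)) has_derivative (\<lambda>h. ddir (h *\<^sub>R v) \<Psi> (z + s *\<^sub>R v))) (at s)"
      using has_derivative_compose by blast
    moreover have "ddir (h *\<^sub>R v) \<Psi> (z + s *\<^sub>R v) = h *\<^sub>R ddir v \<Psi> (z + s *\<^sub>R v)" for h
      using has_derivative_linear[OF D[of v]] linear_scale by blast
    ultimately show "((\<lambda>s. \<Psi> (z + s *\<^sub>R v)) has_vector_derivative ddir v \<Psi> (z + s *\<^sub>R v)) (at s)"
      by (simp add: has_vector_derivative_def)
    have small: "cmod (s *\<^sub>R v) \<le> cmod v" using s by (auto intro: mult_left_le_one_le)
    then have small': "R < cmod (z + s *\<^sub>R v)" if "R + cmod v < cmod z"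
      using norm_triangle_ineq2[of z "- (s *\<^sub>R v)"] that by simp
    show "cmod (ddir v \<Psi> (z + s *\<^sub>R v)) \<le> indicator (cball 0 (R + cmod v)) z * C"
      using C(2)[of "z + s *\<^sub>R v"] ddir_eq_0_off_cball[OF assms small']
      by (auto simp: indicator_def)
  next
    fix s :: real
    assume s: "s \<in> ball 0 1"
    show "integrable lborel (\<lambda>z. \<Psi> (z + s *\<^sub>R v))"
    proof (rule continuous_supported_integrable[where R = "R + cmod v"])
      show "continuous_on UNIV (\<lambda>z. \<Psi> (z + s *\<^sub>R v))"
        by (rule continuous_on_compose2[OF cont(2)]) (auto intro!: continuous_intros)
      show "R + cmod v < cmod z \<Longrightarrow> \<Psi> (z + s *\<^sub>R v) = 0" for z
      proof -
        assume "R + cmod v < cmod z"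
        moreover have "cmod (s *\<^sub>R v) \<le> cmod v" using s by (auto intro: mult_left_le_one_le)
        ultimately have "R < cmod (z + s *\<^sub>R v)"
          using norm_triangle_ineq2[of z "- (s *\<^sub>R v)"] by simp
        then show ?thesis using assms by (auto simp: C1_supported_def)
      qed
    qed
  next
    show "integrable lborel (\<lambda>z::complex. indicator (cball 0 (R + cmod v)) z * C)"
      by (rule bounded_integrable_supported[of _ C "R + cmod v"]) (use C in \<open>auto simp: indicator_def\<close>)
    show "(\<lambda>z. ddir v \<Psi> (z + 0 *\<^sub>R v)) \<in> borel_measurable borel"
      using cont(1) by (auto intro: borel_measurable_continuous_onI)
  qed auto
  moreover have "(LINT z|lborel. \<Psi> (z + s *\<^sub>R v)) = (LINT z|lborel. \<Psi> z)" for s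
  proof -
    have "(LINT z|lborel. \<Psi> z) = (LINT z|distr lborel borel ((+) (s *\<^sub>R v)). \<Psi> z)"
      by (simp add: lborel_distr_plus)
    also have "\<dots> = (LINT z|lborel. \<Psi> (s *\<^sub>R v + z))"
      using cont(2) by (subst integral_distr) (auto intro: borel_measurable_continuous_onI)
    finally show ?thesis by (simp add: add.commute)
  qed
  ultimately have "((\<lambda>s::real. LINT z|lborel. \<Psi> z) has_vector_derivative (LINT z|lborel. ddir v \<Psi> z)) (at 0)"
    by simp
  moreover have "((\<lambda>s::real. LINT z|lborel. \<Psi> z) has_vector_derivative 0) (at 0)"
    by (rule has_vector_derivative_const)
  ultimately show ?thesis by (rule vector_derivative_unique_at)
qed

section \<open>Functions with bounded weak gradient are Lipschitz\<close>

lemma test_function_C1_supported: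
  assumes "test_function \<psi>"
  shows "C1_supported \<psi> 1"
proof -
  obtain K where K: "K \<subseteq> disc" "\<And>z. z \<notin> K \<Longrightarrow> \<psi> z = 0"
    using assms by (auto simp: test_function_def)
  have "Ck (Suc 0) \<psi>" using assms unfolding test_function_def by blast
  moreover have "\<psi> z = 0" if "1 \<le> cmod z" for z
    using K(1) K(2)[of z] that by fastforce
  ultimately show ?thesis
    unfolding C1_supported_def by (auto simp: differentiable_on_def)
qed

lemma lborel_integral_translate:
  fixes f :: "complex \<Rightarrow> 'a :: {banach, second_countable_topology}"
  assumes "f \<in> borel_measurable borel"
  shows "(LINT z|lborel. f (z - c)) = (LINT z|lborel. f z)"
proof -
  have "(LINT z|lborel. f z) = (LINT z|distr lborel borel ((+) (- c)). f z)"
    by (simp add: lborel_distr_plus)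
  also have "\<dots> = (LINT z|lborel. f (- c + z))"
    using assms by (subst integral_distr) auto
  finally show ?thesis by simp
qed

lemma LINT_disc:
  fixes f :: "complex \<Rightarrow> 'a :: {banach, second_countable_topology}"
  assumes "(\<lambda>z. indicator disc z *\<^sub>R f z) \<in> borel_measurable borel"
  shows "(LINT z|lebesgue_on disc. f z) = (LINT z|lborel. indicator disc z *\<^sub>R f z)"
proof -
  have "(LINT z|lebesgue_on disc. f z) = (LINT z|lebesgue. indicator disc z *\<^sub>R f z)"
    by (rule integral_restrict_space) simp
  also have "\<dots> = (LINT z|lborel. indicator disc z *\<^sub>R f z)"
    using assms by (intro integral_completion) simp
  finally show ?thesis .
qed

lemma LINT_disc_cong_AE:
  assumes "AE z in lebesgue_on disc. f z = g z" "f \<in> borel_measurable (lebesgue_on disc)"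
    "g \<in> borel_measurable (lebesgue_on disc)"
  shows "(LINT z|lebesgue_on disc. f z) = (LINT z|lebesgue_on disc. g z)"
  using assms by (intro integral_cong_AE) auto

lemma borel_imp_lebesgue_on:
  assumes "f \<in> borel_measurable borel"
  shows "f \<in> borel_measurable (lebesgue_on S)"
  using assms by (intro measurable_restrict_space1 measurable_completion) simp

lemma complex_completion_ex_borel:
  fixes g :: "complex \<Rightarrow> complex"
  assumes "g \<in> borel_measurable lebesgue"
  shows "\<exists>g'\<in>borel_measurable borel. AE z in lborel. g z = g' z"
proof -
  have "(\<lambda>z. Re (g z)) \<in> borel_measurable lebesgue" "(\<lambda>z. Im (g z)) \<in> borel_measurable lebesgue"
    using assms by measurable
  then obtain p q where pq: "p \<in> borel_measurable lborel" "AE z in lborel. Re (g z) = p z"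
    "q \<in> borel_measurable lborel" "AE z in lborel. Im (g z) = q z"
    using completion_ex_borel_measurable_real by metis
  show ?thesis
  proof (rule bexI[of _ "\<lambda>z. Complex (p z) (q z)"])
    show "AE z in lborel. g z = Complex (p z) (q z)"
      using pq(2,4) by eventually_elim (auto simp: complex_eq_iff)
    have "(\<lambda>z. complex_of_real (p z) + \<i> * complex_of_real (q z)) \<in> borel_measurable borel"
      using pq(1,3) by simp
    then show "(\<lambda>z. Complex (p z) (q z)) \<in> borel_measurable borel"
      by (simp add: Complex_eq)
  qed
qed

text \<open>
  Fubini's theorem is used for Borel functions. Since the weak derivatives enter only through
  integrals, they may be replaced by representatives that are Borel, bounded everywhere and zero
  outside the disc.
\<close>

lemma Linf_borel_representative:
  assumes "Linf g"
  obtains g' M where "g' \<in> borel_measurable borel" "0 \<le> M" "\<And>z. cmod (g' z) \<le> M"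
    "\<And>z. z \<notin> disc \<Longrightarrow> g' z = 0" "AE z in lebesgue_on disc. g z = g' z"
proof -
  obtain C where g: "g \<in> borel_measurable (lebesgue_on disc)" and C: "AE z in lebesgue_on disc. cmod (g z) \<le> C"
    using assms by (auto simp: Linf_def)
  have "(\<lambda>z. if z \<in> disc then g z else 0) \<in> borel_measurable lebesgue"
    using g by (subst borel_measurable_if) auto
  then obtain h where h: "h \<in> borel_measurable borel" "AE z in lborel. (if z \<in> disc then g z else 0) = h z"
    using complex_completion_ex_borel by blast
  have h': "AE z in lebesgue_on disc. h z = g z"
    using AE_completion[OF h(2)] by (subst AE_restrict_space_iff) (auto elim!: eventually_mono split: if_splits)
  define M where "M = max 0 C"
  define g' where "g' z = (if z \<in> disc \<and> cmod (h z) \<le> M then h z else 0)" for z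
  show ?thesis
  proof (rule that[of g' M])
    show "g' \<in> borel_measurable borel"
      unfolding g'_def using h(1) by measurable
    show "AE z in lebesgue_on disc. g z = g' z"
      using h' C AE_space by eventually_elim (auto simp: g'_def M_def)
  qed (auto simp: g'_def M_def)
qed

lemma weak_deriv_lborel:
  assumes w: "weak_deriv v u g" and u: "continuous_on disc u" and \<psi>: "test_function \<psi>"
    and g: "Linf g" and g': "g' \<in> borel_measurable borel" "\<And>z. z \<notin> disc \<Longrightarrow> g' z = 0"
      "AE z in lebesgue_on disc. g z = g' z"
  shows "(LINT z|lborel. (indicator disc z *\<^sub>R u z) * ddir v \<psi> z) = - (LINT z|lborel. g' z * \<psi> z)"
proof -
  have C: "C1_supported \<psi> 1" using \<psi> by (rule test_function_C1_supported)
  have m: "\<psi> \<in> borel_measurable borel" "ddir v \<psi> \<in> borel_measurable borel"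
    using C1_supported_continuous[OF C] C
    by (auto simp: C1_supported_def intro: borel_measurable_continuous_onI)
  have mu: "(\<lambda>z. indicator disc z *\<^sub>R u z) \<in> borel_measurable borel"
    using u by (intro borel_measurable_continuous_on_indicator) auto
  have "(LINT z|lborel. (indicator disc z *\<^sub>R u z) * ddir v \<psi> z) = (LINT z|lebesgue_on disc. u z * ddir v \<psi> z)"
    using m mu by (subst LINT_disc) (auto simp: mult_scaleR_left[symmetric] simp del: mult_scaleR_left)
  also have "\<dots> = - (LINT z|lebesgue_on disc. g z * \<psi> z)"
    using w \<psi> by (auto simp: weak_deriv_def)
  also have "(LINT z|lebesgue_on disc. g z * \<psi> z) = (LINT z|lebesgue_on disc. g' z * \<psi> z)"
  proof (rule LINT_disc_cong_AE)
    show "AE z in lebesgue_on disc. g z * \<psi> z = g' z * \<psi> z"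
      using g'(3) by eventually_elim simp
    show "(\<lambda>z. g z * \<psi> z) \<in> borel_measurable (lebesgue_on disc)"
      using g borel_imp_lebesgue_on[OF m(1)] by (intro borel_measurable_times) (auto simp: Linf_def)
    show "(\<lambda>z. g' z * \<psi> z) \<in> borel_measurable (lebesgue_on disc)"
      by (intro borel_measurable_times borel_imp_lebesgue_on m g')
  qed
  also have "\<dots> = (LINT z|lborel. indicator disc z *\<^sub>R (g' z * \<psi> z))"
    using m g' by (intro LINT_disc) measurable
  also have "\<dots> = (LINT z|lborel. g' z * \<psi> z)"
    by (intro Bochner_Integration.integral_cong) (use g'(2) in \<open>auto simp: indicator_def\<close>)
  finally show ?thesis .
qed

lemma ddir_bump: "ddir v (bump m a e) z = (of_nat m * bump (m + 1) a e z - bump (m + 2) a e z)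
     * complex_of_real (2 * ((z - a) \<bullet> v))"
  by (rule ddir_eq[OF bump_has_derivative])

lemma bump_translate: "bump m (a + c) e z = bump m a e (z - c)"
  by (simp add: bump_def algebra_simps)

lemma cmod_bump: "complex_of_real (cmod (bump m a e z)) = bump m a e z"
  by (simp add: bump_def flat_nonneg)

lemma C1_supported_bump:
  assumes "0 \<le> e" "cmod a + e \<le> R"
  shows "C1_supported (bump m a e) R"
proof -
  have "Ck (Suc 0) (bump m a e)" by (rule Ck_bump)
  moreover have "bump m a e z = 0" if "R \<le> cmod z" for z
    using bump_eq_0[of e z a m] norm_triangle_ineq2[of z a] assms that by simp
  ultimately show ?thesis
    unfolding C1_supported_def by (auto simp: differentiable_on_def)
qed

lemma bump_facts:
  assumes "0 < e"
  shows "continuous_on UNIV (bump m a e)" "bump m a e \<in> borel_measurable borel"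
    "integrable lborel (bump m a e)" "0 < (LINT z|lborel. cmod (bump m a e z))"
proof -
  note C = C1_supported_bump[of e a "cmod a + e" m]
  show 1: "continuous_on UNIV (bump m a e)"
    using C assms by (auto intro: C1_supported_continuous)
  then show "bump m a e \<in> borel_measurable borel" by (rule borel_measurable_continuous_onI)
  show 2: "integrable lborel (bump m a e)"
    by (rule continuous_supported_integrable[OF 1, of "cmod a + e"])
       (use C assms in \<open>auto simp: C1_supported_def\<close>)
  have 3: "0 < cmod (bump m a e a)" using assms by (simp add: bump_def flat_def)
  show "0 < (LINT z|lborel. cmod (bump m a e z))"
    by (rule integral_pos_of_continuous[where ?z0.0 = a])
       (use 1 2 3 in \<open>auto intro!: continuous_intros\<close>)
qed

text \<open>
  Mollify: for a bump \<open>B\<close> moving with constant velocity \<open>d = b - a\<close> from \<open>a\<close> to \<open>b\<close>, the average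
  \<open>H s = \<integral> u * B s\<close> has derivative \<open>- \<integral> u * ddir d (B s)\<close>, which equals the average of the weak gradient
  of \<open>u\<close> in direction \<open>d\<close> and is therefore at most \<open>M * |d|\<close> times the mass \<open>N\<close> of \<open>B\<close>. Shrinking
  the bump turns the averages at the endpoints into \<open>u a\<close> and \<open>u b\<close>.
\<close>

lemma W1inf_lipschitz:
  assumes "u \<in> W1inf"
  obtains L where "L-lipschitz_on disc u"
proof -
  obtain g1 g2 where cont: "continuous_on disc u" and g: "Linf g1" "Linf g2" "weak_deriv 1 u g1" "weak_deriv \<i> u g2"
    using assms by (auto simp: W1inf_def)
  obtain h1 M1 where h1: "h1 \<in> borel_measurable borel" "0 \<le> M1" "\<And>z. cmod (h1 z) \<le> M1"
    "\<And>z. z \<notin> disc \<Longrightarrow> h1 z = 0" "AE z in lebesgue_on disc. g1 z = h1 z"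
    by (rule Linf_borel_representative[OF g(1)]) (rule that)
  obtain h2 M2 where h2: "h2 \<in> borel_measurable borel" "0 \<le> M2" "\<And>z. cmod (h2 z) \<le> M2"
    "\<And>z. z \<notin> disc \<Longrightarrow> h2 z = 0" "AE z in lebesgue_on disc. g2 z = h2 z"
    by (rule Linf_borel_representative[OF g(2)]) (rule that)
  define M where "M = M1 + M2"
  have est: "cmod (u b - u a) \<le> M * cmod (b - a) + 2 * \<eta>" if ab: "a \<in> disc" "b \<in> disc" and \<eta>: "0 < \<eta>" for a b \<eta>
  proof -
    define d where "d = b - a"
    define \<rho> where "\<rho> = max (cmod a) (cmod b)"
    have \<rho>: "\<rho> < 1" "0 \<le> \<rho>" using ab by (auto simp: \<rho>_def max_def)
    obtain e1 where e1: "0 < e1" "\<And>z. z \<in> disc \<Longrightarrow> cmod (z - a) < e1 \<Longrightarrow> cmod (u z - u a) < \<eta>"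
      using cont ab(1) \<eta> unfolding continuous_on_iff dist_norm by metis
    obtain e2 where e2: "0 < e2" "\<And>z. z \<in> disc \<Longrightarrow> cmod (z - b) < e2 \<Longrightarrow> cmod (u z - u b) < \<eta>"
      using cont ab(2) \<eta> unfolding continuous_on_iff dist_norm by metis
    (* The bump of width e stays inside the disc along the whole segment, and at its two ends u is
       within \<eta> of u a and u b on the support. *)
    define e where "e = min (min e1 e2) ((1 - \<rho>) / 2)"
    have e: "0 < e" "e \<le> e1" "e \<le> e2" "e \<le> (1 - \<rho>) / 2"
      using e1(1) e2(1) \<rho>(1) min.cobounded2[of "min e1 e2" "(1 - \<rho>) / 2"] unfolding e_def by auto
    define r where "r = \<rho> + e"
    have r: "r < 1" using e(4) \<rho> unfolding r_def by argo
    have sub: "cball 0 r \<subseteq> disc" using r by auto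
    define B where "B s = bump 0 (a + s *\<^sub>R d) e" for s
    define N where "N = (LINT z|lborel. cmod (bump 0 a e z))"
    have N: "N > 0" unfolding N_def by (rule bump_facts) fact
    have NB: "(LINT z|lborel. cmod (B s z)) = N" for s
      unfolding N_def B_def bump_translate
      using bump_facts(2)[OF e(1), of 0 a] by (intro lborel_integral_translate[where f = "\<lambda>z. cmod (bump 0 a e z)"]) simp
    have NB': "(LINT z|lborel. B s z) = complex_of_real N" for s
    proof -
      have "(LINT z|lborel. B s z) = (LINT z|lborel. complex_of_real (cmod (B s z)))"
        by (simp add: B_def cmod_bump)
      also have "\<dots> = complex_of_real N" unfolding NB[symmetric, of s] by simp
      finally show ?thesis .
    qed
    have Bint: "integrable lborel (B s)" for s unfolding B_def by (rule bump_facts) fact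
    have pos: "cmod (a + s *\<^sub>R d) \<le> \<rho>" if "s \<in> {0..1}" for s
    proof -
      have "a + s *\<^sub>R d = (1 - s) *\<^sub>R a + s *\<^sub>R b" by (simp add: d_def algebra_simps)
      also have "cmod \<dots> \<le> (1 - s) * cmod a + s * cmod b"
        using that by (intro norm_triangle_le) auto
      also have "\<dots> \<le> (1 - s) * \<rho> + s * \<rho>"
        using that by (intro add_mono mult_left_mono) (auto simp: \<rho>_def)
      finally show ?thesis by (simp add: algebra_simps)
    qed
    have Bsupp: "bump m (a + s *\<^sub>R d) e z = 0" if "s \<in> {0..1}" "z \<notin> cball 0 r" for s z m
      using bump_eq_0[of e z "a + s *\<^sub>R d" m] norm_triangle_ineq2[of z "a + s *\<^sub>R d"] pos[OF that(1)] that e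
      by (auto simp: r_def)
    obtain U where U: "0 < U" "\<And>z. z \<in> cball 0 r \<Longrightarrow> cmod (u z) \<le> U"
    proof -
      have "bounded (u ` cball 0 r)"
        by (intro compact_imp_bounded compact_continuous_image continuous_on_subset[OF cont] sub) auto
      then show thesis using that by (auto simp: bounded_pos)
    qed
    (* Cutting off at radius r changes nothing for the bumps on the segment, but makes the integrands
       bounded for every real s, as the differentiation under the integral requires. *)
    define u' where "u' z = indicator (cball 0 r) z *\<^sub>R u z" for z
    have u': "cmod (u' z) \<le> U" for z using U by (auto simp: u'_def indicator_def)
    have mu': "u' \<in> borel_measurable borel" unfolding u'_def
      by (intro borel_measurable_continuous_on_indicator continuous_on_subset[OF cont] sub) auto
    have int: "integrable lborel (\<lambda>z. u' z * k z)"
      if k: "k \<in> borel_measurable borel" "\<And>z. cmod (k z) \<le> C" for k C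
    proof (rule bounded_integrable_supported[where C = "U * C" and R = r])
      show "cmod (u' z * k z) \<le> U * C" for z
        using u'[of z] k(2)[of z] U(1) by (auto simp: norm_mult intro!: mult_mono)
      show "(\<lambda>z. u' z * k z) \<in> borel_measurable borel" using mu' k by simp
      show "r < cmod z \<Longrightarrow> u' z * k z = 0" for z by (simp add: u'_def)
    qed
    obtain C0 where C0: "0 \<le> C0" "\<And>z. cmod (bump 0 a e z) \<le> C0"
      using continuous_supported_bounded[OF bump_facts(1)[OF e(1), of 0 a], of "cmod a + e"]
        C1_supported_bump[of e a "cmod a + e" 0] e(1) by (auto simp: C1_supported_def)
    have D: "continuous_on UNIV (ddir v (bump 0 a e))" for v
      using C1_supported_bump[of e a "cmod a + e" 0] e(1) by (auto simp: C1_supported_def)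
    have C1: "C1_supported (bump 0 a e) (cmod a + e)"
      using e(1) by (intro C1_supported_bump) auto
    have Dbd: "\<exists>C\<ge>0. \<forall>z. cmod (ddir v (bump 0 a e) z) \<le> C" for v
      by (rule continuous_supported_bounded[OF D[of v] ddir_eq_0_off_cball[OF C1]]) blast+
    have Dtr: "ddir v (B s) z = ddir v (bump 0 a e) (z - s *\<^sub>R d)" for v s z
      unfolding B_def ddir_bump bump_translate by (simp add: algebra_simps)
    have mD: "ddir v (B s) \<in> borel_measurable borel" for v s
      unfolding Dtr by (intro borel_measurable_continuous_onI continuous_on_compose2[OF D]) (auto intro!: continuous_intros)
    have iD: "integrable lborel (\<lambda>z. u' z * ddir v (B s) z)" for v s
      using Dbd[of v] by (auto simp: Dtr[abs_def] intro!: int mD[unfolded Dtr[abs_def]])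
    define H where "H s = (LINT z|lborel. u' z * B s z)" for s
    have Hder: "(H has_vector_derivative (LINT z|lborel. - (u' z * ddir d (B s) z))) (at s)" for s
    proof -
      obtain C where C: "0 \<le> C" "\<And>z. cmod (ddir d (bump 0 a e) z) \<le> C" using Dbd by blast
      show ?thesis unfolding H_def
      proof (rule has_vector_derivative_lborel_integral[where r = 1 and w = "\<lambda>z. indicator (cball 0 r) z * (U * C)"])
        fix s z
        have "((\<lambda>s. z - s *\<^sub>R d) has_derivative (\<lambda>h. - (h *\<^sub>R d))) (at s)"
          by (auto intro!: derivative_eq_intros)
        from has_derivative_compose[OF this bump_has_derivative[of 0 a e]]
        have "((\<lambda>s. B s z) has_derivative (\<lambda>h. h *\<^sub>R (bump 2 a e (z - s *\<^sub>R d)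
            * complex_of_real (2 * ((z - s *\<^sub>R d - a) \<bullet> d))))) (at s)"
          unfolding B_def bump_translate
          by (rule has_derivative_eq_rhs)
             (simp add: fun_eq_iff numeral_2_eq_2, simp add: scaleR_conv_of_real mult_ac)
        moreover have "z - s *\<^sub>R d - a = z - (a + s *\<^sub>R d)" by simp
        ultimately have "((\<lambda>s. B s z) has_vector_derivative - ddir d (B s) z) (at s)"
          unfolding has_vector_derivative_def B_def bump_translate ddir_bump by (simp add: numeral_2_eq_2)
        from has_vector_derivative_mult_right[OF this]
        show "((\<lambda>s. u' z * B s z) has_vector_derivative - (u' z * ddir d (B s) z)) (at s)" by simp
        show "cmod (- (u' z * ddir d (B s) z)) \<le> indicator (cball 0 r) z * (U * C)"
        proof (cases "z \<in> cball 0 r")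
          case True
          then show ?thesis using u'[of z] C(2) U(1) by (auto simp: norm_mult Dtr intro!: mult_mono)
        qed (auto simp: u'_def)
      next
        fix s
        show "integrable lborel (\<lambda>z. u' z * B s z)"
          using C0(2) bump_facts(2)[OF e(1)] by (intro int[of _ C0]) (auto simp: B_def bump_translate[of 0])
        show "integrable lborel (\<lambda>z::complex. indicator (cball 0 r) z * (U * C))"
          by (rule bounded_integrable_supported[of _ "U * C" r]) (use U C in \<open>auto simp: indicator_def\<close>)
      qed (use mu' mD in auto)
    qed
    have Hder_bd: "cmod (LINT z|lborel. - (u' z * ddir d (B s) z)) \<le> M * cmod d * N" if s: "s \<in> {0..1}" for s
    proof -
      have test: "test_function (B s)"
        unfolding B_def
      proof (rule test_function_bump)
        show "cball (a + s *\<^sub>R d) e \<subseteq> disc"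
        proof
          fix z assume "z \<in> cball (a + s *\<^sub>R d) e"
          then have "cmod z \<le> cmod (a + s *\<^sub>R d) + e"
            using norm_triangle_ineq2[of z "a + s *\<^sub>R d"] by (simp add: dist_norm norm_minus_commute)
          then show "z \<in> disc" using pos[OF s] r by (simp add: r_def)
        qed
      qed (use e in simp)
      have eq: "(indicator disc z *\<^sub>R u z) * ddir v (B s) z = u' z * ddir v (B s) z" for v z
      proof (cases "z \<in> cball 0 r")
        case True
        then show ?thesis using sub by (auto simp: u'_def indicator_def)
      next
        case False
        then have "ddir v (B s) z = 0" unfolding B_def ddir_bump using Bsupp[OF s False] by simp
        then show ?thesis by simp
      qed
      have p1: "(LINT z|lborel. u' z * ddir 1 (B s) z) = - (LINT z|lborel. h1 z * B s z)"
        using weak_deriv_lborel[OF g(3) cont test g(1) h1(1,4,5)] unfolding eq .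
      have p2: "(LINT z|lborel. u' z * ddir \<i> (B s) z) = - (LINT z|lborel. h2 z * B s z)"
        using weak_deriv_lborel[OF g(4) cont test g(2) h2(1,4,5)] unfolding eq .
      have "- (u' z * ddir d (B s) z) = - (complex_of_real (Re d) * (u' z * ddir 1 (B s) z)
          + complex_of_real (Im d) * (u' z * ddir \<i> (B s) z))" for z
        unfolding B_def ddir_bump by (simp add: inner_complex_def algebra_simps)
      then have "(LINT z|lborel. - (u' z * ddir d (B s) z)) =
         complex_of_real (Re d) * (LINT z|lborel. h1 z * B s z) + complex_of_real (Im d) * (LINT z|lborel. h2 z * B s z)"
        using iD p1 p2 by simp
      also have "cmod \<dots> \<le> \<bar>Re d\<bar> * (M1 * N) + \<bar>Im d\<bar> * (M2 * N)"
      proof -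
        have bd: "cmod (LINT z|lborel. h z * B s z) \<le> K * N"
          if h: "h \<in> borel_measurable borel" "\<And>z. cmod (h z) \<le> K" for h K
        proof -
          have "cmod (LINT z|lborel. h z * B s z) \<le> (LINT z|lborel. K * cmod (B s z))"
          proof (rule order.trans[OF integral_norm_bound integral_mono])
            show "integrable lborel (\<lambda>z. K * cmod (B s z))" using Bint[of s] by simp
            have K0: "0 \<le> K" using order.trans[OF norm_ge_zero h(2)[of 0]] .
            show le: "cmod (h z * B s z) \<le> K * cmod (B s z)" for z
              using h(2)[of z] by (simp add: norm_mult mult_right_mono)
            show "integrable lborel (\<lambda>z. cmod (h z * B s z))"
            proof (rule Bochner_Integration.integrable_bound)
              show "integrable lborel (\<lambda>z. K * cmod (B s z))" by fact
            next
              show "(\<lambda>z. cmod (h z * B s z)) \<in> borel_measurable lborel"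
                using h Bint[of s] by (auto dest!: borel_measurable_integrable)
              show "AE z in lborel. norm (cmod (h z * B s z)) \<le> norm (K * cmod (B s z))"
                using le K0 by simp
            qed
          qed
          then show ?thesis using NB by simp
        qed
        show ?thesis
          using bd[OF h1(1,3)] bd[OF h2(1,3)]
          by (intro norm_triangle_le add_mono) (auto simp: norm_mult intro!: mult_left_mono)
      qed
      also have "\<dots> \<le> cmod d * (M1 * N) + cmod d * (M2 * N)"
        using abs_Re_le_cmod[of d] abs_Im_le_cmod[of d] h1(2) h2(2) N
        by (intro add_mono mult_right_mono) auto
      finally show ?thesis by (simp add: M_def algebra_simps)
    qed
    have diff: "cmod (H 1 - H 0) \<le> M * cmod d * N * norm (1 - 0 :: real)"
    proof (rule differentiable_bound[where S = "{0..1}"])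
      fix s :: real assume s: "s \<in> {0..1}"
      show "(H has_derivative (\<lambda>h. h *\<^sub>R (LINT z|lborel. - (u' z * ddir d (B s) z)))) (at s within {0..1})"
        using Hder[of s] unfolding has_vector_derivative_def by (rule has_derivative_at_withinI)
      show "onorm (\<lambda>h. h *\<^sub>R (LINT z|lborel. - (u' z * ddir d (B s) z))) \<le> M * cmod d * N"
        using Hder_bd[OF s] N h1(2) h2(2)
        by (intro onorm_bound) (auto simp: M_def mult.commute[of _ "\<bar>_\<bar>"] intro!: mult_left_mono)
    qed auto
    have near: "cmod (H s - u q * complex_of_real N) \<le> \<eta> * N"
      if q: "q = a + s *\<^sub>R d" "s \<in> {0..1}" "\<And>z. z \<in> disc \<Longrightarrow> cmod (z - q) < e \<Longrightarrow> cmod (u z - u q) < \<eta>" for s q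
    proof -
      have i1: "integrable lborel (\<lambda>z. u' z * B s z)"
        using C0(2) bump_facts(2)[OF e(1)] by (intro int[of _ C0]) (auto simp: B_def bump_translate[of 0])
      have "H s - u q * complex_of_real N = (LINT z|lborel. u' z * B s z - u q * B s z)"
        using i1 Bint[of s] NB'[of s] unfolding H_def by simp
      also have "cmod \<dots> \<le> (LINT z|lborel. \<eta> * cmod (B s z))"
      proof (rule order.trans[OF integral_norm_bound integral_mono])
        show "integrable lborel (\<lambda>z. cmod (u' z * B s z - u q * B s z))" using i1 Bint[of s] by simp
        show "integrable lborel (\<lambda>z. \<eta> * cmod (B s z))" using Bint[of s] by simp
        fix z
        show "cmod (u' z * B s z - u q * B s z) \<le> \<eta> * cmod (B s z)"
        proof (cases "B s z = 0")
          case False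
          then have z: "z \<in> cball 0 r" using Bsupp[OF q(2), of z 0] by (auto simp: B_def)
          have "cmod (z - q) < e"
            using False bump_eq_0[of e z q 0] e(1) unfolding B_def q(1) by linarith
          then have "cmod (u z - u q) < \<eta>" using q(3) z sub by blast
          moreover have "u' z * B s z - u q * B s z = (u z - u q) * B s z"
            using z by (simp add: u'_def algebra_simps)
          ultimately show ?thesis by (simp add: norm_mult mult_right_mono)
        qed simp
      qed
      finally show ?thesis using NB by simp
    qed
    have n0: "cmod (H 0 - u a * complex_of_real N) \<le> \<eta> * N"
      by (rule near) (use e1 e in auto)
    have n1: "cmod (H 1 - u b * complex_of_real N) \<le> \<eta> * N"
      by (rule near) (use e2 e in \<open>auto simp: d_def\<close>)
    have "cmod (u b - u a) * N = cmod ((u b - u a) * complex_of_real N)"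
      using N by (simp add: norm_mult)
    also have "(u b - u a) * complex_of_real N
        = (H 1 - H 0) - (H 1 - u b * complex_of_real N) + (H 0 - u a * complex_of_real N)"
      by (simp add: algebra_simps)
    also have "cmod \<dots> \<le> cmod (H 1 - H 0) + cmod (H 1 - u b * complex_of_real N) + cmod (H 0 - u a * complex_of_real N)"
      using norm_triangle_ineq4[of "H 1 - H 0" "H 1 - u b * complex_of_real N"]
        norm_triangle_ineq[of "(H 1 - H 0) - (H 1 - u b * complex_of_real N)" "H 0 - u a * complex_of_real N"] by linarith
    also have "\<dots> \<le> (M * cmod d * N + \<eta> * N) + \<eta> * N"
      using diff[simplified] n0 n1 by linarith
    also have "\<dots> = (M * cmod d + 2 * \<eta>) * N" by (simp add: algebra_simps)
    finally show ?thesis using N by (simp add: d_def)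
  qed
  have "M-lipschitz_on disc u"
  proof (rule lipschitz_onI)
    show "0 \<le> M" using h1(2) h2(2) by (simp add: M_def)
    fix a b assume ab: "a \<in> disc" "b \<in> disc"
    have "cmod (u a - u b) \<le> M * cmod (a - b) + \<epsilon>" if "0 < \<epsilon>" for \<epsilon>
      using est[OF ab(2,1), of "\<epsilon> / 2"] that by simp
    then show "dist (u a) (u b) \<le> M * dist a b"
      unfolding dist_norm by (rule field_le_epsilon)
  qed
  then show ?thesis using that by blast
qed

lemma lipschitz_extension_cball:
  fixes u :: "complex \<Rightarrow> complex"
  assumes "L-lipschitz_on disc u"
  obtains U where "L-lipschitz_on (cball 0 1) U" "\<And>z. z \<in> disc \<Longrightarrow> U z = u z"
proof -
  obtain U where U: "uniformly_continuous_on (closure disc) U" "\<And>z. z \<in> disc \<Longrightarrow> u z = U z"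
    using uniformly_continuous_on_extension_on_closure[OF lipschitz_on_uniformly_continuous[OF assms]] by metis
  have "L-lipschitz_on disc U"
    using assms U(2) by (simp add: lipschitz_on_def)
  then have "L-lipschitz_on (closure disc) U"
    using uniformly_continuous_imp_continuous[OF U(1)] by (rule lipschitz_on_closure)
  then show ?thesis using that[of U] U(2) by simp
qed

text \<open>
  A nonempty open set is not a null set.
\<close>

lemma AE_disc_le_imp_le:
  fixes w :: "complex \<Rightarrow> real"
  assumes w: "continuous_on disc w" and AE: "AE z in lebesgue_on disc. w z \<le> c" and z: "z \<in> disc"
  shows "w z \<le> c"
proof (rule ccontr)
  assume "\<not> w z \<le> c"
  define A where "A = disc \<inter> w -` {c<..}"
  have "open A" unfolding A_def by (rule continuous_open_preimage[OF w]) auto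
  moreover have "z \<in> A" using z \<open>\<not> w z \<le> c\<close> by (simp add: A_def)
  moreover have "negligible A"
  proof -
    have "AE z in lebesgue. z \<notin> A"
      using AE unfolding A_def by (subst (asm) AE_restrict_space_iff) (auto elim!: eventually_mono)
    then show ?thesis
      using AE_iff_null_sets[of A lebesgue] \<open>open A\<close> by (simp add: negligible_iff_null_sets)
  qed
  ultimately show False using open_not_negligible by blast
qed

section \<open>The Cauchy--Pompeiu formula\<close>

lemma dbar_mult:
  assumes "f differentiable (at z)" "g differentiable (at z)"
  shows "dbar (\<lambda>z. f z * g z) z = f z * dbar g z + dbar f z * g z"
  using ddir_mult[OF assms] by (simp add: dbar_def field_simps)

lemma ddir_cmult:
  assumes "f differentiable (at z)"
  shows "ddir v (\<lambda>z. c * f z) z = c * ddir v f z"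
  by (rule ddir_eq[OF has_derivative_mult_right]) (rule has_derivative_ddir[OF assms])

lemma C1_supported_lincomb:
  assumes "C1_supported f R" "C1_supported g R"
  shows "C1_supported (\<lambda>z. f z + c * g z) R"
    and "dbar (\<lambda>z. f z + c * g z) z = dbar f z + c * dbar g z"
proof -
  have d: "f differentiable (at z)" "g differentiable (at z)" for z
    using assms by (auto simp: C1_supported_def)
  have 1: "ddir v (\<lambda>z. f z + c * g z) z = ddir v f z + c * ddir v g z" for v z
    using ddir_add[of f z "\<lambda>z. c * g z"] ddir_cmult[of g z] d by simp
  show "C1_supported (\<lambda>z. f z + c * g z) R"
    using assms unfolding C1_supported_def 1[abs_def] by (auto intro!: continuous_intros derivative_intros)
  show "dbar (\<lambda>z. f z + c * g z) z = dbar f z + c * dbar g z"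
    unfolding dbar_def 1 by (simp add: field_simps)
qed

lemma C1_supported_mult:
  assumes "C1_supported f R" "\<And>z. g differentiable (at z)" "\<And>v. continuous_on UNIV (ddir v g)"
  shows "C1_supported (\<lambda>z. f z * g z) R"
proof -
  have d: "f differentiable (at z)" for z using assms by (auto simp: C1_supported_def)
  have "continuous_on UNIV g" "continuous_on UNIV f"
    using d assms(2) by (auto simp: continuous_on_eq_continuous_at differentiable_imp_continuous_within)
  moreover have dd: "ddir v (\<lambda>z. f z * g z) = (\<lambda>z. f z * ddir v g z + ddir v f z * g z)" for v
    by (intro ext ddir_mult d assms)
  ultimately have "continuous_on UNIV (ddir v (\<lambda>z. f z * g z))" for v
    unfolding dd using assms by (intro continuous_intros) (auto simp: C1_supported_def)
  then show ?thesis
    using assms unfolding C1_supported_def by (auto intro!: derivative_intros)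
qed

lemma continuous_dbar:
  assumes "C1_supported f R"
  shows "continuous_on UNIV (dbar f)"
  using assms unfolding dbar_def[abs_def] C1_supported_def by (auto intro!: continuous_intros)

lemma dbar_eq_0_outside:
  assumes "C1_supported f R" "R \<le> cmod z"
  shows "dbar f z = 0"
  using ddir_eq_0_off_ball[OF assms] by (simp add: dbar_def)

lemma integral_dbar_eq_0:
  assumes "C1_supported f R"
  shows "(LINT z|lborel. dbar f z) = 0"
proof -
  have "integrable lborel (ddir v f)" for v
    using assms ddir_eq_0_off_cball[OF assms]
    by (intro continuous_supported_integrable[where R = R]) (auto simp: C1_supported_def)
  then show ?thesis unfolding dbar_def using integral_ddir_eq_0[OF assms] by simp
qed

lemma ddir_decompose:
  assumes "f differentiable (at z)"
  shows "ddir v f z = complex_of_real (Re v) * ddir 1 f z + complex_of_real (Im v) * ddir \<i> f z"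
proof -
  have l: "linear (\<lambda>v. ddir v f z)"
    using has_derivative_linear[OF has_derivative_ddir[OF assms]] .
  have "v = Re v *\<^sub>R 1 + Im v *\<^sub>R \<i>" by (simp add: complex_eq_iff)
  then have "ddir v f z = ddir (Re v *\<^sub>R 1 + Im v *\<^sub>R \<i>) f z" by simp
  also have "\<dots> = Re v *\<^sub>R ddir 1 f z + Im v *\<^sub>R ddir \<i> f z"
    using linear_add[OF l] linear_scale[OF l] by simp
  finally show ?thesis by (simp add: scaleR_conv_of_real)
qed

lemma C1_supported_lipschitz:
  assumes "C1_supported f R"
  obtains L where "0 \<le> L" "\<And>z w. cmod (f z - f w) \<le> L * cmod (z - w)"
proof -
  have c: "continuous_on UNIV (ddir v f)" "f differentiable (at z)" for v z
    using assms by (auto simp: C1_supported_def)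
  have "\<exists>C\<ge>0. \<forall>z. cmod (ddir v f z) \<le> C" for v
    using continuous_supported_bounded[OF c(1) ddir_eq_0_off_cball[OF assms]] by metis
  then obtain C D where C: "0 \<le> C" "\<And>z. cmod (ddir 1 f z) \<le> C" and D: "0 \<le> D" "\<And>z. cmod (ddir \<i> f z) \<le> D"
    by metis
  show ?thesis
  proof (rule that[of "C + D"])
    show "cmod (f z - f w) \<le> (C + D) * cmod (z - w)" for z w
    proof (rule differentiable_bound[where S = UNIV])
      fix z
      show "(f has_derivative (\<lambda>v. ddir v f z)) (at z within UNIV)" using has_derivative_ddir[OF c(2)] by simp
      show "onorm (\<lambda>v. ddir v f z) \<le> C + D"
      proof (rule onorm_bound)
        fix v
        have "cmod (ddir v f z) \<le> \<bar>Re v\<bar> * C + \<bar>Im v\<bar> * D"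
          using C(2)[of z] D(2)[of z]
          by (subst ddir_decompose[OF c(2)], intro norm_triangle_le add_mono) (auto simp: norm_mult intro!: mult_left_mono)
        also have "\<dots> \<le> cmod v * C + cmod v * D"
          using C D abs_Re_le_cmod[of v] abs_Im_le_cmod[of v] by (intro add_mono mult_right_mono)
        finally show "cmod (ddir v f z) \<le> (C + D) * cmod v" by (simp add: algebra_simps)
      qed (use C D in simp)
    qed auto
  qed (use C D in simp)
qed

text \<open>
  The Cauchy kernel \<open>1 / (z - a)\<close> smoothed at scale \<open>sqrt \<epsilon>\<close>; its \<open>dbar\<close> is an approximate
  multiple of the Dirac mass at \<open>a\<close>.
\<close>

definition reg_kernel :: "complex \<Rightarrow> real \<Rightarrow> complex \<Rightarrow> complex" where
  "reg_kernel a \<epsilon> z = cnj (z - a) / ((z - a) * cnj (z - a) + complex_of_real \<epsilon>)"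

lemma reg_kernel_denominator: "(z - a) * cnj (z - a) + complex_of_real \<epsilon> = complex_of_real ((cmod (z - a))\<^sup>2 + \<epsilon>)"
  by (simp only: complex_norm_square[symmetric] of_real_add)

lemma reg_kernel_facts:
  assumes "0 < \<epsilon>"
  shows "reg_kernel a \<epsilon> differentiable (at z)" "continuous_on UNIV (ddir v (reg_kernel a \<epsilon>))"
    "dbar (reg_kernel a \<epsilon>) z = complex_of_real (\<epsilon> / ((cmod (z - a))\<^sup>2 + \<epsilon>)\<^sup>2)"
proof -
  define D where "D z = (z - a) * cnj (z - a) + complex_of_real \<epsilon>" for z
  have D0: "D z \<noteq> 0" for z
  proof -
    have "(cmod (z - a))\<^sup>2 + \<epsilon> > 0" using assms by (intro add_nonneg_pos) auto
    then have "complex_of_real ((cmod (z - a))\<^sup>2 + \<epsilon>) \<noteq> 0" unfolding of_real_eq_0_iff by simp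
    then show ?thesis unfolding D_def reg_kernel_denominator .
  qed
  have cn: "((\<lambda>z. cnj (z - a)) has_derivative cnj) (at z)" for z
    using bounded_linear.has_derivative[OF bounded_linear_cnj, of "\<lambda>z. z - a" "\<lambda>v. v" "at z"]
    by (auto intro!: derivative_eq_intros)
  have dD: "(D has_derivative (\<lambda>v. (z - a) * cnj v + v * cnj (z - a))) (at z)" for z
    unfolding D_def by (auto intro!: derivative_eq_intros cn)
  have der: "(reg_kernel a \<epsilon> has_derivative (\<lambda>v. (cnj v * D z - cnj (z - a) * ((z - a) * cnj v + v * cnj (z - a))) / (D z * D z))) (at z)" for z
    unfolding reg_kernel_def D_def[symmetric] using has_derivative_divide'[OF cn dD D0] .
  have dd: "ddir v (reg_kernel a \<epsilon>) z = (cnj v * D z - cnj (z - a) * ((z - a) * cnj v + v * cnj (z - a))) / (D z * D z)" for v z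
    by (rule ddir_eq[OF der])
  show "reg_kernel a \<epsilon> differentiable (at z)" using der unfolding differentiable_def by blast
  show "continuous_on UNIV (ddir v (reg_kernel a \<epsilon>))"
    unfolding dd[abs_def] using D0 by (auto intro!: continuous_intros simp: D_def)
  have "dbar (reg_kernel a \<epsilon>) z = (D z - cnj (z - a) * (z - a)) / (D z * D z)"
    unfolding dbar_def dd using D0[of z] by (simp add: field_simps)
  also have "\<dots> = complex_of_real \<epsilon> / (D z)\<^sup>2" by (simp add: D_def power2_eq_square)
  finally show "dbar (reg_kernel a \<epsilon>) z = complex_of_real (\<epsilon> / ((cmod (z - a))\<^sup>2 + \<epsilon>)\<^sup>2)"
    unfolding D_def reg_kernel_denominator by simp
qed

lemma cmod_reg_kernel_le:
  assumes "0 < \<epsilon>"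
  shows "cmod (reg_kernel a \<epsilon> z) \<le> cmod (a - z) powr (- 1)"
proof (cases "z = a")
  case False
  then have p: "0 < cmod (z - a)" by simp
  have "cmod (reg_kernel a \<epsilon> z) = cmod (z - a) / ((cmod (z - a))\<^sup>2 + \<epsilon>)"
    unfolding reg_kernel_def reg_kernel_denominator norm_divide complex_mod_cnj norm_of_real using assms by simp
  also have "\<dots> \<le> cmod (z - a) / (cmod (z - a))\<^sup>2"
    using p assms by (intro divide_left_mono) (auto intro!: mult_pos_pos add_pos_pos)
  also have "\<dots> = cmod (a - z) powr (- 1)"
    using p by (simp add: powr_minus power2_eq_square field_simps norm_minus_commute)
  finally show ?thesis .
qed (simp add: reg_kernel_def)

text \<open>
  Integrate by parts against the smoothed kernel and let \<open>\<epsilon> \<rightarrow> 0\<close>. As \<open>f a = 0\<close>, the Lipschitz bound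
  \<open>|f z| \<le> L * |z - a|\<close> makes \<open>f * dbar (reg_kernel a \<epsilon>)\<close> dominated by a multiple of \<open>1 / |z - a|\<close>, so both
  sides converge by dominated convergence.
\<close>

lemma pompeiu_vanishing:
  assumes f: "C1_supported f 1" and 0: "f a = 0"
  shows "(LINT z|lborel. dbar f z / (z - a)) = 0"
proof -
  define \<epsilon> where "\<epsilon> n = inverse (real (Suc n))" for n
  have \<epsilon>: "0 < \<epsilon> n" for n by (simp add: \<epsilon>_def)
  have \<epsilon>0: "\<epsilon> \<longlonglongrightarrow> 0" unfolding \<epsilon>_def by (rule LIMSEQ_inverse_real_of_nat)
  have cf: "continuous_on UNIV f" using f by (rule C1_supported_continuous)
  have df: "f differentiable (at z)" for z using f by (auto simp: C1_supported_def)
  have mb: "dbar f \<in> borel_measurable borel" by (intro borel_measurable_continuous_onI continuous_dbar[OF f])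
  have mf: "f \<in> borel_measurable borel" by (intro borel_measurable_continuous_onI cf)
  have mr: "reg_kernel a (\<epsilon> n) \<in> borel_measurable borel" "dbar (reg_kernel a (\<epsilon> n)) \<in> borel_measurable borel" for n
  proof -
    have "continuous_on UNIV (reg_kernel a (\<epsilon> n))"
      using reg_kernel_facts(1)[OF \<epsilon>] by (auto simp: continuous_on_eq_continuous_at differentiable_imp_continuous_within)
    then show "reg_kernel a (\<epsilon> n) \<in> borel_measurable borel" by (rule borel_measurable_continuous_onI)
    show "dbar (reg_kernel a (\<epsilon> n)) \<in> borel_measurable borel"
      unfolding reg_kernel_facts(3)[OF \<epsilon>, abs_def] by measurable
  qed
  obtain C where C: "0 \<le> C" "\<And>z. cmod (dbar f z) \<le> C"
    using continuous_supported_bounded[OF continuous_dbar[OF f], of 1] dbar_eq_0_outside[OF f] by (metis less_imp_le)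
  obtain L where L: "0 \<le> L" "\<And>z w. cmod (f z - f w) \<le> L * cmod (z - w)"
    using C1_supported_lipschitz[OF f] by metis
  define w where "w z = indicator disc z * cmod (a - z) powr (- 1)" for z
  have w: "integrable lborel w" unfolding w_def by (rule integrable_riesz) auto
  have bA: "cmod (dbar f z * reg_kernel a (\<epsilon> n) z) \<le> C * w z" for z n
  proof (cases "z \<in> disc")
    case True
    have "cmod (dbar f z) * cmod (reg_kernel a (\<epsilon> n) z) \<le> C * cmod (a - z) powr (- 1)"
      using C cmod_reg_kernel_le[OF \<epsilon>, of a n z] by (intro mult_mono) auto
    then show ?thesis using True by (simp add: w_def norm_mult)
  qed (use dbar_eq_0_outside[OF f, of z] in \<open>simp add: w_def\<close>)
  have bB: "cmod (f z * dbar (reg_kernel a (\<epsilon> n)) z) \<le> L * w z" for z n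
  proof (cases "z \<in> disc \<and> z \<noteq> a")
    case True
    define r where "r = cmod (z - a)"
    have r: "r > 0" using True by (simp add: r_def)
    have "cmod (f z * dbar (reg_kernel a (\<epsilon> n)) z) = cmod (f z) * (\<epsilon> n / (r\<^sup>2 + \<epsilon> n)\<^sup>2)"
      unfolding reg_kernel_facts(3)[OF \<epsilon>] norm_mult norm_of_real r_def using \<epsilon>[of n] by simp
    also have "\<dots> \<le> (L * r) * (1 / r\<^sup>2)"
    proof (rule mult_mono)
      show "cmod (f z) \<le> L * r" using L(2)[of z a] 0 by (simp add: r_def)
      have "0 \<le> (r\<^sup>2)\<^sup>2 + r\<^sup>2 * \<epsilon> n + (\<epsilon> n)\<^sup>2" using \<epsilon>[of n] by simp
      then have "\<epsilon> n * r\<^sup>2 \<le> (r\<^sup>2 + \<epsilon> n)\<^sup>2" by (simp add: power2_sum algebra_simps)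
      moreover have "0 < r\<^sup>2 + \<epsilon> n" using \<epsilon>[of n] r by (simp add: add_pos_pos)
      ultimately show "\<epsilon> n / (r\<^sup>2 + \<epsilon> n)\<^sup>2 \<le> 1 / r\<^sup>2" using r by (simp add: divide_simps)
    qed (use L r \<epsilon>[of n] in auto)
    also have "\<dots> = L * w z"
      using True r by (simp add: w_def powr_minus r_def norm_minus_commute power2_eq_square field_simps)
    finally show ?thesis .
  next
    case False
    then have "f z = 0" using 0 f by (auto simp: C1_supported_def)
    then show ?thesis using L by (simp add: w_def)
  qed
  have iA: "integrable lborel (\<lambda>z. dbar f z * reg_kernel a (\<epsilon> n) z)" for n
    by (rule Bochner_Integration.integrable_bound[OF integrable_mult_right[OF w, of C]])
       (use bA mb mr C in \<open>auto intro!: AE_I2 order.trans[OF bA] mult_mono\<close>)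
  have iB: "integrable lborel (\<lambda>z. f z * dbar (reg_kernel a (\<epsilon> n)) z)" for n
    by (rule Bochner_Integration.integrable_bound[OF integrable_mult_right[OF w, of L]])
       (use bB mf mr L in \<open>auto intro!: AE_I2 order.trans[OF bB] mult_mono\<close>)
  have eq: "(LINT z|lborel. dbar f z * reg_kernel a (\<epsilon> n) z) = - (LINT z|lborel. f z * dbar (reg_kernel a (\<epsilon> n)) z)" for n
  proof -
    have "(LINT z|lborel. dbar (\<lambda>z. f z * reg_kernel a (\<epsilon> n) z) z) = 0"
      by (rule integral_dbar_eq_0[OF C1_supported_mult[OF f]]) (intro reg_kernel_facts \<epsilon>)+
    then have "(LINT z|lborel. f z * dbar (reg_kernel a (\<epsilon> n)) z + dbar f z * reg_kernel a (\<epsilon> n) z) = 0"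
      using dbar_mult[OF df reg_kernel_facts(1)[OF \<epsilon>]] by simp
    then show ?thesis using iA iB by (simp add: add_eq_0_iff2 add_eq_0_iff)
  qed
  have lim1: "(\<lambda>n. LINT z|lborel. dbar f z * reg_kernel a (\<epsilon> n) z) \<longlonglongrightarrow> (LINT z|lborel. dbar f z / (z - a))"
  proof (rule integral_dominated_convergence[where w = "\<lambda>z. C * w z"])
    show "AE z in lborel. (\<lambda>n. dbar f z * reg_kernel a (\<epsilon> n) z) \<longlonglongrightarrow> dbar f z / (z - a)"
    proof (rule AE_I2)
      fix z
      show "(\<lambda>n. dbar f z * reg_kernel a (\<epsilon> n) z) \<longlonglongrightarrow> dbar f z / (z - a)"
      proof (cases "z = a")
        case False
        have "(\<lambda>n. dbar f z * reg_kernel a (\<epsilon> n) z) \<longlonglongrightarrow> dbar f z * (cnj (z - a) / ((z - a) * cnj (z - a) + complex_of_real 0))"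
          unfolding reg_kernel_def using False by (intro tendsto_intros \<epsilon>0) auto
        then show ?thesis using False by simp
      qed (simp add: reg_kernel_def)
    qed
  qed (use mb mr w bA in auto)
  have lim2: "(\<lambda>n. LINT z|lborel. f z * dbar (reg_kernel a (\<epsilon> n)) z) \<longlonglongrightarrow> (LINT (z::complex)|lborel. 0)"
  proof (rule integral_dominated_convergence[where w = "\<lambda>z. L * w z"])
    show "AE z in lborel. (\<lambda>n. f z * dbar (reg_kernel a (\<epsilon> n)) z) \<longlonglongrightarrow> 0"
    proof (rule AE_I2)
      fix z
      show "(\<lambda>n. f z * dbar (reg_kernel a (\<epsilon> n)) z) \<longlonglongrightarrow> 0"
      proof (cases "z = a")
        case False
        have "(\<lambda>n. f z * dbar (reg_kernel a (\<epsilon> n)) z) \<longlonglongrightarrow> f z * complex_of_real (0 / ((cmod (z - a))\<^sup>2 + 0)\<^sup>2)"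
          unfolding reg_kernel_facts(3)[OF \<epsilon>] using False by (intro tendsto_intros \<epsilon>0) auto
        then show ?thesis by simp
      qed (use 0 in simp)
    qed
  qed (use mf mr w bB in auto)
  have "(\<lambda>n. LINT z|lborel. dbar f z * reg_kernel a (\<epsilon> n) z) \<longlonglongrightarrow> - (LINT (z::complex)|lborel. 0)"
    unfolding eq by (rule tendsto_minus[OF lim2])
  then show ?thesis using LIMSEQ_unique[OF lim1] by simp
qed

text \<open>
  The constant of the Pompeiu formula (that is, \<open>\<pi>\<close>), read off from one bump function, for which the
  formula can be evaluated explicitly and shows a positive constant.
\<close>

definition cauchy_const :: real where
  "cauchy_const = (LINT z|lborel. cmod (bump 2 0 1 z)) / flat 0 1"

lemma cauchy_const_pos: "0 < cauchy_const"
  unfolding cauchy_const_def using bump_facts(4)[of 1 2 0] by (simp add: flat_def)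

lemma dbar_bump: "dbar (bump 0 a e) z = - bump 2 a e z * (z - a)"
  unfolding dbar_def ddir_bump by (simp add: inner_complex_def complex_eq_iff numeral_2_eq_2 field_simps)

text \<open>
  The factor \<open>z - a\<close> in \<open>dbar (bump 0 a e)\<close> cancels the Cauchy kernel off the null set \<open>{a}\<close>.
\<close>

lemma integral_dbar_bump:
  assumes "0 < e"
  shows "(LINT z|lborel. dbar (bump 0 a e) z / (z - a)) = - complex_of_real (LINT z|lborel. cmod (bump 2 0 e z))"
    and "integrable lborel (\<lambda>z. dbar (bump 0 a e) z / (z - a))"
proof -
  have AE: "AE z in lborel. - bump 2 a e z = dbar (bump 0 a e) z / (z - a)"
    using AE_lborel_singleton[of a] by eventually_elim (auto simp: dbar_bump)
  have m: "(\<lambda>z. dbar (bump 0 a e) z / (z - a)) \<in> borel_measurable borel"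
    unfolding dbar_bump using bump_facts(2)[OF assms, of 2 a] by measurable
  note i = bump_facts(2,3)[OF assms, of 2 a]
  show "integrable lborel (\<lambda>z. dbar (bump 0 a e) z / (z - a))"
    using integrable_cong_AE[THEN iffD1, OF _ _ AE] i m by simp
  have "(LINT z|lborel. dbar (bump 0 a e) z / (z - a)) = (LINT z|lborel. - bump 2 a e z)"
    using AE m i by (intro integral_cong_AE) auto
  also have "\<dots> = - (LINT z|lborel. bump 2 0 e (z - a))"
    using bump_translate[of 2 0 a e] by simp
  also have "\<dots> = - (LINT z|lborel. bump 2 0 e z)"
    using lborel_integral_translate[OF bump_facts(2)[OF assms]] by metis
  also have "(LINT z|lborel. bump 2 0 e z) = (LINT z|lborel. complex_of_real (cmod (bump 2 0 e z)))"
    by (simp add: cmod_bump)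
  finally show "(LINT z|lborel. dbar (bump 0 a e) z / (z - a)) = - complex_of_real (LINT z|lborel. cmod (bump 2 0 e z))"
    by simp
qed

lemma integrable_cauchy_dbar:
  assumes f: "C1_supported f 1"
  shows "integrable lborel (\<lambda>z. dbar f z / (z - a))"
proof -
  obtain C where C: "0 \<le> C" "\<And>z. cmod (dbar f z) \<le> C"
    using continuous_supported_bounded[OF continuous_dbar[OF f], of 1] dbar_eq_0_outside[OF f] by (metis less_imp_le)
  have "cmod (dbar f z / (z - a)) \<le> C * (indicator disc z * cmod (a - z) powr (- 1))" for z
  proof (cases "z \<in> disc")
    case True
    then show ?thesis using C(2)[of z]
      by (simp add: norm_divide norm_mult norm_inverse powr_minus norm_minus_commute[of a z] divide_inverse mult_right_mono)
  qed (use dbar_eq_0_outside[OF f, of z] in simp)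
  then show ?thesis
    using C(1) borel_measurable_continuous_onI[OF continuous_dbar[OF f]]
    by (intro Bochner_Integration.integrable_bound[OF integrable_mult_right[OF integrable_riesz(1)[of 1 a], of C]]) auto
qed

text \<open>
  Subtracting a multiple of a bump at \<open>a\<close> reduces the formula to functions vanishing at \<open>a\<close>. The bump
  has to be narrow to fit into the disc, so the same reduction at \<open>0\<close> is used to see that the
  constant does not depend on its width.
\<close>

lemma pompeiu:
  assumes f: "C1_supported f 1" and a: "a \<in> disc"
  shows "(LINT z|lborel. dbar f z / (z - a)) = - complex_of_real cauchy_const * f a"
proof -
  define N where "N e = (LINT z|lborel. cmod (bump 2 0 e z))" for e
  have lin: "(LINT z|lborel. dbar f z / (z - b)) = - c * complex_of_real (N e)"
    if f: "C1_supported f 1" and b: "cmod b + e \<le> 1" "0 < e" and c: "f b = - c * complex_of_real (flat 0 (e\<^sup>2)) * (-1)" for f b e c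
  proof -
    have B: "C1_supported (bump 0 b e) 1" using b by (intro C1_supported_bump) auto
    (* The multiple c of the bump is chosen to cancel the value of f at b. *)
    have "(LINT z|lborel. dbar (\<lambda>z. f z + (- c) * bump 0 b e z) z / (z - b)) = 0"
      using c by (intro pompeiu_vanishing C1_supported_lincomb[OF f B]) (simp add: bump_def)
    then have "(LINT z|lborel. dbar f z / (z - b) - c * (dbar (bump 0 b e) z / (z - b))) = 0"
      unfolding C1_supported_lincomb(2)[OF f B] by (simp add: diff_divide_distrib)
    also have "(LINT z|lborel. dbar f z / (z - b) - c * (dbar (bump 0 b e) z / (z - b)))
      = (LINT z|lborel. dbar f z / (z - b)) - (LINT z|lborel. c * (dbar (bump 0 b e) z / (z - b)))"
      using integrable_cauchy_dbar[OF f, of b] integral_dbar_bump(2)[OF b(2), of b]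
      by (intro Bochner_Integration.integral_diff integrable_mult_right)
    also have "(LINT z|lborel. c * (dbar (bump 0 b e) z / (z - b))) = - c * complex_of_real (N e)"
      unfolding integral_mult_right_zero integral_dbar_bump(1)[OF b(2)] N_def by simp
    finally show ?thesis by (simp add: add_eq_0_iff)
  qed
  have Ne: "complex_of_real (N e) = complex_of_real (flat 0 (e\<^sup>2)) * complex_of_real cauchy_const" if e: "0 < e" "e \<le> 1" for e
  proof -
    have fl: "flat 0 1 \<noteq> 0" "flat 0 (e\<^sup>2) \<noteq> 0" using e by (auto simp: flat_def)
    have B: "C1_supported (bump 0 0 e) 1" using e by (intro C1_supported_bump) auto
    have "(LINT z|lborel. dbar (bump 0 0 e) z / (z - 0))
        = - (complex_of_real (flat 0 (e\<^sup>2)) / complex_of_real (flat 0 1)) * complex_of_real (N 1)"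
      by (rule lin[OF B]) (use fl in \<open>auto simp: bump_def\<close>)
    moreover have "(LINT z|lborel. dbar (bump 0 0 e) z / (z - 0)) = - complex_of_real (N e)"
      unfolding N_def by (rule integral_dbar_bump(1)[OF e(1)])
    ultimately have "complex_of_real (N e) = (complex_of_real (flat 0 (e\<^sup>2)) / complex_of_real (flat 0 1)) * complex_of_real (N 1)"
      by simp
    then show ?thesis using fl by (simp add: cauchy_const_def N_def)
  qed
  define e where "e = 1 - cmod a"
  have e: "0 < e" "e \<le> 1" using a by (auto simp: e_def)
  have fl: "complex_of_real (flat 0 (e\<^sup>2)) \<noteq> 0" using e by (simp add: flat_def)
  have "(LINT z|lborel. dbar f z / (z - a)) = - (f a / complex_of_real (flat 0 (e\<^sup>2))) * complex_of_real (N e)"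
    by (rule lin[OF f]) (use e fl in \<open>auto simp: e_def\<close>)
  also have "\<dots> = - complex_of_real cauchy_const * f a"
    unfolding Ne[OF e] using fl by simp
  finally show ?thesis .
qed

section \<open>Poisson averages and subordination\<close>

definition circle_mean :: "(complex \<Rightarrow> 'b) \<Rightarrow> 'b::{real_normed_vector}" where
  "circle_mean f = (1 / (2 * pi)) *\<^sub>R integral {0..2 * pi} (\<lambda>t. f (cis t))"

lemma cis_integrable:
  fixes f :: "complex \<Rightarrow> 'b::{real_normed_vector, banach}"
  assumes "continuous_on circle f"
  shows "(\<lambda>t. f (cis t)) integrable_on {0..2 * pi}"
  by (intro integrable_continuous_interval continuous_on_compose2[OF assms])
     (auto intro!: continuous_intros)

lemma circle_mean_add:
  fixes f g :: "complex \<Rightarrow> 'b::{real_normed_vector, banach}"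
  assumes "continuous_on circle f" "continuous_on circle g"
  shows "circle_mean (\<lambda>z. f z + g z) = circle_mean f + circle_mean g"
  using integral_add[OF cis_integrable[OF assms(1)] cis_integrable[OF assms(2)]]
  by (simp add: circle_mean_def scaleR_add_right)

lemma circle_mean_mult:
  fixes f :: "complex \<Rightarrow> 'b::real_normed_field"
  shows "circle_mean (\<lambda>z. c * f z) = c * circle_mean f"
  by (simp add: circle_mean_def)

lemma circle_mean_const: "circle_mean (\<lambda>z. c :: real) = c"
  by (simp add: circle_mean_def)

lemma circle_mean_mono:
  fixes f g :: "complex \<Rightarrow> real"
  assumes "continuous_on circle f" "continuous_on circle g" "\<And>z. z \<in> circle \<Longrightarrow> f z \<le> g z"
  shows "circle_mean f \<le> circle_mean g"
  unfolding circle_mean_def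
  by (intro scaleR_left_mono integral_le cis_integrable assms) (auto intro!: assms)

lemma circle_mean_norm:
  fixes f :: "complex \<Rightarrow> complex"
  assumes "continuous_on circle f"
  shows "cmod (circle_mean f) \<le> circle_mean (\<lambda>z. cmod (f z))"
proof -
  have "cmod (integral {0..2 * pi} (\<lambda>t. f (cis t))) \<le> integral {0..2 * pi} (\<lambda>t. cmod (f (cis t)))"
    by (intro integral_norm_bound_integral cis_integrable assms continuous_on_norm) auto
  then show ?thesis by (simp add: circle_mean_def divide_right_mono)
qed

text \<open>
  Cauchy's integral formula on the circle of radius \<open>r\<close>, written as an average.
\<close>

lemma circle_mean_cauchy:
  assumes g: "g holomorphic_on cball 0 r" and b: "cmod b < r"
  shows "circle_mean (\<lambda>\<zeta>. g (complex_of_real r * \<zeta>) * (complex_of_real r * \<zeta> / (complex_of_real r * \<zeta> - b))) = g b"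
proof -
  have "((\<lambda>u. g u / (u - b)) has_contour_integral (2 * of_real pi * \<i> * g b)) (circlepath 0 r)"
    using Cauchy_integral_circlepath_simple[OF g] b by simp
  then have "((\<lambda>t. g (r * cis t) / (r * cis t - b) * r * \<i> * cis t) has_integral (2 * of_real pi * \<i> * g b)) {0..2 * pi}"
    unfolding circlepath_def using has_contour_integral_part_circlepath_iff[of 0 "2 * pi"] by simp
  from has_integral_mult_right[OF this, of "1 / (2 * of_real pi * \<i>)"]
  have "((\<lambda>t. g (r * cis t) * (r * cis t / (r * cis t - b)) * (1 / (2 * of_real pi))) has_integral g b) {0..2 * pi}"
    by (rule has_integral_eq_rhs[OF has_integral_eq[rotated]]) (auto simp: field_simps)
  then have "integral {0..2 * pi} (\<lambda>t. g (r * cis t) * (r * cis t / (r * cis t - b)) * (1 / (2 * of_real pi))) = g b"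
    by (rule integral_unique)
  then show ?thesis
    unfolding circle_mean_def integral_mult_left by (simp add: scaleR_conv_of_real mult.commute)
qed

definition poisson :: "complex \<Rightarrow> complex \<Rightarrow> real" where
  "poisson b \<zeta> = (1 - (cmod b)\<^sup>2) / (cmod (\<zeta> - b))\<^sup>2"

lemma poisson_nonneg: "cmod b < 1 \<Longrightarrow> 0 \<le> poisson b \<zeta>"
  by (simp add: poisson_def power_le_one)

lemma poisson_0: "\<zeta> \<in> circle \<Longrightarrow> poisson 0 \<zeta> = 1"
  by (simp add: poisson_def)

lemma continuous_poisson: "cmod b < 1 \<Longrightarrow> continuous_on circle (poisson b)"
  unfolding poisson_def by (intro continuous_intros) auto

lemma poisson_lower:
  assumes "cmod b \<le> \<rho>" "\<rho> < 1" "\<zeta> \<in> circle"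
  shows "(1 - \<rho>) / (1 + \<rho>) \<le> poisson b \<zeta>"
proof -
  define r where "r = cmod b"
  have r: "0 \<le> r" "r \<le> \<rho>" "r < 1" using assms by (auto simp: r_def)
  have pos: "0 < cmod (\<zeta> - b)" using assms by auto
  have le: "cmod (\<zeta> - b) \<le> 1 + r"
    using norm_triangle_ineq4[of \<zeta> b] assms(3) by (simp add: r_def)
  have "(1 - \<rho>) / (1 + \<rho>) \<le> (1 - r) / (1 + r)"
    using r assms(2) by (simp add: field_simps)
  also have "\<dots> = (1 - r\<^sup>2) / (1 + r)\<^sup>2"
  proof -
    have "1 - r\<^sup>2 = (1 - r) * (1 + r)" by (simp add: power2_eq_square algebra_simps)
    then show ?thesis using r by (simp add: power2_eq_square)
  qed
  also have "\<dots> \<le> (1 - r\<^sup>2) / (cmod (\<zeta> - b))\<^sup>2"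
    using pos le r by (intro divide_left_mono power_mono) (auto simp: power_le_one)
  finally show ?thesis by (simp add: poisson_def r_def)
qed

lemma poisson_eq_Re:
  assumes "\<zeta> \<in> circle" "cmod b < 1"
  shows "poisson b \<zeta> = Re ((\<zeta> + b) / (\<zeta> - b))"
proof -
  have "(\<zeta> + b) / (\<zeta> - b) = ((\<zeta> + b) * cnj (\<zeta> - b)) / complex_of_real ((cmod (\<zeta> - b))\<^sup>2)"
    by (subst complex_div_cnj) simp
  then have "Re ((\<zeta> + b) / (\<zeta> - b)) = Re ((\<zeta> + b) * cnj (\<zeta> - b)) / (cmod (\<zeta> - b))\<^sup>2"
    by (simp only: Re_divide_of_real)
  also have "Re ((\<zeta> + b) * cnj (\<zeta> - b)) = (cmod \<zeta>)\<^sup>2 - (cmod b)\<^sup>2"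
    by (simp only: cmod_power2) (simp add: power2_eq_square algebra_simps)
  finally show ?thesis using assms by (simp add: poisson_def)
qed

text \<open>
  Cauchy's formula for \<open>h z * (1 - |b|\<^sup>2) / (1 - cnj b * z)\<close>, which takes the value \<open>h b\<close> at \<open>b\<close>
  and on the circle turns the Cauchy kernel into the Poisson kernel.
\<close>

lemma poisson_formula:
  assumes h: "h holomorphic_on cball 0 1" and b: "cmod b < 1"
  shows "circle_mean (\<lambda>\<zeta>. h \<zeta> * complex_of_real (poisson b \<zeta>)) = h b"
proof -
  define g where "g z = h z * (complex_of_real (1 - (cmod b)\<^sup>2) / (1 - cnj b * z))" for z
  have nz: "1 - cnj b * z \<noteq> 0" if "cmod z \<le> 1" for z
  proof
    assume "1 - cnj b * z = 0"
    then have "cmod (cnj b * z) = 1" by simp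
    then have "cmod b * cmod z = 1" by (simp only: norm_mult complex_mod_cnj)
    moreover have "cmod b * cmod z \<le> cmod b * 1" using that by (intro mult_left_mono) auto
    ultimately show False using b by simp
  qed
  have hol: "g holomorphic_on cball 0 1"
    unfolding g_def using nz by (intro holomorphic_intros h) auto
  have gb: "g b = h b"
  proof -
    have "1 - cnj b * b = complex_of_real (1 - (cmod b)\<^sup>2)"
      by (simp only: of_real_diff of_real_1 complex_norm_square mult.commute)
    then show ?thesis unfolding g_def using nz[of b] b by simp
  qed
  have eq: "g \<zeta> * (\<zeta> / (\<zeta> - b)) = h \<zeta> * complex_of_real (poisson b \<zeta>)" if \<zeta>: "\<zeta> \<in> circle" for \<zeta>
  proof -
    have 1: "\<zeta> * cnj \<zeta> = 1" using \<zeta> by (simp add: complex_norm_square[symmetric])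
    have nb: "\<zeta> - b \<noteq> 0" using \<zeta> b by auto
    have "complex_of_real (poisson b \<zeta>) = complex_of_real (1 - (cmod b)\<^sup>2) / ((\<zeta> - b) * cnj (\<zeta> - b))"
      unfolding poisson_def of_real_divide complex_norm_square[symmetric] by simp
    also have "\<dots> = complex_of_real (1 - (cmod b)\<^sup>2) * \<zeta> / ((\<zeta> - b) * (1 - cnj b * \<zeta>))"
    proof -
      have "1 - cnj b * \<zeta> = \<zeta> * cnj (\<zeta> - b)" using 1 by (simp add: algebra_simps)
      moreover have "\<zeta> \<noteq> 0" using \<zeta> by auto
      ultimately show ?thesis by simp
    qed
    finally show ?thesis by (simp add: g_def mult_ac)
  qed
  have "circle_mean (\<lambda>\<zeta>. h \<zeta> * complex_of_real (poisson b \<zeta>)) = circle_mean (\<lambda>\<zeta>. g \<zeta> * (\<zeta> / (\<zeta> - b)))"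
    unfolding circle_mean_def by (subst eq) auto
  then show ?thesis using circle_mean_cauchy[OF hol, of b] b gb by simp
qed

lemma poisson_formula_harmonic:
  assumes h: "h holomorphic_on cball 0 1" and b: "cmod b < 1"
  shows "circle_mean (\<lambda>\<zeta>. (\<alpha> * h \<zeta> + \<beta> * cnj (h \<zeta>)) * complex_of_real (poisson b \<zeta>)) = \<alpha> * h b + \<beta> * cnj (h b)"
proof -
  have c: "continuous_on circle h" using h
    by (intro continuous_on_subset[OF holomorphic_on_imp_continuous_on[OF h]]) auto
  define k where "k \<zeta> = h \<zeta> * complex_of_real (poisson b \<zeta>)" for \<zeta>
  have ck: "continuous_on circle k" unfolding k_def by (intro continuous_intros c continuous_poisson b)
  have "circle_mean (\<lambda>\<zeta>. (\<alpha> * h \<zeta> + \<beta> * cnj (h \<zeta>)) * complex_of_real (poisson b \<zeta>))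
     = circle_mean (\<lambda>\<zeta>. \<alpha> * k \<zeta> + \<beta> * cnj (k \<zeta>))"
    by (simp add: k_def algebra_simps)
  also have "\<dots> = \<alpha> * circle_mean k + \<beta> * circle_mean (\<lambda>\<zeta>. cnj (k \<zeta>))"
    by (subst circle_mean_add) (auto intro!: continuous_intros ck simp: circle_mean_mult)
  also have "circle_mean (\<lambda>\<zeta>. cnj (k \<zeta>)) = cnj (circle_mean k)"
    unfolding circle_mean_def by (simp add: integral_cnj)
  also have "circle_mean k = h b" unfolding k_def by (rule poisson_formula[OF h b])
  finally show ?thesis .
qed

lemma poisson_mean: "cmod b < 1 \<Longrightarrow> circle_mean (poisson b) = 1"
proof -
  assume b: "cmod b < 1"
  have "complex_of_real (circle_mean (poisson b)) = circle_mean (\<lambda>\<zeta>. complex_of_real (poisson b \<zeta>))"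
    unfolding circle_mean_def using integral_linear[OF cis_integrable[OF continuous_poisson[OF b]] bounded_linear_of_real[where 'a=complex]]
    by (simp add: o_def scaleR_conv_of_real)
  then show ?thesis using poisson_formula[of "\<lambda>z. 1" b] b by simp
qed

text \<open>
  The graph of the convex function \<open>x powr p\<close> lies above its tangent at \<open>y\<close>; a form of Young's
  inequality.
\<close>

lemma powr_tangent:
  fixes x y p :: real
  assumes "1 < p" "0 \<le> x" "0 \<le> y"
  shows "y powr p + p * y powr (p - 1) * (x - y) \<le> x powr p"
proof (cases "y = 0")
  case False
  then have y: "0 < y" using assms by simp
  define q where "q = p / (p - 1)"
  have q: "1 < q" "1 / p + 1 / q = 1" using assms by (auto simp: q_def field_simps)
  have "x * y powr (p - 1) \<le> x powr p / p + (y powr (p - 1)) powr q / q"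
    using assms q by (intro Youngs_inequality) auto
  also have "(y powr (p - 1)) powr q = y powr p"
    using assms by (simp add: powr_powr q_def)
  finally have "p * (x * y powr (p - 1)) \<le> x powr p + (p - 1) * y powr p"
    using assms by (simp add: q_def field_simps)
  moreover have "y powr (p - 1) * y = y powr p"
    using y by (simp add: powr_diff)
  ultimately show ?thesis by (simp add: algebra_simps)
qed (use assms in simp)

text \<open>
  Jensen's inequality for the probability density \<open>poisson b\<close>, obtained by averaging the tangent
  inequality at \<open>|F b|\<close>.
\<close>

lemma poisson_jensen:
  fixes \<alpha> \<beta> :: complex
  assumes h: "h holomorphic_on cball 0 1" and b: "cmod b < 1" and p: "1 < p"
  defines "F \<equiv> \<lambda>z. \<alpha> * h z + \<beta> * cnj (h z)"
  shows "cmod (F b) powr p \<le> circle_mean (\<lambda>\<zeta>. cmod (F \<zeta>) powr p * poisson b \<zeta>)"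
proof -
  have c: "continuous_on circle h" using h
    by (intro continuous_on_subset[OF holomorphic_on_imp_continuous_on[OF h]]) auto
  have cF: "continuous_on circle F" unfolding F_def by (intro continuous_intros c)
  note cP = continuous_poisson[OF b]
  have cFp: "continuous_on circle (\<lambda>\<zeta>. cmod (F \<zeta>) powr p)"
    using p by (intro continuous_on_powr' continuous_intros cF) auto
  define y where "y = cmod (F b)"
  have "y = cmod (circle_mean (\<lambda>\<zeta>. F \<zeta> * complex_of_real (poisson b \<zeta>)))"
    unfolding y_def F_def poisson_formula_harmonic[OF h b] ..
  also have "\<dots> \<le> circle_mean (\<lambda>\<zeta>. cmod (F \<zeta> * complex_of_real (poisson b \<zeta>)))"
    by (intro circle_mean_norm continuous_intros cF cP)
  also have "\<dots> = circle_mean (\<lambda>\<zeta>. cmod (F \<zeta>) * poisson b \<zeta>)"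
    using poisson_nonneg[OF b] by (simp add: norm_mult)
  finally have y: "y \<le> circle_mean (\<lambda>\<zeta>. cmod (F \<zeta>) * poisson b \<zeta>)" .
  define A B where "A = y powr p - p * y powr (p - 1) * y" and "B = p * y powr (p - 1)"
  have B: "0 \<le> B" using p by (simp add: B_def)
  have "y powr p = A * 1 + B * y" by (simp add: A_def B_def)
  also have "\<dots> \<le> A * circle_mean (poisson b) + B * circle_mean (\<lambda>\<zeta>. cmod (F \<zeta>) * poisson b \<zeta>)"
    using y B poisson_mean[OF b] by (simp add: mult_left_mono)
  also have "\<dots> = circle_mean (\<lambda>\<zeta>. A * poisson b \<zeta> + B * (cmod (F \<zeta>) * poisson b \<zeta>))"
    by (subst circle_mean_add) (auto intro!: continuous_intros cF cP simp: circle_mean_mult)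
  also have "\<dots> \<le> circle_mean (\<lambda>\<zeta>. cmod (F \<zeta>) powr p * poisson b \<zeta>)"
  proof (rule circle_mean_mono)
    fix \<zeta> :: complex
    have "A + B * cmod (F \<zeta>) \<le> cmod (F \<zeta>) powr p"
      using powr_tangent[OF p, of "cmod (F \<zeta>)" y] by (simp add: A_def B_def y_def algebra_simps)
    from mult_right_mono[OF this poisson_nonneg[OF b, of \<zeta>]]
    show "A * poisson b \<zeta> + B * (cmod (F \<zeta>) * poisson b \<zeta>) \<le> cmod (F \<zeta>) powr p * poisson b \<zeta>"
      by (simp add: algebra_simps)
  qed (intro continuous_intros cF cP cFp)+
  finally show ?thesis by (simp add: y_def)
qed

text \<open>
  As a function of \<open>z\<close>, \<open>poisson (\<phi> z) \<eta>\<close> is the real part of the holomorphic function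
  \<open>(\<eta> + \<phi> z) / (\<eta> - \<phi> z)\<close>, hence has the mean value property.
\<close>

lemma mean_poisson_compose:
  assumes \<phi>: "\<phi> holomorphic_on disc" "\<phi> ` disc \<subseteq> disc" and r: "0 \<le> r" "r < 1" and \<eta>: "\<eta> \<in> circle"
  shows "circle_mean (\<lambda>\<zeta>. poisson (\<phi> (complex_of_real r * \<zeta>)) \<eta>) = poisson (\<phi> 0) \<eta>"
proof (cases "r = 0")
  case False
  then have r0: "0 < r" using r by simp
  have lt: "cmod (\<phi> z) < 1" if "z \<in> disc" for z using \<phi>(2) that by (auto simp: image_subset_iff)
  define k where "k z = (\<eta> + \<phi> z) / (\<eta> - \<phi> z)" for z
  have k: "k holomorphic_on cball 0 r"
    unfolding k_def
  proof -
    have "\<phi> holomorphic_on cball 0 r" using r by (intro holomorphic_on_subset[OF \<phi>(1)]) auto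
    moreover have "\<eta> - \<phi> z \<noteq> 0" if "z \<in> cball 0 r" for z using lt[of z] \<eta> r that by auto
    ultimately show "(\<lambda>z. (\<eta> + \<phi> z) / (\<eta> - \<phi> z)) holomorphic_on cball 0 r"
      by (intro holomorphic_intros) auto
  qed
  have inD: "complex_of_real r * \<zeta> \<in> disc" if "\<zeta> \<in> circle" for \<zeta>
    using that r by (simp add: norm_mult)
  have "circle_mean (\<lambda>\<zeta>. k (complex_of_real r * \<zeta>)) = k 0"
  proof -
    have "circle_mean (\<lambda>\<zeta>. k (complex_of_real r * \<zeta>)) =
      circle_mean (\<lambda>\<zeta>. k (complex_of_real r * \<zeta>) * (complex_of_real r * \<zeta> / (complex_of_real r * \<zeta> - 0)))"
      unfolding circle_mean_def using r0 by simp
    then show ?thesis using circle_mean_cauchy[OF k, of 0] r0 by simp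
  qed
  moreover have "circle_mean (\<lambda>\<zeta>. Re (k (complex_of_real r * \<zeta>))) = Re (circle_mean (\<lambda>\<zeta>. k (complex_of_real r * \<zeta>)))"
  proof -
    have "continuous_on circle (\<lambda>\<zeta>. k (complex_of_real r * \<zeta>))"
      by (intro continuous_on_compose2[OF holomorphic_on_imp_continuous_on[OF k]] continuous_intros)
         (use r in \<open>auto simp: norm_mult\<close>)
    from integral_linear[OF cis_integrable[OF this] bounded_linear_Re]
    show ?thesis by (simp add: circle_mean_def o_def)
  qed
  moreover have "circle_mean (\<lambda>\<zeta>. poisson (\<phi> (complex_of_real r * \<zeta>)) \<eta>) = circle_mean (\<lambda>\<zeta>. Re (k (complex_of_real r * \<zeta>)))"
    unfolding circle_mean_def k_def
    using inD lt \<eta> by (intro arg_cong2[where f = "(*\<^sub>R)"] refl integral_cong poisson_eq_Re) auto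
  moreover have "poisson (\<phi> 0) \<eta> = Re (k 0)" unfolding k_def using lt \<eta> by (intro poisson_eq_Re) auto
  ultimately show ?thesis by simp
qed (simp add: circle_mean_const)

lemma powr_continuous_on:
  fixes f :: "'a::topological_space \<Rightarrow> complex"
  assumes "continuous_on S f" "0 < p"
  shows "continuous_on S (\<lambda>x. cmod (f x) powr p)"
  using assms by (intro continuous_on_powr' continuous_intros) auto

lemma continuous_circle_mean_dilate:
  fixes G :: "complex \<Rightarrow> real"
  assumes "continuous_on (cball 0 1) G"
  shows "continuous_on {0..1} (\<lambda>r. circle_mean (\<lambda>\<zeta>. G (complex_of_real r * \<zeta>)))"
proof -
  have "continuous_on ({0..1} \<times> cbox 0 (2 * pi)) (\<lambda>(r, t). G (complex_of_real r * cis t))"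
    unfolding case_prod_beta
    by (intro continuous_on_compose2[OF assms]) (auto intro!: continuous_intros simp: norm_mult)
  from integral_continuous_on_param[OF this] show ?thesis
    unfolding circle_mean_def by (intro continuous_intros) simp
qed

lemma poisson_average:
  assumes \<phi>: "\<phi> holomorphic_on disc" "\<phi> ` disc \<subseteq> disc" and r: "0 \<le> r" "r < 1"
    and w: "continuous_on circle w"
  shows "circle_mean (\<lambda>\<zeta>. circle_mean (\<lambda>\<eta>. w \<eta> * poisson (\<phi> (complex_of_real r * \<zeta>)) \<eta>))
    = circle_mean (\<lambda>\<eta>. w \<eta> * poisson (\<phi> 0) \<eta>)"
proof -
  have lt: "cmod (\<phi> z) < 1" if "z \<in> disc" for z using \<phi>(2) that by (auto simp: image_subset_iff)
  have c\<phi>: "continuous_on disc \<phi>" using \<phi>(1) by (rule holomorphic_on_imp_continuous_on)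
  have inD: "complex_of_real r * cis t \<in> disc" for t
    using r by (simp add: norm_mult)
  have c1: "continuous_on (cbox (0, 0) (2 * pi, 2 * pi)) (\<lambda>x. \<phi> (complex_of_real r * cis (fst x)))"
    using inD by (intro continuous_on_compose2[OF c\<phi>]) (auto intro!: continuous_intros)
  have c2: "continuous_on (cbox (0, 0) (2 * pi, 2 * pi :: real)) (\<lambda>x :: real \<times> real. w (cis (snd x)))"
    by (intro continuous_on_compose2[OF w]) (auto intro!: continuous_intros)
  have ne: "cmod (cis s - \<phi> (complex_of_real r * cis t)) \<noteq> 0" for s t
    using lt[OF inD[of t]] norm_cis[of s] by (metis norm_eq_zero right_minus_eq less_irrefl)
  have "continuous_on (cbox (0, 0) (2 * pi, 2 * pi))
     (\<lambda>x. w (cis (snd x)) * poisson (\<phi> (complex_of_real r * cis (fst x))) (cis (snd x)))"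
    unfolding poisson_def using ne by (intro continuous_intros c1 c2) auto
  then have cont: "continuous_on (cbox (0, 0) (2 * pi, 2 * pi))
     (\<lambda>(t, s). w (cis s) * poisson (\<phi> (complex_of_real r * cis t)) (cis s))"
    by (simp add: case_prod_beta)
  have "circle_mean (\<lambda>\<zeta>. circle_mean (\<lambda>\<eta>. w \<eta> * poisson (\<phi> (complex_of_real r * \<zeta>)) \<eta>))
     = circle_mean (\<lambda>\<eta>. circle_mean (\<lambda>\<zeta>. w \<eta> * poisson (\<phi> (complex_of_real r * \<zeta>)) \<eta>))"
    using integral_swap_continuous[OF cont] by (simp add: circle_mean_def)
  also have "\<dots> = circle_mean (\<lambda>\<eta>. w \<eta> * circle_mean (\<lambda>\<zeta>. poisson (\<phi> (complex_of_real r * \<zeta>)) \<eta>))"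
    by (simp add: circle_mean_mult)
  also have "\<dots> = circle_mean (\<lambda>\<eta>. w \<eta> * poisson (\<phi> 0) \<eta>)"
    unfolding circle_mean_def[of "\<lambda>\<eta>. w \<eta> * _ \<eta>"]
    using mean_poisson_compose[OF \<phi> r] by simp
  finally show ?thesis .
qed

text \<open>
  Littlewood's subordination principle with a remainder. The cutoff \<open>\<theta>\<close> marks points of the disc of
  radius \<open>\<rho>\<close>. There \<open>|F b|\<^sup>p \<le> \<epsilon>\<close>, while the Poisson average of \<open>|F|\<^sup>p\<close> at \<open>b\<close> is at least
  \<open>(1 - \<rho>) / (1 + \<rho>)\<close> times the mean, so Jensen's inequality holds with room to spare. The pointwise
  inequality is averaged over \<open>b = \<phi> (r * \<zeta>)\<close>, and then \<open>r\<close> tends to 1.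
\<close>

lemma subordination_deficit:
  fixes \<alpha> \<beta> :: complex and \<Phi> :: "complex \<Rightarrow> complex" and \<theta> :: "complex \<Rightarrow> real"
  assumes \<phi>: "\<phi> holomorphic_on disc" "\<phi> ` disc \<subseteq> disc"
    and \<Phi>: "continuous_on (cball 0 1) \<Phi>" "\<And>z. z \<in> disc \<Longrightarrow> \<Phi> z = \<phi> z" "\<Phi> ` cball 0 1 \<subseteq> cball 0 1"
    and h: "h holomorphic_on cball 0 1" and p: "1 < p"
    and \<rho>: "0 \<le> \<rho>" "\<rho> < 1"
    and \<theta>: "continuous_on (cball 0 1) \<theta>" "\<And>b. 0 \<le> \<theta> b" "\<And>b. \<theta> b \<le> 1" "\<And>b. \<rho> < cmod b \<Longrightarrow> \<theta> b = 0"
  defines "F \<equiv> \<lambda>z. \<alpha> * h z + \<beta> * cnj (h z)"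
  assumes \<epsilon>: "0 \<le> \<epsilon>" "\<And>b. cmod b \<le> \<rho> \<Longrightarrow> cmod (F b) powr p \<le> \<epsilon>"
  shows "circle_mean (\<lambda>\<zeta>. cmod (F (\<Phi> \<zeta>)) powr p)
      + ((1 - \<rho>) / (1 + \<rho>) * circle_mean (\<lambda>\<eta>. cmod (F \<eta>) powr p) - \<epsilon>) * circle_mean (\<lambda>\<zeta>. \<theta> (\<Phi> \<zeta>))
    \<le> circle_mean (\<lambda>\<eta>. cmod (F \<eta>) powr p * poisson (\<phi> 0) \<eta>)"
proof -
  define w where "w \<eta> = cmod (F \<eta>) powr p" for \<eta>
  define d where "d = (1 - \<rho>) / (1 + \<rho>) * circle_mean w - \<epsilon>"
  have cF: "continuous_on (cball 0 1) F" unfolding F_def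
    by (intro continuous_intros holomorphic_on_imp_continuous_on[OF h])
  have cw: "continuous_on (cball 0 1) w" unfolding w_def using p by (intro powr_continuous_on cF) auto
  have cw': "continuous_on circle w" by (rule continuous_on_subset[OF cw]) auto
  have pt: "w b + d * \<theta> b \<le> circle_mean (\<lambda>\<eta>. w \<eta> * poisson b \<eta>)" if b: "cmod b < 1" for b
  proof -
    have J: "w b \<le> circle_mean (\<lambda>\<eta>. w \<eta> * poisson b \<eta>)"
      unfolding w_def F_def by (rule poisson_jensen[OF h b p])
    show ?thesis
    (* If d < 0, the extra term is not positive and plain Jensen suffices. *)
    proof (cases "cmod b \<le> \<rho> \<and> 0 \<le> d")
      case True
      have "(1 - \<rho>) / (1 + \<rho>) * circle_mean w = circle_mean (\<lambda>\<eta>. (1 - \<rho>) / (1 + \<rho>) * w \<eta>)"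
        by (rule circle_mean_mult[symmetric])
      also have "\<dots> \<le> circle_mean (\<lambda>\<eta>. w \<eta> * poisson b \<eta>)"
      proof (rule circle_mean_mono)
        fix \<eta> :: complex assume "\<eta> \<in> circle"
        then have "(1 - \<rho>) / (1 + \<rho>) \<le> poisson b \<eta>" using True \<rho> by (intro poisson_lower) auto
        then show "(1 - \<rho>) / (1 + \<rho>) * w \<eta> \<le> w \<eta> * poisson b \<eta>"
          by (subst mult.commute) (intro mult_left_mono, auto simp: w_def)
      qed (intro continuous_intros cw' continuous_poisson b)+
      finally have "d + \<epsilon> \<le> circle_mean (\<lambda>\<eta>. w \<eta> * poisson b \<eta>)" by (simp add: d_def)
      moreover have "w b \<le> \<epsilon>" using \<epsilon>(2)[of b] True by (simp add: w_def)
      moreover have "d * \<theta> b \<le> d" using True \<theta>(3)[of b] by (simp add: mult_left_le)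
      ultimately show ?thesis by linarith
    next
      case False
      then have "d * \<theta> b \<le> 0" using \<theta>(2,4)[of b] by (cases "cmod b \<le> \<rho>") (auto simp: mult_nonpos_nonneg)
      then show ?thesis using J by linarith
    qed
  qed
  define G where "G z = w (\<Phi> z) + d * \<theta> (\<Phi> z)" for z
  have cG: "continuous_on (cball 0 1) G"
    unfolding G_def
    by (intro continuous_intros continuous_on_compose2[OF cw \<Phi>(1)] continuous_on_compose2[OF \<theta>(1) \<Phi>(1)] \<Phi>(3))
  define I where "I = circle_mean (\<lambda>\<eta>. w \<eta> * poisson (\<phi> 0) \<eta>)"
  have small: "circle_mean (\<lambda>\<zeta>. G (complex_of_real r * \<zeta>)) \<le> I" if r: "r \<in> {0..<1}" for r
  proof -
    have inD: "complex_of_real r * \<zeta> \<in> disc" if "\<zeta> \<in> circle" for \<zeta>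
      using r that by (simp add: norm_mult)
    have c1: "continuous_on circle (\<lambda>\<zeta>. \<phi> (complex_of_real r * \<zeta>))"
      using inD by (intro continuous_on_compose2[OF holomorphic_on_imp_continuous_on[OF \<phi>(1)]]) (auto intro!: continuous_intros)
    have lt: "cmod (\<phi> z) < 1" if "z \<in> disc" for z using \<phi>(2) that by (auto simp: image_subset_iff)
    have "continuous_on (circle \<times> cbox 0 (2 * pi)) (\<lambda>(\<zeta>, t). w (cis t) * poisson (\<phi> (complex_of_real r * \<zeta>)) (cis t))"
    proof -
      have "cmod (cis t - \<phi> (complex_of_real r * \<zeta>)) \<noteq> 0" if "\<zeta> \<in> circle" for \<zeta> t
        using lt[OF inD[OF that]] norm_cis[of t] by (metis norm_eq_zero right_minus_eq less_irrefl)
      moreover have "continuous_on (circle \<times> cbox 0 (2 * pi)) (\<lambda>x::complex \<times> real. w (cis (snd x)))"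
        by (intro continuous_on_compose2[OF cw']) (auto intro!: continuous_intros)
      moreover have "continuous_on (circle \<times> cbox 0 (2 * pi)) (\<lambda>x::complex \<times> real. \<phi> (complex_of_real r * fst x))"
        by (intro continuous_on_compose2[OF c1]) (auto intro!: continuous_intros)
      ultimately show ?thesis
        unfolding case_prod_beta poisson_def by (intro continuous_intros) auto
    qed
    from integral_continuous_on_param[OF this]
    have c2: "continuous_on circle (\<lambda>\<zeta>. circle_mean (\<lambda>\<eta>. w \<eta> * poisson (\<phi> (complex_of_real r * \<zeta>)) \<eta>))"
      unfolding circle_mean_def by (intro continuous_intros) simp
    have "circle_mean (\<lambda>\<zeta>. G (complex_of_real r * \<zeta>))
       \<le> circle_mean (\<lambda>\<zeta>. circle_mean (\<lambda>\<eta>. w \<eta> * poisson (\<phi> (complex_of_real r * \<zeta>)) \<eta>))"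
    proof (rule circle_mean_mono[OF _ c2])
      show "continuous_on circle (\<lambda>\<zeta>. G (complex_of_real r * \<zeta>))"
        by (intro continuous_on_compose2[OF cG]) (use r in \<open>auto intro!: continuous_intros simp: norm_mult\<close>)
      fix \<zeta> :: complex assume \<zeta>: "\<zeta> \<in> circle"
      show "G (complex_of_real r * \<zeta>) \<le> circle_mean (\<lambda>\<eta>. w \<eta> * poisson (\<phi> (complex_of_real r * \<zeta>)) \<eta>)"
        unfolding G_def \<Phi>(2)[OF inD[OF \<zeta>]] by (rule pt[OF lt[OF inD[OF \<zeta>]]])
    qed
    also have "\<dots> = I" unfolding I_def using r by (intro poisson_average[OF \<phi> _ _ cw']) auto
    finally show ?thesis .
  qed
  have "circle_mean (\<lambda>\<zeta>. G (complex_of_real 1 * \<zeta>)) \<le> I"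
    by (rule continuous_le_on_closure[where S = "{0..<1}" and x = "1::real"])
       (use small continuous_circle_mean_dilate[OF cG] in auto)
  moreover have "circle_mean (\<lambda>\<zeta>. G (complex_of_real 1 * \<zeta>)) = circle_mean (\<lambda>\<zeta>. w (\<Phi> \<zeta>)) + d * circle_mean (\<lambda>\<zeta>. \<theta> (\<Phi> \<zeta>))"
  proof -
    have "continuous_on (cball 0 1) (\<lambda>\<zeta>. w (\<Phi> \<zeta>))" "continuous_on (cball 0 1) (\<lambda>\<zeta>. \<theta> (\<Phi> \<zeta>))"
      by (intro continuous_on_compose2[OF cw \<Phi>(1)] continuous_on_compose2[OF \<theta>(1) \<Phi>(1)] \<Phi>(3))+
    then have "continuous_on circle (\<lambda>\<zeta>. w (\<Phi> \<zeta>))" "continuous_on circle (\<lambda>\<zeta>. d * \<theta> (\<Phi> \<zeta>))"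
      by (auto intro!: continuous_intros elim: continuous_on_subset)
    then show ?thesis unfolding G_def by (simp add: circle_mean_add circle_mean_mult)
  qed
  ultimately show ?thesis unfolding w_def d_def I_def by simp
qed

lemma circle_mean_pos:
  fixes f :: "complex \<Rightarrow> real"
  assumes "continuous_on circle f" "\<And>z. z \<in> circle \<Longrightarrow> 0 \<le> f z" "z0 \<in> circle" "0 < f z0"
  shows "0 < circle_mean f"
proof -
  have c: "continuous_on {0..2 * pi} (\<lambda>t. f (cis t))"
    by (intro continuous_on_compose2[OF assms(1)]) (auto intro!: continuous_intros)
  have "z0 = cis (Arg2pi z0)" using Arg2pi[of z0] assms(3)
    by (simp add: cis_conv_exp is_Arg_def)
  moreover have "Arg2pi z0 \<in> {0..2 * pi}" using Arg2pi_ge_0[of z0] Arg2pi_lt_2pi[of z0] by simp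
  ultimately have "integral {0..2 * pi} (\<lambda>t. f (cis t)) \<noteq> 0"
    using integral_eq_0_iff[OF c] assms(2,4) by fastforce
  moreover have "0 \<le> integral {0..2 * pi} (\<lambda>t. f (cis t))"
    using assms(2) by (intro integral_nonneg cis_integrable assms(1)) auto
  ultimately show ?thesis by (simp add: circle_mean_def)
qed

lemma poisson_antipodal:
  assumes "b \<noteq> 0" "cmod b < 1"
  shows "poisson b (- sgn b) < 1"
proof -
  define r where "r = cmod b"
  have r: "0 < r" "r < 1" using assms by (auto simp: r_def)
  have "- sgn b - b = - ((1 + r) *\<^sub>R sgn b)"
    using r by (simp add: r_def sgn_div_norm scaleR_conv_of_real field_simps)
  then have "cmod (- sgn b - b) = 1 + r"
    using r assms by (simp only: norm_minus_cancel norm_scaleR norm_sgn) simp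
  then have "poisson b (- sgn b) = (1 - r\<^sup>2) / (1 + r)\<^sup>2" by (simp add: poisson_def r_def)
  also have "\<dots> < 1"
  proof (subst divide_less_eq_1_pos)
    show "0 < (1 + r)\<^sup>2" using r by simp
    have "0 < 2 * r\<^sup>2 + 2 * r" using r by (intro add_pos_pos) auto
    then show "1 - r\<^sup>2 < (1 + r)\<^sup>2" by (simp add: power2_sum algebra_simps)
  qed
  finally show ?thesis .
qed

text \<open>
  The two ways for the conclusion of the theorem to fail. If \<open>\<phi> 0 \<noteq> 0\<close>, no remainder is needed: near
  \<open>\<zeta>0 = - sgn (\<phi> 0)\<close> the Poisson kernel of \<open>\<phi> 0\<close> stays below some \<open>q < 1\<close>. If \<open>\<phi> 0 = 0\<close>, the Poisson
  kernel is 1 and \<open>\<zeta>0\<close> may be any point; the gain comes from the part of the circle that \<open>\<Phi>\<close> maps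
  into a disc of radius \<open>\<rho> < 1\<close>.
\<close>

lemma composition_loses_mass:
  fixes \<Phi> :: "complex \<Rightarrow> complex"
  assumes \<phi>: "\<phi> holomorphic_on disc" "\<phi> ` disc \<subseteq> disc"
    and \<Phi>: "continuous_on (cball 0 1) \<Phi>" "\<And>z. z \<in> disc \<Longrightarrow> \<Phi> z = \<phi> z" "\<Phi> ` cball 0 1 \<subseteq> cball 0 1"
    and p: "1 < p" and neg: "\<not> (\<Phi> ` circle \<subseteq> circle \<and> \<phi> 0 = 0)"
  obtains \<zeta>0 q \<tau> K where "\<zeta>0 \<in> circle" "0 \<le> q" "q < 1" "0 < \<tau>" "0 \<le> K"
    "\<And>\<alpha> \<beta> h \<epsilon>. h holomorphic_on cball 0 1 \<Longrightarrow> 0 \<le> \<epsilon> \<Longrightarrow>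
       (\<And>z. z \<in> cball 0 1 \<Longrightarrow> \<tau> \<le> cmod (z - \<zeta>0) \<Longrightarrow> cmod (\<alpha> * h z + \<beta> * cnj (h z)) powr p \<le> \<epsilon>) \<Longrightarrow>
       circle_mean (\<lambda>\<zeta>. cmod (\<alpha> * h (\<Phi> \<zeta>) + \<beta> * cnj (h (\<Phi> \<zeta>))) powr p)
       \<le> q * circle_mean (\<lambda>\<zeta>. cmod (\<alpha> * h \<zeta> + \<beta> * cnj (h \<zeta>)) powr p) + K * \<epsilon>"
proof (cases "\<phi> 0 = 0")
  case False
  have a: "cmod (\<phi> 0) < 1" using \<phi>(2) by (auto simp: image_subset_iff)
  define \<zeta>0 where "\<zeta>0 = - sgn (\<phi> 0)"
  have \<zeta>0: "\<zeta>0 \<in> circle" using False by (simp add: \<zeta>0_def norm_sgn)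
  (* Any number strictly between the value of the Poisson kernel at \<zeta>0 and 1 would do. *)
  define q where "q = (poisson (\<phi> 0) \<zeta>0 + 1) / 2"
  have q: "0 \<le> q" "poisson (\<phi> 0) \<zeta>0 < q" "q < 1"
    using poisson_antipodal[OF False a] poisson_nonneg[OF a, of \<zeta>0] by (auto simp: q_def \<zeta>0_def)
  note cP = continuous_poisson[OF a]
  obtain \<tau> where \<tau>: "0 < \<tau>" "\<And>\<zeta>. \<zeta> \<in> circle \<Longrightarrow> cmod (\<zeta> - \<zeta>0) < \<tau> \<Longrightarrow> poisson (\<phi> 0) \<zeta> < q"
  proof -
    obtain \<tau> where "0 < \<tau>" "\<forall>\<zeta>\<in>circle. cmod (\<zeta> - \<zeta>0) < \<tau> \<longrightarrow> \<bar>poisson (\<phi> 0) \<zeta> - poisson (\<phi> 0) \<zeta>0\<bar> < q - poisson (\<phi> 0) \<zeta>0"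
      using cP \<zeta>0 q(2) unfolding continuous_on_iff dist_norm by (metis diff_gt_0_iff_gt real_norm_def)
    then show thesis using that[of \<tau>] by force
  qed
  obtain K where K: "0 < K" "\<And>\<zeta>. \<zeta> \<in> circle \<Longrightarrow> poisson (\<phi> 0) \<zeta> \<le> K"
  proof -
    have "bounded (poisson (\<phi> 0) ` circle)"
      by (intro compact_imp_bounded compact_continuous_image cP) auto
    then obtain K where "0 < K" "\<forall>x\<in>poisson (\<phi> 0) ` circle. norm x \<le> K" by (auto simp: bounded_pos)
    then show thesis using that[of K] by force
  qed
  show thesis
  proof (rule that[OF \<zeta>0 q(1,3) \<tau>(1) less_imp_le[OF K(1)]])
    fix \<alpha> \<beta> :: complex and h :: "complex \<Rightarrow> complex" and \<epsilon> :: real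
    assume h: "h holomorphic_on cball 0 1" and \<epsilon>: "0 \<le> \<epsilon>"
      and off: "\<And>z. z \<in> cball 0 1 \<Longrightarrow> \<tau> \<le> cmod (z - \<zeta>0) \<Longrightarrow> cmod (\<alpha> * h z + \<beta> * cnj (h z)) powr p \<le> \<epsilon>"
    define w where "w \<zeta> = cmod (\<alpha> * h \<zeta> + \<beta> * cnj (h \<zeta>)) powr p" for \<zeta>
    have c: "continuous_on circle h" using h
      by (intro continuous_on_subset[OF holomorphic_on_imp_continuous_on[OF h]]) auto
    have cw: "continuous_on circle w" unfolding w_def using p by (intro powr_continuous_on continuous_intros c) auto
    have "circle_mean (\<lambda>\<zeta>. w (\<Phi> \<zeta>)) \<le> circle_mean (\<lambda>\<eta>. w \<eta> * poisson (\<phi> 0) \<eta>)"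
    proof -
      show ?thesis
        using subordination_deficit[OF \<phi> \<Phi> h p, of 0 "\<lambda>_. 0" "w 0" \<alpha> \<beta>]
        by (simp add: w_def circle_mean_const)
    qed
    also have "\<dots> \<le> circle_mean (\<lambda>\<eta>. q * w \<eta> + K * \<epsilon>)"
    proof (rule circle_mean_mono)
      fix \<eta> :: complex assume \<eta>: "\<eta> \<in> circle"
      show "w \<eta> * poisson (\<phi> 0) \<eta> \<le> q * w \<eta> + K * \<epsilon>"
      proof (cases "cmod (\<eta> - \<zeta>0) < \<tau>")
        case True
        have "w \<eta> * poisson (\<phi> 0) \<eta> \<le> w \<eta> * q"
          using \<tau>(2)[OF \<eta> True] by (intro mult_left_mono) (auto simp: w_def)
        moreover have "0 \<le> K * \<epsilon>" using K(1) \<epsilon> by simp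
        ultimately show ?thesis by (simp add: mult.commute)
      next
        case False
        then have "w \<eta> \<le> \<epsilon>" using off[of \<eta>] \<eta> by (simp add: w_def)
        then have "w \<eta> * poisson (\<phi> 0) \<eta> \<le> \<epsilon> * K"
          using K(2)[OF \<eta>] poisson_nonneg[OF a] \<epsilon> by (intro mult_mono) auto
        moreover have "0 \<le> q * w \<eta>" using q(1) by (simp add: w_def)
        ultimately show ?thesis by (simp add: mult.commute)
      qed
    qed (intro continuous_intros cw cP)+
    also have "\<dots> = q * circle_mean w + K * \<epsilon>"
      by (subst circle_mean_add) (auto intro!: continuous_intros cw simp: circle_mean_mult circle_mean_const)
    finally show "circle_mean (\<lambda>\<zeta>. cmod (\<alpha> * h (\<Phi> \<zeta>) + \<beta> * cnj (h (\<Phi> \<zeta>))) powr p)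
       \<le> q * circle_mean (\<lambda>\<zeta>. cmod (\<alpha> * h \<zeta> + \<beta> * cnj (h \<zeta>)) powr p) + K * \<epsilon>"
      unfolding w_def .
  qed
next
  case True
  then obtain \<zeta>1 where \<zeta>1: "\<zeta>1 \<in> circle" "\<Phi> \<zeta>1 \<notin> circle" using neg by blast
  then have lt1: "cmod (\<Phi> \<zeta>1) < 1" proof -
    have "\<zeta>1 \<in> cball 0 1" using \<zeta>1(1) by simp
    then have "\<Phi> \<zeta>1 \<in> cball 0 1" using \<Phi>(3) by blast
    then show ?thesis using \<zeta>1(2) by simp
  qed
  define \<rho> where "\<rho> = (cmod (\<Phi> \<zeta>1) + 1) / 2"
  have \<rho>: "0 \<le> \<rho>" "\<rho> < 1" "cmod (\<Phi> \<zeta>1) < \<rho>" using lt1 by (auto simp: \<rho>_def)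
  define \<theta> where "\<theta> b = max 0 (\<rho> - cmod b)" for b :: complex
  have \<theta>1: "continuous_on S \<theta>" for S
    unfolding \<theta>_def by (intro continuous_intros)
  have \<theta>2: "0 \<le> \<theta> b" "\<rho> < cmod b \<Longrightarrow> \<theta> b = 0" for b
    unfolding \<theta>_def by auto
  have \<theta>3: "\<theta> b \<le> 1" for b
    unfolding \<theta>_def using \<rho>(2) norm_ge_zero[of b] by (intro max.boundedI; linarith)
  note \<theta> = \<theta>1 \<theta>2(1) \<theta>3 \<theta>2(2)
  define X where "X = circle_mean (\<lambda>\<zeta>. \<theta> (\<Phi> \<zeta>))"
  have c\<Phi>: "continuous_on circle \<Phi>" by (rule continuous_on_subset[OF \<Phi>(1)]) auto
  have c\<theta>\<Phi>: "continuous_on circle (\<lambda>\<zeta>. \<theta> (\<Phi> \<zeta>))"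
    by (intro continuous_on_compose2[OF \<theta>(1)[of UNIV] c\<Phi>]) auto
  have X0: "0 < X" unfolding X_def
    by (rule circle_mean_pos[OF c\<theta>\<Phi> _ \<zeta>1(1)]) (use \<rho> in \<open>auto simp: \<theta>_def\<close>)
  have X1: "X \<le> 1"
  proof -
    have "X \<le> circle_mean (\<lambda>\<zeta>. 1)" unfolding X_def using \<theta>(3) by (intro circle_mean_mono c\<theta>\<Phi>) auto
    then show ?thesis by (simp add: circle_mean_const)
  qed
  define c where "c = (1 - \<rho>) / (1 + \<rho>)"
  have c: "0 < c" "c \<le> 1" using \<rho> by (auto simp: c_def)
  have q: "0 \<le> 1 - c * X" "1 - c * X < 1" using c X0 X1 mult_mono[of c 1 X 1] by auto
  show thesis
  proof (rule that[of 1 "1 - c * X" "1 - \<rho>" X])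
    fix \<alpha> \<beta> :: complex and h :: "complex \<Rightarrow> complex" and \<epsilon> :: real
    assume h: "h holomorphic_on cball 0 1" and \<epsilon>: "0 \<le> \<epsilon>"
      and off: "\<And>z. z \<in> cball 0 1 \<Longrightarrow> 1 - \<rho> \<le> cmod (z - 1) \<Longrightarrow> cmod (\<alpha> * h z + \<beta> * cnj (h z)) powr p \<le> \<epsilon>"
    have off': "cmod (\<alpha> * h b + \<beta> * cnj (h b)) powr p \<le> \<epsilon>" if "cmod b \<le> \<rho>" for b
      by (rule off) (use that \<rho> norm_triangle_ineq2[of 1 b] in \<open>auto simp: norm_minus_commute\<close>)
    define A where "A = circle_mean (\<lambda>\<zeta>. cmod (\<alpha> * h \<zeta> + \<beta> * cnj (h \<zeta>)) powr p)"
    have "circle_mean (\<lambda>\<eta>. cmod (\<alpha> * h \<eta> + \<beta> * cnj (h \<eta>)) powr p * poisson (\<phi> 0) \<eta>) = A"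
      unfolding A_def circle_mean_def True by (simp add: poisson_0)
    then have "circle_mean (\<lambda>\<zeta>. cmod (\<alpha> * h (\<Phi> \<zeta>) + \<beta> * cnj (h (\<Phi> \<zeta>))) powr p) + (c * A - \<epsilon>) * X \<le> A"
      using subordination_deficit[OF \<phi> \<Phi> h p \<rho>(1,2) \<theta> \<epsilon> off'] unfolding A_def X_def c_def by simp
    then show "circle_mean (\<lambda>\<zeta>. cmod (\<alpha> * h (\<Phi> \<zeta>) + \<beta> * cnj (h (\<Phi> \<zeta>))) powr p)
       \<le> (1 - c * X) * circle_mean (\<lambda>\<zeta>. cmod (\<alpha> * h \<zeta> + \<beta> * cnj (h \<zeta>)) powr p) + X * \<epsilon>"
      unfolding A_def by (simp add: algebra_simps)
  qed (use q X0 \<rho> in auto)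
qed

section \<open>The Gaussian-weighted Cauchy transform\<close>

lemma borel_measurable_cnj [measurable]:
  assumes "f \<in> borel_measurable M"
  shows "(\<lambda>x. cnj (f x)) \<in> borel_measurable M"
  using measurable_compose[OF assms borel_measurable_continuous_onI[OF continuous_on_cnj[OF continuous_on_id]]] .

text \<open>
  Each product is bounded by the power of the smaller of the two bases. This splits a kernel with
  two singularities into two Riesz kernels.
\<close>

lemma powr_product_le:
  fixes a b s u :: real
  assumes "0 < a" "0 < b" "0 \<le> s" "0 \<le> u"
  shows "a powr (- s) * b powr (- u) \<le> a powr (- (s + u)) + b powr (- (s + u))"
proof -
  have *: "x powr (- s') * y powr (- u') \<le> x powr (- (s' + u'))" if "0 < x" "x \<le> y" "0 \<le> s'" "0 \<le> u'" for x y s' u' :: real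
  proof -
    have "x powr (- s') * y powr (- u') \<le> x powr (- s') * x powr (- u')"
      using that by (intro mult_left_mono powr_mono2') auto
    then show ?thesis using that by (simp add: powr_add[symmetric])
  qed
  show ?thesis
  proof (cases "a \<le> b")
    case True
    then show ?thesis using *[of a b s u] assms by (simp add: add_increasing2)
  next
    case False
    then have "b powr (- u) * a powr (- s) \<le> b powr (- (u + s))" using assms by (intro *) auto
    then have "a powr (- s) * b powr (- u) \<le> b powr (- (s + u))"
      by (simp only: add.commute[of u s] mult.commute)
    moreover have "0 \<le> a powr (- (s + u))" by simp
    ultimately show ?thesis by linarith
  qed
qed

text \<open>
  The modulus of this factor is the Gaussian \<open>exp (- t * |z - \<zeta>|\<^sup>2 / 2)\<close>, while
  \<open>exp (t * |z|\<^sup>2 / 2) * gauss_phase t z \<zeta>\<close> is holomorphic in \<open>z\<close>. It is the reproducing kernel of the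
  Bargmann--Fock space, normalised by the weight.
\<close>

definition gauss_phase :: "real \<Rightarrow> complex \<Rightarrow> complex \<Rightarrow> complex" where
  "gauss_phase t z \<zeta> = exp (complex_of_real t * (z * cnj \<zeta> - complex_of_real ((cmod z)\<^sup>2) / 2 - complex_of_real ((cmod \<zeta>)\<^sup>2) / 2))"

lemma cmod_gauss_phase: "cmod (gauss_phase t z \<zeta>) = exp (- (t * (cmod (z - \<zeta>))\<^sup>2 / 2))"
proof -
  have "Re (z * cnj \<zeta>) - (cmod z)\<^sup>2 / 2 - (cmod \<zeta>)\<^sup>2 / 2 = - ((cmod (z - \<zeta>))\<^sup>2 / 2)"
    unfolding cmod_power2 by (simp add: power2_eq_square field_simps)
  moreover have "Re (complex_of_real t * (z * cnj \<zeta> - complex_of_real ((cmod z)\<^sup>2) / 2 - complex_of_real ((cmod \<zeta>)\<^sup>2) / 2))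
     = t * (Re (z * cnj \<zeta>) - (cmod z)\<^sup>2 / 2 - (cmod \<zeta>)\<^sup>2 / 2)"
    by (simp add: Re_divide_numeral)
  ultimately show ?thesis unfolding gauss_phase_def norm_exp_eq_Re by simp
qed

lemma cmod_gauss_phase_le_1: "0 \<le> t \<Longrightarrow> cmod (gauss_phase t z \<zeta>) \<le> 1"
  unfolding cmod_gauss_phase by simp

definition weighted_cauchy :: "real \<Rightarrow> (complex \<Rightarrow> complex) \<Rightarrow> complex \<Rightarrow> complex" where
  "weighted_cauchy t g z = (LINT \<zeta>|lborel. gauss_phase t z \<zeta> / (z - \<zeta>) * g \<zeta>) / complex_of_real cauchy_const"

lemma measurable_gauss_phase [measurable]:
  "(\<lambda>x. gauss_phase t (fst x) (snd x)) \<in> borel_measurable (borel \<Otimes>\<^sub>M borel)"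
  "(\<lambda>\<zeta>. gauss_phase t z \<zeta>) \<in> borel_measurable borel"
proof -
  have "continuous_on UNIV (\<lambda>x. gauss_phase t (fst x) (snd x))"
    unfolding gauss_phase_def by (intro continuous_intros) auto
  then show "(\<lambda>x. gauss_phase t (fst x) (snd x)) \<in> borel_measurable (borel \<Otimes>\<^sub>M borel)"
    unfolding borel_prod by (rule borel_measurable_continuous_onI)
  have "continuous_on UNIV (\<lambda>\<zeta>. gauss_phase t z \<zeta>)"
    unfolding gauss_phase_def by (intro continuous_intros) auto
  then show "(\<lambda>\<zeta>. gauss_phase t z \<zeta>) \<in> borel_measurable borel"
    by (rule borel_measurable_continuous_onI)
qed

text \<open>
  The bounded densities on the disc to which the Cauchy transform is applied.
\<close>

definition disc_density :: "(complex \<Rightarrow> complex) \<Rightarrow> real \<Rightarrow> bool" where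
  "disc_density g G \<longleftrightarrow> g \<in> borel_measurable borel \<and> (\<forall>z. cmod (g z) \<le> G) \<and> (\<forall>z. z \<notin> disc \<longrightarrow> g z = 0)"

lemma disc_densityD:
  assumes "disc_density g G"
  shows "g \<in> borel_measurable borel" "cmod (g z) \<le> G" "z \<notin> disc \<Longrightarrow> g z = 0" "0 \<le> G"
proof -
  show "g \<in> borel_measurable borel" "cmod (g z) \<le> G" "z \<notin> disc \<Longrightarrow> g z = 0"
    using assms by (auto simp: disc_density_def)
  show "0 \<le> G" using assms order.trans[OF norm_ge_zero] unfolding disc_density_def by blast
qed

lemma disc_density_le:
  assumes "disc_density g G"
  shows "cmod (g z) \<le> G * indicator disc z"
  using disc_densityD(2,3)[OF assms, of z] disc_densityD(4)[OF assms] by (cases "z \<in> disc") auto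

lemma cmod_cauchy_integrand_le:
  assumes "0 \<le> t"
  shows "cmod (gauss_phase t z \<zeta> / (z - \<zeta>) * g) \<le> cmod (z - \<zeta>) powr (- 1) * cmod g"
  using cmod_gauss_phase_le_1[OF assms, of z \<zeta>]
  by (auto simp: norm_mult norm_divide norm_inverse powr_minus divide_inverse intro!: mult_right_mono mult_left_le_one_le)

lemma integrable_disc_density:
  assumes g: "disc_density g G" and k: "integrable lborel (\<lambda>\<zeta>. indicator disc \<zeta> * k \<zeta>)"
    "\<And>\<zeta>. cmod (m \<zeta>) \<le> k \<zeta>" "m \<in> borel_measurable borel"
  shows "integrable lborel (\<lambda>\<zeta>. m \<zeta> * g \<zeta>)"
proof (rule Bochner_Integration.integrable_bound[OF integrable_mult_right[OF k(1), of G]])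
  show "(\<lambda>\<zeta>. m \<zeta> * g \<zeta>) \<in> borel_measurable lborel" using disc_densityD(1)[OF g] k(3) by simp
  have "cmod (m \<zeta> * g \<zeta>) \<le> norm (G * (indicator disc \<zeta> * k \<zeta>))" for \<zeta>
  proof -
    have "cmod (m \<zeta> * g \<zeta>) \<le> k \<zeta> * (G * indicator disc \<zeta>)"
      unfolding norm_mult using k(2)[of \<zeta>] disc_density_le[OF g, of \<zeta>] disc_densityD(4)[OF g]
      by (intro mult_mono) (auto intro: order.trans[OF norm_ge_zero])
    also have "\<dots> \<le> norm (G * (indicator disc \<zeta> * k \<zeta>))" by (simp add: mult_ac)
    finally show ?thesis .
  qed
  then show "AE \<zeta> in lborel. cmod (m \<zeta> * g \<zeta>) \<le> norm (G * (indicator disc \<zeta> * k \<zeta>))" by simp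
qed

lemma integrable_cauchy_integrand:
  assumes "0 \<le> t" and g: "disc_density g G"
  shows "integrable lborel (\<lambda>\<zeta>. gauss_phase t z \<zeta> / (z - \<zeta>) * g \<zeta>)"
proof (rule integrable_disc_density[OF g, where k = "\<lambda>\<zeta>. cmod (z - \<zeta>) powr (- 1)"])
  show "integrable lborel (\<lambda>\<zeta>. indicator disc \<zeta> * cmod (z - \<zeta>) powr (- 1))"
    by (rule integrable_riesz) auto
  show "cmod (gauss_phase t z \<zeta> / (z - \<zeta>)) \<le> cmod (z - \<zeta>) powr (- 1)" for \<zeta>
    using cmod_cauchy_integrand_le[OF assms(1), of z \<zeta> 1] by simp
qed measurable

lemma exp_minus_le_powr:
  assumes "0 < y"
  shows "exp (- y) \<le> y powr (- (1/4) :: real)"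
proof -
  have "ln y \<le> y - 1" using ln_le_minus_one[OF assms] .
  then have "- y \<le> - (1/4) * ln y" using assms by simp
  then show ?thesis using assms by (simp add: powr_def)
qed

text \<open>
  From \<open>exp (- y) \<le> y powr (- 1/4)\<close> the Gaussian factor trades half a power of \<open>|z - \<zeta>|\<close> for the small
  factor \<open>(t / 2) powr (- 1/4)\<close>. This is what makes the fixed point equation a contraction for
  large \<open>t\<close>.
\<close>

lemma weighted_cauchy_bound:
  assumes t: "0 < t" and g: "disc_density g G"
  shows "cmod (weighted_cauchy t g z) \<le> G * ((t / 2) powr (- (1/4)) * riesz_bound (3/2) / cauchy_const)"
proof -
  have pt: "cmod (gauss_phase t z \<zeta> / (z - \<zeta>) * g \<zeta>) \<le> (G * (t / 2) powr (- (1/4))) * (indicator disc \<zeta> * cmod (z - \<zeta>) powr (- (3/2)))" for \<zeta>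
  proof (cases "z = \<zeta>")
    case False
    define r where "r = cmod (z - \<zeta>)"
    have r: "0 < r" using False by (simp add: r_def)
    have "cmod (gauss_phase t z \<zeta> / (z - \<zeta>)) = exp (- (t * r\<^sup>2 / 2)) / r"
      by (simp only: norm_divide cmod_gauss_phase r_def)
    also have "\<dots> = exp (- (t / 2 * r\<^sup>2)) * r powr (- 1)"
      using r by (simp add: powr_minus field_simps)
    also have "\<dots> \<le> (t / 2 * r\<^sup>2) powr (- (1/4)) * r powr (- 1)"
      using t r by (intro mult_right_mono exp_minus_le_powr) auto
    also have "\<dots> = (t / 2) powr (- (1/4)) * (r powr (- (1/2)) * r powr (- 1))"
    proof -
      have "(r\<^sup>2) powr (- (1/4)) = r powr (- (1/2))"
      proof -
        have "r\<^sup>2 = r powr 2" using r by (simp add: powr_numeral)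
        then show ?thesis by (simp add: powr_powr)
      qed
      then show ?thesis using t r powr_mult[of "t / 2" "r\<^sup>2" "- (1/4)"] by simp
    qed
    also have "r powr (- (1/2)) * r powr (- 1) = r powr (- (3/2))" by (subst powr_add[symmetric]) simp
    finally have "cmod (gauss_phase t z \<zeta> / (z - \<zeta>)) * cmod (g \<zeta>)
       \<le> ((t / 2) powr (- (1/4)) * r powr (- (3/2))) * (G * indicator disc \<zeta>)"
      using disc_density_le[OF g, of \<zeta>] by (intro mult_mono) auto
    then show ?thesis unfolding norm_mult[of "gauss_phase t z \<zeta> / (z - \<zeta>)"] r_def by (simp only: mult_ac)
  qed simp
  have "cmod (LINT \<zeta>|lborel. gauss_phase t z \<zeta> / (z - \<zeta>) * g \<zeta>)
     \<le> (LINT \<zeta>|lborel. (G * (t / 2) powr (- (1/4))) * (indicator disc \<zeta> * cmod (z - \<zeta>) powr (- (3/2))))"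
  proof (rule order.trans[OF integral_norm_bound integral_mono])
    show "integrable lborel (\<lambda>\<zeta>. cmod (gauss_phase t z \<zeta> / (z - \<zeta>) * g \<zeta>))"
      using integrable_cauchy_integrand[OF less_imp_le[OF t] g] by simp
    show "integrable lborel (\<lambda>\<zeta>. (G * (t / 2) powr (- (1/4))) * (indicator disc \<zeta> * cmod (z - \<zeta>) powr (- (3/2))))"
      by (intro integrable_mult_right integrable_riesz) auto
  qed (rule pt)
  also have "\<dots> = (G * (t / 2) powr (- (1/4))) * (LINT \<zeta>|lborel. indicator disc \<zeta> * cmod (z - \<zeta>) powr (- (3/2)))"
    by simp
  also have "\<dots> \<le> (G * (t / 2) powr (- (1/4))) * riesz_bound (3/2)"
    using disc_densityD(4)[OF g] by (intro mult_left_mono integrable_riesz) auto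
  finally show ?thesis
    using cauchy_const_pos by (simp add: weighted_cauchy_def norm_divide field_simps)
qed

text \<open>
  Writing \<open>d = sqrt d * sqrt d\<close> for \<open>d = |z - z0|\<close> and bounding one factor by
  \<open>sqrt |z - \<zeta>| + sqrt |z0 - \<zeta>|\<close> gives Hoelder continuity with exponent \<open>1/2\<close> and integrable
  singularities; with exponent 1 the integral would grow like the logarithm of \<open>1 / d\<close>.
\<close>

lemma inverse_diff_le:
  fixes z z0 \<zeta> :: complex
  assumes "\<zeta> \<noteq> z" "\<zeta> \<noteq> z0"
  shows "cmod (1 / (z - \<zeta>) - 1 / (z0 - \<zeta>))
    \<le> 2 * cmod (z - z0) powr (1/2) * (cmod (z - \<zeta>) powr (- (3/2)) + cmod (z0 - \<zeta>) powr (- (3/2)))"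
proof -
  define a b d where "a = cmod (z - \<zeta>)" and "b = cmod (z0 - \<zeta>)" and "d = cmod (z - z0)"
  have ab: "0 < a" "0 < b" using assms by (auto simp: a_def b_def)
  have d: "0 \<le> d" "d \<le> a + b"
    using norm_triangle_ineq4[of "z - \<zeta>" "z0 - \<zeta>"] by (auto simp: a_def b_def d_def)
  have "sqrt d \<le> sqrt a + sqrt b"
    using d ab sqrt_add_le_add_sqrt[of a b] real_sqrt_le_mono[OF d(2)] by linarith
  then have s: "d powr (1/2) \<le> a powr (1/2) + b powr (1/2)"
    using d ab by (simp add: powr_half_sqrt)
  have "1 / (z - \<zeta>) - 1 / (z0 - \<zeta>) = (z0 - z) / ((z - \<zeta>) * (z0 - \<zeta>))"
    using assms by (simp add: field_simps)
  then have "cmod (1 / (z - \<zeta>) - 1 / (z0 - \<zeta>)) = d / (a * b)"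
    by (simp only: norm_divide norm_mult a_def b_def d_def norm_minus_commute[of z0 z])
  also have "\<dots> = d * (a powr (- 1) * b powr (- 1))"
    using ab by (simp add: powr_minus field_simps)
  also have "d = d powr (1/2) * d powr (1/2)"
    using d(1) by (simp add: powr_add[symmetric])
  also have "d powr (1/2) * d powr (1/2) * (a powr (- 1) * b powr (- 1))
      \<le> d powr (1/2) * (a powr (1/2) + b powr (1/2)) * (a powr (- 1) * b powr (- 1))"
    using s by (intro mult_right_mono mult_left_mono) auto
  also have "\<dots> = d powr (1/2) * ((a powr (1/2) * a powr (- 1)) * b powr (- 1) + a powr (- 1) * (b powr (1/2) * b powr (- 1)))"
    by (simp add: algebra_simps)
  also have "a powr (1/2) * a powr (- 1) = a powr (- (1/2))" by (subst powr_add[symmetric]) simp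
  also have "b powr (1/2) * b powr (- 1) = b powr (- (1/2))" by (subst powr_add[symmetric]) simp
  also have "d powr (1/2) * (a powr (- (1/2)) * b powr (- 1) + a powr (- 1) * b powr (- (1/2)))
     \<le> d powr (1/2) * ((a powr (- (3/2)) + b powr (- (3/2))) + (a powr (- (3/2)) + b powr (- (3/2))))"
    using powr_product_le[OF ab, of "1/2" 1] powr_product_le[OF ab, of 1 "1/2"]
    by (intro mult_left_mono add_mono) auto
  finally show ?thesis by (simp add: a_def b_def d_def algebra_simps)
qed

text \<open>
  The change of the phase (\<open>A n\<close>) is handled by dominated convergence, the change of the singular
  factor (\<open>B n\<close>) by the preceding Hoelder bound.
\<close>

lemma continuous_weighted_cauchy:
  assumes t: "0 \<le> t" and g: "disc_density g G"
  shows "continuous_on UNIV (weighted_cauchy t g)"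
proof -
  have "weighted_cauchy t g \<midarrow>z0\<rightarrow> weighted_cauchy t g z0" for z0
    unfolding tendsto_at_iff_sequentially
  proof safe
    fix X :: "nat \<Rightarrow> complex"
    assume X: "X \<longlonglongrightarrow> z0"
    let ?k = "\<lambda>z \<zeta>. gauss_phase t z \<zeta> / (z - \<zeta>) * g \<zeta>"
    define A where "A n \<zeta> = (gauss_phase t (X n) \<zeta> - gauss_phase t z0 \<zeta>) / (z0 - \<zeta>) * g \<zeta>" for n \<zeta>
    define B where "B n \<zeta> = gauss_phase t (X n) \<zeta> * (1 / (X n - \<zeta>) - 1 / (z0 - \<zeta>)) * g \<zeta>" for n \<zeta>
    have AB: "?k (X n) \<zeta> - ?k z0 \<zeta> = A n \<zeta> + B n \<zeta>" for n \<zeta>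
      unfolding A_def B_def by (simp add: algebra_simps diff_divide_distrib)
    note i = integrable_cauchy_integrand[OF t g]
    have riesz_int: "integrable lborel (\<lambda>\<zeta>. indicator disc \<zeta> * cmod (z - \<zeta>) powr (- s))" if "0 < s" "s < 2" for z s
      using integrable_riesz[OF that] by simp
    have A_le: "cmod (A n \<zeta>) \<le> 2 * G * (indicator disc \<zeta> * cmod (z0 - \<zeta>) powr (- 1))" for n \<zeta>
    proof -
      have "cmod (gauss_phase t (X n) \<zeta> - gauss_phase t z0 \<zeta>) \<le> 2"
        using norm_triangle_ineq4[of "gauss_phase t (X n) \<zeta>" "gauss_phase t z0 \<zeta>"]
          cmod_gauss_phase_le_1[OF t, of "X n" \<zeta>] cmod_gauss_phase_le_1[OF t, of z0 \<zeta>] by linarith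
      then have "cmod (gauss_phase t (X n) \<zeta> - gauss_phase t z0 \<zeta>) * cmod (z0 - \<zeta>) powr (- 1) * cmod (g \<zeta>)
         \<le> 2 * cmod (z0 - \<zeta>) powr (- 1) * (G * indicator disc \<zeta>)"
        using disc_density_le[OF g, of \<zeta>] by (intro mult_mono) auto
      then show ?thesis unfolding A_def by (simp add: norm_mult norm_divide norm_inverse powr_minus divide_inverse mult_ac)
    qed
    have Am: "A n \<in> borel_measurable borel" for n
      unfolding A_def using disc_densityD(1)[OF g] by measurable
    have Aint: "integrable lborel (A n)" for n
      by (rule Bochner_Integration.integrable_bound[OF integrable_mult_right[OF riesz_int[of 1 z0], of "2 * G"]])
         (use A_le[of n] Am in \<open>auto intro!: AE_I2 order.trans[OF A_le] simp: disc_densityD(4)[OF g]\<close>)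
    have A0: "(\<lambda>n. LINT \<zeta>|lborel. A n \<zeta>) \<longlonglongrightarrow> (LINT (\<zeta>::complex)|lborel. 0)"
    proof (rule integral_dominated_convergence[where w = "\<lambda>\<zeta>. 2 * G * (indicator disc \<zeta> * cmod (z0 - \<zeta>) powr (- 1))"])
      show "AE \<zeta> in lborel. (\<lambda>n. A n \<zeta>) \<longlonglongrightarrow> 0"
      proof (rule AE_I2)
        fix \<zeta>
        have "continuous_on UNIV (\<lambda>z. gauss_phase t z \<zeta>)"
          unfolding gauss_phase_def by (intro continuous_intros) auto
        then have "(\<lambda>n. gauss_phase t (X n) \<zeta>) \<longlonglongrightarrow> gauss_phase t z0 \<zeta>"
          using X by (auto simp: continuous_on_eq_continuous_at intro: isCont_tendsto_compose)
        then have "(\<lambda>n. A n \<zeta>) \<longlonglongrightarrow> (gauss_phase t z0 \<zeta> - gauss_phase t z0 \<zeta>) / (z0 - \<zeta>) * g \<zeta>"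
          unfolding A_def divide_inverse by (intro tendsto_intros)
        then show "(\<lambda>n. A n \<zeta>) \<longlonglongrightarrow> 0" by simp
      qed
      show "integrable lborel (\<lambda>\<zeta>. 2 * G * (indicator disc \<zeta> * cmod (z0 - \<zeta>) powr (- 1)))"
        by (intro integrable_mult_right riesz_int) auto
    qed (use Am A_le in auto)
    have Bint: "integrable lborel (B n)" for n
    proof -
      have "B n = (\<lambda>\<zeta>. ?k (X n) \<zeta> - ?k z0 \<zeta> - A n \<zeta>)" using AB[of n] by (auto simp: fun_eq_iff)
      then show ?thesis using i Aint[of n] by simp
    qed
    have B_le: "cmod (LINT \<zeta>|lborel. B n \<zeta>) \<le> (4 * G * riesz_bound (3/2)) * cmod (X n - z0) powr (1/2)" for n
    proof -
      let ?r = "\<lambda>z \<zeta>. indicator disc \<zeta> * cmod (z - \<zeta>) powr (- (3/2))"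
      define C where "C = 2 * G * cmod (X n - z0) powr (1/2)"
      have C: "0 \<le> C" using disc_densityD(4)[OF g] by (simp add: C_def)
      have "cmod (LINT \<zeta>|lborel. B n \<zeta>) \<le> (LINT \<zeta>|lborel. cmod (B n \<zeta>))"
        by (rule integral_norm_bound)
      also have "\<dots> \<le> (LINT \<zeta>|lborel. C * (?r (X n) \<zeta> + ?r z0 \<zeta>))"
      proof (rule integral_mono_AE)
        show "AE \<zeta> in lborel. cmod (B n \<zeta>) \<le> C * (?r (X n) \<zeta> + ?r z0 \<zeta>)"
          using AE_lborel_singleton[of z0] AE_lborel_singleton[of "X n"]
        proof eventually_elim
          case (elim \<zeta>)
          let ?p = "cmod (X n - \<zeta>) powr (- (3/2)) + cmod (z0 - \<zeta>) powr (- (3/2))"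
          have "cmod (B n \<zeta>) = cmod (gauss_phase t (X n) \<zeta>) * cmod (1 / (X n - \<zeta>) - 1 / (z0 - \<zeta>)) * cmod (g \<zeta>)"
            by (simp add: B_def norm_mult)
          also have "\<dots> \<le> 1 * (2 * cmod (X n - z0) powr (1/2) * ?p) * (G * indicator disc \<zeta>)"
            using cmod_gauss_phase_le_1[OF t, of "X n" \<zeta>] inverse_diff_le[of \<zeta> "X n" z0] elim disc_density_le[OF g, of \<zeta>]
            by (intro mult_mono) (auto intro!: add_nonneg_nonneg mult_nonneg_nonneg)
          also have "\<dots> = C * (?r (X n) \<zeta> + ?r z0 \<zeta>)" by (simp add: C_def algebra_simps)
          finally show ?case .
        qed
        show "integrable lborel (\<lambda>\<zeta>. C * (?r (X n) \<zeta> + ?r z0 \<zeta>))"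
          by (intro integrable_mult_right Bochner_Integration.integrable_add riesz_int) auto
      qed (use Bint[of n] in simp)
      also have "\<dots> = C * ((LINT \<zeta>|lborel. ?r (X n) \<zeta>) + (LINT \<zeta>|lborel. ?r z0 \<zeta>))"
        using riesz_int[of "3/2"] by simp
      also have "\<dots> \<le> C * (riesz_bound (3/2) + riesz_bound (3/2))"
        using C by (intro mult_left_mono add_mono integrable_riesz) auto
      finally show ?thesis by (simp add: C_def algebra_simps)
    qed
    have "(\<lambda>n. (4 * G * riesz_bound (3/2)) * cmod (X n - z0) powr (1/2)) \<longlonglongrightarrow> (4 * G * riesz_bound (3/2)) * 0 powr (1/2)"
      using tendsto_norm[OF LIM_zero[OF X]] by (intro tendsto_intros tendsto_powr') auto
    then have lim: "(\<lambda>n. (4 * G * riesz_bound (3/2)) * cmod (X n - z0) powr (1/2)) \<longlonglongrightarrow> 0" by simp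
    have B0: "(\<lambda>n. LINT \<zeta>|lborel. B n \<zeta>) \<longlonglongrightarrow> 0"
      by (rule Lim_null_comparison[OF always_eventually[OF allI[OF B_le]] lim])
    have "(LINT \<zeta>|lborel. ?k (X n) \<zeta>) - (LINT \<zeta>|lborel. ?k z0 \<zeta>) = (LINT \<zeta>|lborel. A n \<zeta>) + (LINT \<zeta>|lborel. B n \<zeta>)" for n
    proof -
      have "(LINT \<zeta>|lborel. ?k (X n) \<zeta>) - (LINT \<zeta>|lborel. ?k z0 \<zeta>) = (LINT \<zeta>|lborel. ?k (X n) \<zeta> - ?k z0 \<zeta>)"
        by (rule Bochner_Integration.integral_diff[symmetric]) (rule i)+
      then show ?thesis unfolding AB using Aint Bint by simp
    qed
    then have "(\<lambda>n. (LINT \<zeta>|lborel. ?k (X n) \<zeta>) - (LINT \<zeta>|lborel. ?k z0 \<zeta>)) \<longlonglongrightarrow> 0"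
      using tendsto_add[OF A0 B0] by simp
    then have "(\<lambda>n. LINT \<zeta>|lborel. ?k (X n) \<zeta>) \<longlonglongrightarrow> (LINT \<zeta>|lborel. ?k z0 \<zeta>)"
      by (rule LIM_zero_cancel)
    then show "(weighted_cauchy t g \<circ> X) \<longlonglongrightarrow> weighted_cauchy t g z0"
      unfolding weighted_cauchy_def o_def using cauchy_const_pos by (intro tendsto_intros) auto
  qed
  then show ?thesis by (simp add: continuous_on_def)
qed

lemma dbar_holomorphic:
  assumes "(f has_field_derivative d) (at z)"
  shows "dbar f z = 0"
proof -
  have "ddir v f z = d * v" for v
    by (rule ddir_eq) (use assms in \<open>simp add: has_field_derivative_def\<close>)
  then show ?thesis by (simp add: dbar_def mult.left_commute[of \<i>])
qed

text \<open>
  After removing the weight, the kernel is \<open>m z / (z - \<zeta>)\<close> with \<open>m\<close> holomorphic and \<open>m \<zeta> = 1\<close>. By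
  Fubini's theorem it remains to apply the Pompeiu formula to \<open>\<psi> * m\<close>, for which
  \<open>dbar (\<psi> * m) = dbar \<psi> * m\<close>.
\<close>

lemma weak_dbar_weighted_cauchy:
  assumes t: "0 \<le> t" and g: "disc_density g G" and \<psi>: "C1_supported \<psi> 1"
  defines "e \<equiv> \<lambda>z. complex_of_real (exp (t * (cmod z)\<^sup>2 / 2))"
  shows "(LINT z|lborel. (e z * weighted_cauchy t g z) * dbar \<psi> z) = - (LINT \<zeta>|lborel. e \<zeta> * g \<zeta> * \<psi> \<zeta>)"
proof -
  define k where "k z \<zeta> = (gauss_phase t z \<zeta> / (z - \<zeta>) * g \<zeta>) * (e z * dbar \<psi> z)" for z \<zeta>
  have ce: "continuous_on UNIV e" unfolding e_def by (intro continuous_intros) auto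
  have cd: "continuous_on UNIV (\<lambda>z. e z * dbar \<psi> z)"
    by (intro continuous_intros ce continuous_dbar[OF \<psi>])
  have d0: "dbar \<psi> z = 0" if "1 < cmod z" for z using dbar_eq_0_outside[OF \<psi>, of z] that by simp
  obtain D where D: "0 \<le> D" "\<And>z. cmod (e z * dbar \<psi> z) \<le> D"
    by (rule continuous_supported_bounded[OF cd, of 1]) (use d0 in auto)
  have md [measurable]: "(\<lambda>z. e z * dbar \<psi> z) \<in> borel_measurable borel"
    by (rule borel_measurable_continuous_onI[OF cd])
  have mg [measurable]: "g \<in> borel_measurable borel" using disc_densityD(1)[OF g] .
  have mk: "(\<lambda>x. k (fst x) (snd x)) \<in> borel_measurable (lborel \<Otimes>\<^sub>M lborel)"
    unfolding k_def by measurable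
  have i1: "integrable lborel (\<lambda>\<zeta>. k z \<zeta>)" for z
    unfolding k_def by (intro integrable_mult_left integrable_cauchy_integrand[OF t g])
  have nk: "cmod (k z \<zeta>) \<le> (D * G * indicator (cball 0 1) z) * (indicator disc \<zeta> * cmod (z - \<zeta>) powr (- 1))" for z \<zeta>
  proof -
    have "cmod (e z * dbar \<psi> z) \<le> D * indicator (cball 0 1) z"
      using D(2)[of z] d0[of z] by (cases "cmod z \<le> 1") auto
    moreover have "cmod (gauss_phase t z \<zeta> / (z - \<zeta>) * g \<zeta>) \<le> cmod (z - \<zeta>) powr (- 1) * (G * indicator disc \<zeta>)"
      by (rule order.trans[OF cmod_cauchy_integrand_le[OF t]]) (intro mult_left_mono disc_density_le[OF g], simp)
    ultimately have "cmod (k z \<zeta>) \<le> (cmod (z - \<zeta>) powr (- 1) * (G * indicator disc \<zeta>)) * (D * indicator (cball 0 1) z)"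
      unfolding k_def norm_mult[of _ "e z * dbar \<psi> z"] using disc_densityD(4)[OF g] by (intro mult_mono) auto
    then show ?thesis by (simp only: mult_ac)
  qed
  have int: "integrable (lborel \<Otimes>\<^sub>M lborel) (\<lambda>x. k (fst x) (snd x))"
  proof (rule lborel_pair.Fubini_integrable[OF mk])
    show "integrable lborel (\<lambda>z. LINT \<zeta>|lborel. norm (k (fst (z, \<zeta>)) (snd (z, \<zeta>))))"
    proof (rule bounded_integrable_supported[where C = "D * G * riesz_bound 1" and R = 1])
      have "(\<lambda>x. norm (k (fst x) (snd x))) \<in> borel_measurable (lborel \<Otimes>\<^sub>M lborel)" using mk by measurable
      then have "(\<lambda>x. norm (k (fst x) (snd x))) \<in> borel_measurable (borel \<Otimes>\<^sub>M lborel)"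
        by (simp cong: measurable_cong_sets sets_pair_measure_cong)
      then have "(\<lambda>(z, \<zeta>). norm (k z \<zeta>)) \<in> borel_measurable (borel \<Otimes>\<^sub>M lborel)"
        by (simp add: case_prod_beta')
      from lborel.borel_measurable_lebesgue_integral[OF this]
      show "(\<lambda>z. LINT \<zeta>|lborel. norm (k (fst (z, \<zeta>)) (snd (z, \<zeta>)))) \<in> borel_measurable borel"
        by simp
      fix z
      show "norm (LINT \<zeta>|lborel. norm (k (fst (z, \<zeta>)) (snd (z, \<zeta>)))) \<le> D * G * riesz_bound 1"
      proof -
        have "(LINT \<zeta>|lborel. norm (k z \<zeta>)) \<le> (LINT \<zeta>|lborel. (D * G * indicator (cball 0 1) z) * (indicator disc \<zeta> * cmod (z - \<zeta>) powr (- 1)))"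
          by (intro integral_mono integrable_norm i1 integrable_mult_right integrable_riesz nk) auto
        also have "\<dots> = (D * G * indicator (cball 0 1) z) * (LINT \<zeta>|lborel. indicator disc \<zeta> * cmod (z - \<zeta>) powr (- 1))"
          by (rule integral_mult_right_zero)
        also have "\<dots> \<le> (D * G * 1) * riesz_bound 1"
          using D(1) disc_densityD(4)[OF g] riesz_bound_pos[of 1]
          by (intro mult_mono integrable_riesz mult_nonneg_nonneg integral_nonneg_AE) (auto simp: indicator_def)
        finally show ?thesis by (simp add: integral_nonneg_AE)
      qed
      show "1 < cmod z \<Longrightarrow> (LINT \<zeta>|lborel. norm (k (fst (z, \<zeta>)) (snd (z, \<zeta>)))) = 0"
        using d0 by (simp add: k_def)
    qed
  qed (use i1 in auto)
  have inner: "(LINT z|lborel. k z \<zeta>) = - complex_of_real cauchy_const * (e \<zeta> * g \<zeta> * \<psi> \<zeta>)" for \<zeta>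
  proof (cases "\<zeta> \<in> disc")
    case True
    define m where "m z = exp (complex_of_real t * (z - \<zeta>) * cnj \<zeta>)" for z
    have dm: "(m has_field_derivative (complex_of_real t * cnj \<zeta> * m z)) (at z)" for z
      unfolding m_def by (auto intro!: derivative_eq_intros)
    have diffm: "m differentiable (at z)" for z
      using dm[of z] unfolding has_field_derivative_def differentiable_def by blast
    have ddm: "ddir v m = (\<lambda>z. complex_of_real t * cnj \<zeta> * m z * v)" for v
      by (rule ext, rule ddir_eq, rule dm[unfolded has_field_derivative_def])
    have cm: "continuous_on UNIV m" unfolding m_def by (intro continuous_intros)
    have S: "C1_supported (\<lambda>z. \<psi> z * m z) 1"
      by (rule C1_supported_mult[OF \<psi> diffm]) (unfold ddm, intro continuous_intros cm)
    have dS: "dbar (\<lambda>z. \<psi> z * m z) z = dbar \<psi> z * m z" for z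
      using dbar_mult[of \<psi> z m] \<psi> diffm dbar_holomorphic[OF dm] by (simp add: C1_supported_def)
    (* The quadratic term in z cancels, which leaves a factor holomorphic in z. *)
    have phase: "gauss_phase t z \<zeta> * e z = m z * e \<zeta>" for z
      unfolding gauss_phase_def e_def m_def exp_of_real[symmetric] exp_add[symmetric]
      by (rule arg_cong[where f = exp]) (simp add: complex_norm_square field_simps del: of_real_power)
    have "k z \<zeta> = (e \<zeta> * g \<zeta>) * (dbar (\<lambda>z. \<psi> z * m z) z / (z - \<zeta>))" for z
    proof -
      have "k z \<zeta> = (gauss_phase t z \<zeta> * e z) * (g \<zeta> * dbar \<psi> z) / (z - \<zeta>)" by (simp add: k_def)
      then show ?thesis unfolding phase dS by (simp add: mult_ac)
    qed
    then have "(LINT z|lborel. k z \<zeta>) = (e \<zeta> * g \<zeta>) * (LINT z|lborel. dbar (\<lambda>z. \<psi> z * m z) z / (z - \<zeta>))"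
      by (simp only: integral_mult_right_zero)
    also have "\<dots> = (e \<zeta> * g \<zeta>) * (- complex_of_real cauchy_const * \<psi> \<zeta>)"
      unfolding pompeiu[OF S True] by (simp add: m_def)
    finally show ?thesis by simp
  next
    case False
    then have "g \<zeta> = 0" using disc_densityD(3)[OF g] by blast
    then show ?thesis by (simp add: k_def)
  qed
  have "complex_of_real cauchy_const * (LINT z|lborel. (e z * weighted_cauchy t g z) * dbar \<psi> z)
     = (LINT z|lborel. complex_of_real cauchy_const * ((e z * weighted_cauchy t g z) * dbar \<psi> z))"
    by (simp only: integral_mult_right_zero)
  also have "\<dots> = (LINT z|lborel. (LINT \<zeta>|lborel. k z \<zeta>))"
    unfolding k_def weighted_cauchy_def integral_mult_left_zero using cauchy_const_pos
    by (intro Bochner_Integration.integral_cong refl) (simp add: mult_ac)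
  also have "\<dots> = (LINT \<zeta>|lborel. (LINT z|lborel. k z \<zeta>))"
    using lborel_pair.Fubini_integral[of k] int by (simp add: case_prod_beta')
  also have "\<dots> = - complex_of_real cauchy_const * (LINT \<zeta>|lborel. e \<zeta> * g \<zeta> * \<psi> \<zeta>)"
    unfolding inner by (simp only: integral_mult_right_zero)
  finally have "complex_of_real cauchy_const * (LINT z|lborel. (e z * weighted_cauchy t g z) * dbar \<psi> z)
     = complex_of_real cauchy_const * - (LINT \<zeta>|lborel. e \<zeta> * g \<zeta> * \<psi> \<zeta>)" by simp
  moreover have "complex_of_real cauchy_const \<noteq> 0" using cauchy_const_pos by simp
  ultimately show ?thesis using mult_left_cancel by blast
qed

lemma weighted_cauchy_diff:
  assumes "0 \<le> t" "disc_density g G" "disc_density g' G'"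
  shows "weighted_cauchy t g z - weighted_cauchy t g' z = weighted_cauchy t (\<lambda>\<zeta>. g \<zeta> - g' \<zeta>) z"
proof -
  have "(LINT \<zeta>|lborel. gauss_phase t z \<zeta> / (z - \<zeta>) * (g \<zeta> - g' \<zeta>))
    = (LINT \<zeta>|lborel. gauss_phase t z \<zeta> / (z - \<zeta>) * g \<zeta> - gauss_phase t z \<zeta> / (z - \<zeta>) * g' \<zeta>)"
    by (simp only: right_diff_distrib)
  also have "\<dots> = (LINT \<zeta>|lborel. gauss_phase t z \<zeta> / (z - \<zeta>) * g \<zeta>) - (LINT \<zeta>|lborel. gauss_phase t z \<zeta> / (z - \<zeta>) * g' \<zeta>)"
    by (intro Bochner_Integration.integral_diff integrable_cauchy_integrand[OF assms(1,2)] integrable_cauchy_integrand[OF assms(1,3)])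
  finally show ?thesis unfolding weighted_cauchy_def by (simp only: diff_divide_distrib)
qed

text \<open>
  In contrast to the bound by the supremum of \<open>g\<close>, this one sees that a tall and narrow density has
  a small potential.
\<close>

lemma weighted_cauchy_potential_bound:
  assumes t: "0 \<le> t" and g: "disc_density g G" and gh: "\<And>\<zeta>. cmod (g \<zeta>) \<le> C * cmod (h \<zeta>)" and C: "0 \<le> C"
    and h: "disc_density h B" and H: "(LINT \<zeta>|lborel. cmod (z - \<zeta>) powr (- 1) * cmod (h \<zeta>)) \<le> H"
  shows "cmod (weighted_cauchy t g z) \<le> C * H / cauchy_const"
proof -
  have ih: "integrable lborel (\<lambda>\<zeta>. cmod (z - \<zeta>) powr (- 1) * cmod (h \<zeta>))"
  proof -
    have "integrable lborel (\<lambda>\<zeta>. complex_of_real (cmod (z - \<zeta>) powr (- 1)) * h \<zeta>)"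
    proof (rule integrable_disc_density[OF h, where k = "\<lambda>\<zeta>. cmod (z - \<zeta>) powr (- 1)"])
      show "integrable lborel (\<lambda>\<zeta>. indicator disc \<zeta> * cmod (z - \<zeta>) powr (- 1))"
        by (rule integrable_riesz) auto
      show "cmod (complex_of_real (cmod (z - \<zeta>) powr (- 1))) \<le> cmod (z - \<zeta>) powr (- 1)" for \<zeta>
        unfolding norm_of_real by simp
    qed simp
    from integrable_norm[OF this] show ?thesis
      by (simp only: norm_mult norm_of_real abs_of_nonneg powr_ge_zero)
  qed
  have "cmod (LINT \<zeta>|lborel. gauss_phase t z \<zeta> / (z - \<zeta>) * g \<zeta>) \<le> (LINT \<zeta>|lborel. C * (cmod (z - \<zeta>) powr (- 1) * cmod (h \<zeta>)))"
  proof (rule order.trans[OF integral_norm_bound integral_mono])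
    fix \<zeta>
    have "cmod (gauss_phase t z \<zeta> / (z - \<zeta>) * g \<zeta>) \<le> cmod (z - \<zeta>) powr (- 1) * (C * cmod (h \<zeta>))"
      by (rule order.trans[OF cmod_cauchy_integrand_le[OF t]]) (intro mult_left_mono gh, simp)
    then show "cmod (gauss_phase t z \<zeta> / (z - \<zeta>) * g \<zeta>) \<le> C * (cmod (z - \<zeta>) powr (- 1) * cmod (h \<zeta>))"
      by (simp only: mult_ac)
  qed (intro integrable_mult_right integrable_norm ih integrable_cauchy_integrand[OF t g])+
  also have "\<dots> = C * (LINT \<zeta>|lborel. cmod (z - \<zeta>) powr (- 1) * cmod (h \<zeta>))"
    by (rule integral_mult_right_zero)
  also have "\<dots> \<le> C * H" using H C by (rule mult_left_mono)
  finally show ?thesis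
    using cauchy_const_pos by (simp add: weighted_cauchy_def norm_divide divide_right_mono)
qed

section \<open>Solving the conjugate Beltrami equation\<close>

text \<open>
  The inverse of the real-linear map \<open>w \<mapsto> w - x * cnj w\<close>: it recovers a solution \<open>f\<close> from
  \<open>f - \<nu> * cnj f\<close>.
\<close>

definition beltrami_inv :: "real \<Rightarrow> complex \<Rightarrow> complex" where
  "beltrami_inv x w = (w + complex_of_real x * cnj w) / complex_of_real (1 - x\<^sup>2)"

lemma beltrami_inv_diff: "beltrami_inv x (w - w') = beltrami_inv x w - beltrami_inv x w'"
  by (simp add: beltrami_inv_def diff_divide_distrib[symmetric] algebra_simps)

lemma beltrami_inv_of_real: "beltrami_inv x (complex_of_real c * w) = complex_of_real c * beltrami_inv x w"
  by (simp add: beltrami_inv_def algebra_simps)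

lemma cmod_sub_cnj_ge:
  assumes "\<bar>x\<bar> \<le> \<kappa>"
  shows "(1 - \<kappa>) * cmod w \<le> cmod (w - complex_of_real x * cnj w)"
proof -
  have "cmod (complex_of_real x * cnj w) \<le> \<kappa> * cmod w"
    using assms by (simp add: norm_mult mult_right_mono)
  then show ?thesis
    using norm_triangle_ineq2[of w "complex_of_real x * cnj w"] by (simp add: algebra_simps)
qed

lemma beltrami_inv_eq:
  assumes "\<bar>x\<bar> \<le> \<kappa>" "\<kappa> < 1"
  shows "beltrami_inv x w - complex_of_real x * cnj (beltrami_inv x w) = w"
proof -
  have "\<bar>x\<bar> < 1" using assms by simp
  then have "1 - x\<^sup>2 \<noteq> 0" using abs_square_less_1[of x] by simp
  then have nz: "complex_of_real (1 - x\<^sup>2) \<noteq> 0" using of_real_eq_0_iff by blast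
  have "beltrami_inv x w - complex_of_real x * cnj (beltrami_inv x w)
     = ((w + complex_of_real x * cnj w) - complex_of_real x * (cnj w + complex_of_real x * w)) / complex_of_real (1 - x\<^sup>2)"
    by (simp add: beltrami_inv_def diff_divide_distrib)
  also have "(w + complex_of_real x * cnj w) - complex_of_real x * (cnj w + complex_of_real x * w) = w * complex_of_real (1 - x\<^sup>2)"
    by (simp add: algebra_simps power2_eq_square)
  finally show ?thesis using nz by simp
qed

lemma cmod_beltrami_inv_le:
  assumes "\<bar>x\<bar> \<le> \<kappa>" "\<kappa> < 1"
  shows "cmod (beltrami_inv x w) \<le> cmod w / (1 - \<kappa>)"
  using cmod_sub_cnj_ge[OF assms(1), of "beltrami_inv x w"] assms
  unfolding beltrami_inv_eq[OF assms] by (simp add: field_simps)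

text \<open>
  With \<open>n = \<nu>\<close> and \<open>b = dbar \<nu>\<close> on the disc, \<open>f = beltrami_inv n (h + u)\<close> satisfies
  \<open>dbar (f - \<nu> * cnj f) = - dbar \<nu> * cnj f\<close> weakly. The unknown of the fixed point problem is
  \<open>v = \<omega> * u\<close> with the Gaussian weight \<open>\<omega>\<close>; as \<open>\<omega>\<close> is real, it commutes with \<open>beltrami_inv\<close> and
  conjugation. The map is a contraction with factor \<open>1/2\<close>, so \<open>v\<close> is at most twice the image of 0,
  which only involves the potential of \<open>|h|\<close>. Note that \<open>K\<close> does not depend on \<open>h\<close>.
\<close>

lemma solve_conj_beltrami:
  fixes b :: "complex \<Rightarrow> complex" and n :: "complex \<Rightarrow> real"
  assumes b: "disc_density b M" and n: "n \<in> borel_measurable borel" "\<And>z. \<bar>n z\<bar> \<le> \<kappa>" and \<kappa>: "\<kappa> < 1"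
  obtains K where "0 \<le> K"
    "\<And>h B H. disc_density h B \<Longrightarrow> (\<And>z. (LINT \<zeta>|lborel. cmod (z - \<zeta>) powr (- 1) * cmod (h \<zeta>)) \<le> H) \<Longrightarrow>
      \<exists>u. continuous_on UNIV u \<and> (\<forall>z\<in>cball 0 1. cmod (u z) \<le> K * H) \<and>
        (\<forall>\<psi>. C1_supported \<psi> 1 \<longrightarrow>
          (LINT z|lborel. u z * dbar \<psi> z) = (LINT z|lborel. b z * cnj (beltrami_inv (n z) (h z + u z)) * \<psi> z))"
proof -
  have M0: "0 \<le> M" by (rule disc_densityD(4)[OF b])
  define M' where "M' = M / (1 - \<kappa>)"
  have M': "0 \<le> M'" using M0 \<kappa> by (simp add: M'_def)
  (* The choice of t makes the Lipschitz constant of the fixed point map at most 1/2. *)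
  define X where "X = 2 * (M' * riesz_bound (3/2) / cauchy_const) + 1"
  have P: "0 \<le> M' * riesz_bound (3/2) / cauchy_const"
    using M' riesz_bound_pos[of "3/2"] cauchy_const_pos by simp
  then have X: "0 < X" by (simp add: X_def)
  define t where "t = 2 * X ^ 4"
  have t: "0 < t" using X by (simp add: t_def)
  have tX: "(t / 2) powr (- (1/4)) = 1 / X"
  proof -
    have "t / 2 = X powr 4" using X by (simp add: t_def powr_numeral)
    then have "(t / 2) powr (- (1/4)) = X powr (- 1)" by (simp only: powr_powr) simp
    then show ?thesis using X by (simp add: powr_minus field_simps)
  qed
  have half: "M' * ((t / 2) powr (- (1/4)) * riesz_bound (3/2) / cauchy_const) \<le> 1 / 2"
  proof -
    have "M' * riesz_bound (3/2) / cauchy_const \<le> X / 2"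
      unfolding X_def by (simp only: add_divide_distrib) simp
    then have "(M' * riesz_bound (3/2) / cauchy_const) / X \<le> (X / 2) / X"
      using X by (intro divide_right_mono) auto
    then show ?thesis unfolding tX using X by (simp add: mult.commute[of X])
  qed
  define \<omega> where "\<omega> z = complex_of_real (exp (- (t * (cmod z)\<^sup>2 / 2)))" for z
  define e where "e z = complex_of_real (exp (t * (cmod z)\<^sup>2 / 2))" for z
  have e\<omega>: "e z * \<omega> z = 1" for z
    unfolding e_def \<omega>_def of_real_mult[symmetric] exp_add[symmetric] by simp
  have \<omega>1: "cmod (\<omega> z) \<le> 1" for z using t by (simp add: \<omega>_def)
  have c\<omega>: "continuous_on UNIV \<omega>" "continuous_on UNIV e"
    unfolding \<omega>_def e_def by (intro continuous_intros; simp)+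
  have m\<omega>: "\<omega> \<in> borel_measurable borel" using c\<omega>(1) by (rule borel_measurable_continuous_onI)
  define K where "K = exp (t / 2) * (2 * M' / cauchy_const)"
  show thesis
  proof (rule that[of K])
    show "0 \<le> K" using M' cauchy_const_pos by (simp add: K_def)
    fix h B H
    assume h: "disc_density h B" and H: "\<And>z. (LINT \<zeta>|lborel. cmod (z - \<zeta>) powr (- 1) * cmod (h \<zeta>)) \<le> H"
    define g where "g v \<zeta> = - b \<zeta> * cnj (beltrami_inv (n \<zeta>) (\<omega> \<zeta> * h \<zeta> + v \<zeta>))" for v \<zeta>
    have cbi: "cmod (beltrami_inv (n \<zeta>) w) \<le> cmod w / (1 - \<kappa>)" for \<zeta> w
      by (rule cmod_beltrami_inv_le[OF n(2) \<kappa>])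
    have bw: "cmod (b \<zeta> * cnj (beltrami_inv (n \<zeta>) w)) \<le> M' * cmod w" for \<zeta> w
    proof -
      have "cmod (b \<zeta>) * cmod (beltrami_inv (n \<zeta>) w) \<le> M * (cmod w / (1 - \<kappa>))"
        using disc_densityD(2)[OF b, of \<zeta>] cbi M0 by (intro mult_mono) auto
      then show ?thesis by (simp add: norm_mult M'_def)
    qed
    have mg: "g v \<in> borel_measurable borel" if "v \<in> borel_measurable borel" for v
      unfolding g_def beltrami_inv_def using that m\<omega> n(1) disc_densityD(1)[OF b] disc_densityD(1)[OF h] by measurable
    have g: "disc_density (g v) (M' * (B + V))" if v: "v \<in> borel_measurable borel" "\<And>z. cmod (v z) \<le> V" for v V
      unfolding disc_density_def
    proof (intro conjI allI impI mg v)
      fix \<zeta>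
      have "cmod (\<omega> \<zeta> * h \<zeta> + v \<zeta>) \<le> 1 * B + V"
        unfolding norm_mult[symmetric]
        by (intro norm_triangle_le add_mono v(2), unfold norm_mult, intro mult_mono \<omega>1 disc_densityD(2)[OF h]) auto
      then have "M' * cmod (\<omega> \<zeta> * h \<zeta> + v \<zeta>) \<le> M' * (B + V)" using M' by (intro mult_left_mono) auto
      then show "cmod (g v \<zeta>) \<le> M' * (B + V)"
        using bw[of \<zeta> "\<omega> \<zeta> * h \<zeta> + v \<zeta>"] by (simp add: g_def)
      show "\<zeta> \<notin> disc \<Longrightarrow> g v \<zeta> = 0" using disc_densityD(3)[OF b] by (simp add: g_def)
    qed
    have gd: "disc_density (\<lambda>\<zeta>. g v \<zeta> - g v' \<zeta>) (M' * V)"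
      if v: "v \<in> borel_measurable borel" "v' \<in> borel_measurable borel" "\<And>z. cmod (v z - v' z) \<le> V" for v v' V
      unfolding disc_density_def
    proof (intro conjI allI impI)
      show "(\<lambda>\<zeta>. g v \<zeta> - g v' \<zeta>) \<in> borel_measurable borel" using mg v by simp
      fix \<zeta>
      have "g v \<zeta> - g v' \<zeta> = - (b \<zeta> * cnj (beltrami_inv (n \<zeta>) ((\<omega> \<zeta> * h \<zeta> + v \<zeta>) - (\<omega> \<zeta> * h \<zeta> + v' \<zeta>))))"
        unfolding g_def beltrami_inv_diff by (simp add: algebra_simps)
      then have "cmod (g v \<zeta> - g v' \<zeta>) \<le> M' * cmod (v \<zeta> - v' \<zeta>)"
        using bw[of \<zeta> "v \<zeta> - v' \<zeta>"] by simp
      also have "\<dots> \<le> M' * V" using M' v(3) by (rule mult_left_mono[rotated])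
      finally show "cmod (g v \<zeta> - g v' \<zeta>) \<le> M' * V" .
      show "\<zeta> \<notin> disc \<Longrightarrow> g v \<zeta> - g v' \<zeta> = 0" using disc_densityD(3)[OF b] by (simp add: g_def)
    qed
    define T where "T v = Bcontfun (weighted_cauchy t (g (apply_bcontfun v)))" for v :: "complex \<Rightarrow>\<^sub>C complex"
    have mv: "apply_bcontfun v \<in> borel_measurable borel" for v :: "complex \<Rightarrow>\<^sub>C complex"
      by (rule borel_measurable_continuous_onI) simp
    have gv: "disc_density (g (apply_bcontfun v)) (M' * (B + norm v))" for v
      by (rule g[OF mv]) (rule norm_bounded)
    have Tv: "apply_bcontfun (T v) = weighted_cauchy t (g (apply_bcontfun v))" for v
      unfolding T_def
    proof (rule Bcontfun_inverse)
      show "weighted_cauchy t (g (apply_bcontfun v)) \<in> bcontfun"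
        by (rule bcontfun_normI[OF continuous_weighted_cauchy[OF less_imp_le[OF t] gv]])
           (rule weighted_cauchy_bound[OF t gv])
    qed
    have contr: "cmod (weighted_cauchy t (g v) z - weighted_cauchy t (g v') z) \<le> 1 / 2 * V"
      if v: "v \<in> borel_measurable borel" "v' \<in> borel_measurable borel" "\<And>z. cmod (v z - v' z) \<le> V"
        "\<And>z. cmod (v z) \<le> W" "\<And>z. cmod (v' z) \<le> W" for v v' V W z
    proof -
      have V0: "0 \<le> V" using order.trans[OF norm_ge_zero v(3)] .
      have "cmod (weighted_cauchy t (g v) z - weighted_cauchy t (g v') z) = cmod (weighted_cauchy t (\<lambda>\<zeta>. g v \<zeta> - g v' \<zeta>) z)"
        using weighted_cauchy_diff[OF less_imp_le[OF t] g[OF v(1,4)] g[OF v(2,5)]] by simp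
      also have "\<dots> \<le> (M' * V) * ((t / 2) powr (- (1/4)) * riesz_bound (3/2) / cauchy_const)"
        by (rule weighted_cauchy_bound[OF t gd[OF v(1-3)]])
      also have "\<dots> = (M' * ((t / 2) powr (- (1/4)) * riesz_bound (3/2) / cauchy_const)) * V" by (simp only: mult_ac)
      also have "\<dots> \<le> 1 / 2 * V" using half V0 by (rule mult_right_mono)
      finally show ?thesis .
    qed
    have "\<exists>!v. T v = v"
    proof (rule banach_fix_type[where c = "1/2"])
      show "\<forall>x y. dist (T x) (T y) \<le> 1 / 2 * dist x y"
      proof (intro allI dist_bound)
        fix x y z
        show "dist (apply_bcontfun (T x) z) (apply_bcontfun (T y) z) \<le> 1 / 2 * dist x y"
          unfolding Tv dist_norm[of "_ :: complex"]
          by (rule contr[where W = "max (norm x) (norm y)"])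
             (auto intro!: mv simp: dist_norm[symmetric] dist_bounded intro: max.coboundedI1 max.coboundedI2 norm_bounded)
      qed
    qed auto
    then obtain v where v: "T v = v" by blast
    have vz: "apply_bcontfun v z = weighted_cauchy t (g (apply_bcontfun v)) z" for z
      using Tv[of v] v by simp
    have v_bd: "norm v \<le> 2 * (M' * H / cauchy_const)"
    proof -
      have "norm v \<le> 1 / 2 * norm v + M' * H / cauchy_const"
      proof (rule norm_bound)
        fix z
        have "cmod (weighted_cauchy t (g (apply_bcontfun v)) z - weighted_cauchy t (g (\<lambda>_. 0)) z) \<le> 1 / 2 * norm v"
          by (rule contr[where W = "norm v"]) (auto intro: mv norm_bounded)
        moreover have "cmod (weighted_cauchy t (g (\<lambda>_. 0)) z) \<le> M' * H / cauchy_const"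
        proof (rule weighted_cauchy_potential_bound[OF less_imp_le[OF t] _ _ M' h H])
          show "disc_density (g (\<lambda>_. 0)) (M' * (B + 0))" by (rule g) auto
          fix \<zeta>
          have "cmod (g (\<lambda>_. 0) \<zeta>) \<le> M' * cmod (\<omega> \<zeta> * h \<zeta>)"
            using bw[of \<zeta> "\<omega> \<zeta> * h \<zeta>"] by (simp add: g_def)
          also have "\<dots> \<le> M' * cmod (h \<zeta>)"
            using M' \<omega>1[of \<zeta>] by (intro mult_left_mono) (auto simp: norm_mult intro: mult_left_le_one_le)
          finally show "cmod (g (\<lambda>_. 0) \<zeta>) \<le> M' * cmod (h \<zeta>)" .
        qed
        ultimately show "cmod (apply_bcontfun v z) \<le> 1 / 2 * norm v + M' * H / cauchy_const"
          unfolding vz[of z]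
          using norm_triangle_ineq2[of "weighted_cauchy t (g (apply_bcontfun v)) z" "weighted_cauchy t (g (\<lambda>_. 0)) z"] by linarith
      qed
      then show ?thesis by simp
    qed
    define u where "u z = e z * apply_bcontfun v z" for z
    show "\<exists>u. continuous_on UNIV u \<and> (\<forall>z\<in>cball 0 1. cmod (u z) \<le> K * H) \<and>
        (\<forall>\<psi>. C1_supported \<psi> 1 \<longrightarrow>
          (LINT z|lborel. u z * dbar \<psi> z) = (LINT z|lborel. b z * cnj (beltrami_inv (n z) (h z + u z)) * \<psi> z))"
    proof (intro exI[of _ u] conjI ballI allI impI)
      show "continuous_on UNIV u" unfolding u_def by (intro continuous_intros c\<omega>) simp
      fix z :: complex assume z: "z \<in> cball 0 1"
      have "cmod (u z) = exp (t * (cmod z)\<^sup>2 / 2) * cmod (apply_bcontfun v z)" by (simp add: u_def e_def norm_mult)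
      also have "\<dots> \<le> exp (t / 2) * (2 * (M' * H / cauchy_const))"
      proof (intro mult_mono)
        have "(cmod z)\<^sup>2 \<le> 1" using z by (simp add: power_le_one)
        then show "exp (t * (cmod z)\<^sup>2 / 2) \<le> exp (t / 2)" using t by simp
        show "cmod (apply_bcontfun v z) \<le> 2 * (M' * H / cauchy_const)"
          using norm_bounded[of v z] v_bd by linarith
      qed auto
      finally show "cmod (u z) \<le> K * H" by (simp add: K_def)
    next
      fix \<psi> assume \<psi>: "C1_supported \<psi> 1"
      have "(LINT z|lborel. u z * dbar \<psi> z) = - (LINT \<zeta>|lborel. e \<zeta> * g (apply_bcontfun v) \<zeta> * \<psi> \<zeta>)"
      proof -
        have "u = (\<lambda>z. e z * weighted_cauchy t (g (apply_bcontfun v)) z)"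
          by (rule ext) (simp only: u_def vz[symmetric])
        then show ?thesis
          unfolding e_def using weak_dbar_weighted_cauchy[OF less_imp_le[OF t] gv \<psi>] by simp
      qed
      also have "\<dots> = (LINT \<zeta>|lborel. - (e \<zeta> * g (apply_bcontfun v) \<zeta> * \<psi> \<zeta>))" by simp
      also have "\<dots> = (LINT z|lborel. b z * cnj (beltrami_inv (n z) (h z + u z)) * \<psi> z)"
      proof (intro Bochner_Integration.integral_cong refl)
        fix z
        have "h z + u z = e z * (\<omega> z * h z + apply_bcontfun v z)"
          using e\<omega>[of z] by (simp add: u_def distrib_left mult.assoc[symmetric])
        then have "beltrami_inv (n z) (h z + u z) = e z * beltrami_inv (n z) (\<omega> z * h z + apply_bcontfun v z)"
          by (simp only: e_def beltrami_inv_of_real)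
        then have "cnj (beltrami_inv (n z) (h z + u z)) = e z * cnj (beltrami_inv (n z) (\<omega> z * h z + apply_bcontfun v z))"
          by (simp add: e_def)
        then show "- (e z * g (apply_bcontfun v) z * \<psi> z) = b z * cnj (beltrami_inv (n z) (h z + u z)) * \<psi> z"
          by (simp add: g_def)
      qed
      finally show "(LINT z|lborel. u z * dbar \<psi> z) = (LINT z|lborel. b z * cnj (beltrami_inv (n z) (h z + u z)) * \<psi> z)" .
    qed
  qed
qed

section \<open>Traces and Hardy norms of functions continuous on the closed disc\<close>

text \<open>
  Stolz regions of aperture above 1 contain a radial segment ending at \<open>\<zeta>\<close>, so nontangential limits
  are unique.
\<close>

lemma stolz_nontrivial:
  assumes "\<zeta> \<in> circle" "1 < \<beta>"
  shows "at \<zeta> within stolz \<beta> \<zeta> \<noteq> bot"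
proof -
  have "\<zeta> islimpt stolz \<beta> \<zeta>"
    unfolding islimpt_approachable
  proof (intro allI impI)
    fix e :: real assume e: "0 < e"
    define r where "r = max (1/2) (1 - e / 2)"
    have r: "0 < r" "r < 1" "1 - r < e" using e by (auto simp: r_def max_def)
    define z where "z = r *\<^sub>R \<zeta>"
    have "z - \<zeta> = - ((1 - r) *\<^sub>R \<zeta>)" by (simp add: z_def algebra_simps)
    then have d: "cmod (z - \<zeta>) = 1 - r" using assms(1) r by simp
    have "cmod z = r" using assms(1) r by (simp add: z_def)
    then have "z \<in> stolz \<beta> \<zeta>" using d r assms(2) by (simp add: stolz_def)
    moreover have "z \<noteq> \<zeta>" using d r by auto
    ultimately show "\<exists>x'\<in>stolz \<beta> \<zeta>. x' \<noteq> \<zeta> \<and> dist x' \<zeta> < e"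
      using d r by (auto simp: dist_norm)
  qed
  then show ?thesis by (simp add: trivial_limit_within)
qed

lemma tr_eq_continuous_extension:
  assumes F: "continuous_on (cball 0 1) F" "\<And>z. z \<in> disc \<Longrightarrow> f z = F z" and \<zeta>: "\<zeta> \<in> circle"
  shows "tr f \<zeta> = F \<zeta>"
proof -
  have lim: "(f \<longlongrightarrow> F \<zeta>) (at \<zeta> within stolz \<beta> \<zeta>)" for \<beta>
  proof -
    have "(F \<longlongrightarrow> F \<zeta>) (at \<zeta> within cball 0 1)"
      using F(1) \<zeta> by (auto simp: continuous_on_def)
    then have "(F \<longlongrightarrow> F \<zeta>) (at \<zeta> within stolz \<beta> \<zeta>)"
      by (rule tendsto_within_subset) (auto simp: stolz_def)
    then show ?thesis
      by (rule Lim_transform_eventually) (auto simp: eventually_at_filter stolz_def F(2))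
  qed
  show ?thesis
    unfolding tr_def
  proof (rule the_equality)
    show "nontangential_limit f \<zeta> (F \<zeta>)" using lim by (simp add: nontangential_limit_def)
    fix l assume "nontangential_limit f \<zeta> l"
    then have "(f \<longlongrightarrow> l) (at \<zeta> within stolz 2 \<zeta>)" by (simp add: nontangential_limit_def)
    then show "l = F \<zeta>" using tendsto_unique[OF stolz_nontrivial[OF \<zeta>, of 2]] lim[of 2] by auto
  qed
qed

lemma LINT_eq_circle_mean:
  fixes w :: "complex \<Rightarrow> real"
  assumes "continuous_on circle w"
  shows "1 / (2 * pi) * (LINT t|lebesgue_on {0..2 * pi}. w (cis t)) = circle_mean w"
proof -
  have "continuous_on {0..2 * pi} (\<lambda>t. w (cis t))"
    by (intro continuous_on_compose2[OF assms]) (auto intro!: continuous_intros)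
  then show ?thesis
    by (simp add: circle_mean_def lebesgue_integral_eq_integral continuous_imp_integrable_real)
qed

lemma tr_norm_eq:
  assumes F: "continuous_on (cball 0 1) F" "\<And>z. z \<in> disc \<Longrightarrow> f z = F z" and p: "1 < p"
  shows "tr_norm p f = circle_mean (\<lambda>\<zeta>. cmod (F \<zeta>) powr p) powr (1 / p)"
proof -
  have "continuous_on circle F" by (rule continuous_on_subset[OF F(1)]) auto
  then have "continuous_on circle (\<lambda>\<zeta>. cmod (F \<zeta>) powr p)" using p by (intro powr_continuous_on) auto
  from LINT_eq_circle_mean[OF this]
  have "1 / (2 * pi) * (LINT t|lebesgue_on {0..2 * pi}. cmod (F (cis t)) powr p) = circle_mean (\<lambda>\<zeta>. cmod (F \<zeta>) powr p)" .
  moreover have "tr f (cis t) = F (cis t)" for t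
    by (rule tr_eq_continuous_extension[OF F]) auto
  ultimately show ?thesis
    unfolding tr_norm_def by simp
qed

lemma circle_mean_powr_eq_of_tr_norm_eq:
  assumes F: "continuous_on (cball 0 1) F" "\<And>z. z \<in> disc \<Longrightarrow> f z = F z"
    and G: "continuous_on (cball 0 1) G" "\<And>z. z \<in> disc \<Longrightarrow> g z = G z"
    and p: "1 < p" and eq: "tr_norm p f = tr_norm p g"
  shows "circle_mean (\<lambda>\<zeta>. cmod (F \<zeta>) powr p) = circle_mean (\<lambda>\<zeta>. cmod (G \<zeta>) powr p)"
proof -
  have nn: "0 \<le> circle_mean (\<lambda>\<zeta>. cmod (F \<zeta>) powr p)" if "continuous_on (cball 0 1) F" for F :: "complex \<Rightarrow> complex"
  proof -
    have "continuous_on circle F" by (rule continuous_on_subset[OF that]) auto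
    then have "continuous_on circle (\<lambda>\<zeta>. cmod (F \<zeta>) powr p)" using p by (intro powr_continuous_on) auto
    then have "circle_mean (\<lambda>_. 0) \<le> circle_mean (\<lambda>\<zeta>. cmod (F \<zeta>) powr p)" by (intro circle_mean_mono) auto
    then show ?thesis by (simp add: circle_mean_const)
  qed
  have "(circle_mean (\<lambda>\<zeta>. cmod (F \<zeta>) powr p) powr (1 / p)) powr p = (circle_mean (\<lambda>\<zeta>. cmod (G \<zeta>) powr p) powr (1 / p)) powr p"
  proof -
    have e: "circle_mean (\<lambda>\<zeta>. cmod (F \<zeta>) powr p) powr (1 / p) = circle_mean (\<lambda>\<zeta>. cmod (G \<zeta>) powr p) powr (1 / p)"
      using eq tr_norm_eq[OF F p] tr_norm_eq[OF G p] by simp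
    show ?thesis by (simp only: e)
  qed
  then show ?thesis using p nn[OF F(1)] nn[OF G(1)] by (simp add: powr_powr)
qed

lemma bounded_mean_imp_Hp_bound:
  assumes "continuous_on (cball 0 1) F" "\<And>z. z \<in> disc \<Longrightarrow> f z = F z" and p: "1 < p"
  shows "\<exists>C. AE r in lebesgue_on {0<..<1}.
        1 / (2 * pi) * (LINT t|lebesgue_on {0..2 * pi}. cmod (f (complex_of_real r * cis t)) powr p) \<le> C"
proof -
  have "bounded (F ` cball 0 1)" by (intro compact_imp_bounded compact_continuous_image assms) auto
  then obtain B where B: "0 < B" "\<And>z. z \<in> cball 0 1 \<Longrightarrow> cmod (F z) \<le> B" by (auto simp: bounded_pos)
  have "1 / (2 * pi) * (LINT t|lebesgue_on {0..2 * pi}. cmod (f (complex_of_real r * cis t)) powr p) \<le> B powr p"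
    if r: "r \<in> {0<..<1}" for r
  proof -
    have inD: "complex_of_real r * \<zeta> \<in> disc" if "\<zeta> \<in> circle" for \<zeta> using r that by (simp add: norm_mult)
    have "continuous_on circle (\<lambda>\<zeta>. F (complex_of_real r * \<zeta>))"
    proof (intro continuous_on_compose2[OF assms(1)] continuous_intros)
      show "(\<lambda>\<zeta>. complex_of_real r * \<zeta>) ` circle \<subseteq> cball 0 1"
        using inD ball_subset_cball by blast
    qed
    then have c: "continuous_on circle (\<lambda>\<zeta>. cmod (F (complex_of_real r * \<zeta>)) powr p)"
      using p by (intro powr_continuous_on) auto
    have "circle_mean (\<lambda>\<zeta>. cmod (F (complex_of_real r * \<zeta>)) powr p) \<le> circle_mean (\<lambda>\<zeta>. B powr p)"
    proof (rule circle_mean_mono[OF c])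
      fix \<zeta> :: complex assume "\<zeta> \<in> circle"
      then have "complex_of_real r * \<zeta> \<in> cball 0 1" using inD[of \<zeta>] by simp
      then show "cmod (F (complex_of_real r * \<zeta>)) powr p \<le> B powr p"
        using B p by (intro powr_mono2) auto
    qed auto
    moreover have "f (complex_of_real r * cis t) = F (complex_of_real r * cis t)" for t
      using inD[of "cis t"] by (intro assms(2)) simp
    ultimately show ?thesis
      using LINT_eq_circle_mean[OF c] by (simp add: circle_mean_const)
  qed
  then show ?thesis by (intro exI[of _ "B powr p"]) (auto intro!: AE_I2)
qed

text \<open>
  Substitutes for the triangle inequality in \<open>L\<^sup>p\<close>: either \<open>b\<close> is at most \<open>s * a\<close>, or \<open>a\<close> is less than
  \<open>b / s\<close>.
\<close>

lemma add_powr_le: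
  fixes a b s p :: real
  assumes "0 \<le> a" "0 \<le> b" "0 < s" "0 < p"
  shows "(a + b) powr p \<le> (1 + s) powr p * a powr p + (1 + 1 / s) powr p * b powr p"
proof (cases "b \<le> s * a")
  case True
  then have "(a + b) powr p \<le> ((1 + s) * a) powr p"
    using assms by (intro powr_mono2) (auto simp: algebra_simps)
  also have "\<dots> = (1 + s) powr p * a powr p" using assms by (simp add: powr_mult)
  finally show ?thesis by (simp add: add_increasing2)
next
  case False
  then have "a \<le> b / s" using assms by (simp add: field_simps)
  then have "(a + b) powr p \<le> ((1 + 1 / s) * b) powr p"
    using assms by (intro powr_mono2) (auto simp: algebra_simps)
  also have "\<dots> = (1 + 1 / s) powr p * b powr p" using assms by (simp add: powr_mult)
  finally show ?thesis by (simp add: add_increasing)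
qed

lemma circle_mean_powr_perturb:
  fixes F G :: "complex \<Rightarrow> complex"
  assumes F: "continuous_on circle F" and G: "continuous_on circle G"
    and e: "\<And>z. z \<in> circle \<Longrightarrow> cmod (F z - G z) \<le> e" and s: "0 < s" and p: "0 < p"
  shows "circle_mean (\<lambda>z. cmod (F z) powr p)
    \<le> (1 + s) powr p * circle_mean (\<lambda>z. cmod (G z) powr p) + (1 + 1 / s) powr p * e powr p"
proof -
  note c = powr_continuous_on[OF F p] powr_continuous_on[OF G p]
  have "circle_mean (\<lambda>z. cmod (F z) powr p)
     \<le> circle_mean (\<lambda>z. (1 + s) powr p * cmod (G z) powr p + (1 + 1 / s) powr p * e powr p)"
  proof (rule circle_mean_mono)
    fix z :: complex assume z: "z \<in> circle"
    have e0: "0 \<le> e" using order.trans[OF norm_ge_zero e[OF z]] .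
    have "cmod (F z) \<le> cmod (G z) + e"
      using norm_triangle_ineq2[of "F z" "G z"] e[OF z] by linarith
    then have "cmod (F z) powr p \<le> (cmod (G z) + e) powr p" using p by (intro powr_mono2) auto
    also have "\<dots> \<le> (1 + s) powr p * cmod (G z) powr p + (1 + 1 / s) powr p * e powr p"
      using e0 s p by (intro add_powr_le) auto
    finally show "cmod (F z) powr p \<le> (1 + s) powr p * cmod (G z) powr p + (1 + 1 / s) powr p * e powr p" .
  qed (intro continuous_intros c)+
  also have "\<dots> = (1 + s) powr p * circle_mean (\<lambda>z. cmod (G z) powr p) + (1 + 1 / s) powr p * e powr p"
    by (subst circle_mean_add) (auto intro!: continuous_intros c simp: circle_mean_mult circle_mean_const)
  finally show ?thesis .
qed

section \<open>Membership in the Hardy space\<close>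

text \<open>
  Holomorphic functions satisfy the Cauchy--Riemann equation weakly. The product \<open>h * \<psi>\<close> is
  continuously differentiable on the whole plane, whatever the values of \<open>h\<close> off \<open>S\<close>, since \<open>\<psi>\<close> vanishes
  off the disc.
\<close>

lemma integral_holomorphic_dbar_eq_0:
  assumes h: "h holomorphic_on S" "open S" "cball 0 1 \<subseteq> S" and \<psi>: "C1_supported \<psi> 1"
  shows "(LINT z|lborel. h z * dbar \<psi> z) = 0"
proof -
  define D where "D v z = h z * ddir v \<psi> z + (deriv h z * v) * \<psi> z" for v z
  have out: "\<psi> z = 0" "ddir v \<psi> z = 0" if "1 \<le> cmod z" for z v
    using \<psi> ddir_eq_0_off_ball[OF \<psi> that] that by (auto simp: C1_supported_def)
  have cover: "UNIV = S \<union> - cball 0 1" using h(3) by auto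
  have dh: "(h has_field_derivative deriv h z) (at z)" if "z \<in> S" for z
    using holomorphic_derivI[OF h(1,2) that] .
  have der: "((\<lambda>z. h z * \<psi> z) has_derivative (\<lambda>v. D v z)) (at z)" for z
  proof (cases "z \<in> S")
    case True
    have "((\<lambda>z. h z * \<psi> z) has_derivative (\<lambda>v. h z * ddir v \<psi> z + (deriv h z * v) * \<psi> z)) (at z)"
      using has_derivative_mult[OF dh[OF True, unfolded has_field_derivative_def] has_derivative_ddir] \<psi>
      by (simp add: C1_supported_def)
    then show ?thesis by (simp add: D_def)
  next
    case False
    then have z: "z \<in> - cball 0 1" using h(3) by auto
    have "((\<lambda>z. 0) has_derivative (\<lambda>v. 0 :: complex)) (at z)" by simp
    then have "((\<lambda>z. h z * \<psi> z) has_derivative (\<lambda>v. 0)) (at z)"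
      by (rule has_derivative_transform_within_open[OF _ _ z]) (auto simp: out)
    then show ?thesis using z by (simp add: D_def out)
  qed
  have "continuous_on UNIV (D v)" for v
  proof -
    have "continuous_on S (D v)"
    proof -
      have "continuous_on S \<psi>" "continuous_on S (ddir v \<psi>)"
        using \<psi> C1_supported_continuous[OF \<psi>] by (auto simp: C1_supported_def intro: continuous_on_subset[OF _ subset_UNIV])
      moreover have "continuous_on S h" "continuous_on S (deriv h)"
        by (intro holomorphic_on_imp_continuous_on holomorphic_deriv h)+
      ultimately show ?thesis unfolding D_def by (intro continuous_intros)
    qed
    moreover have "continuous_on (- cball 0 1) (D v)"
      by (rule continuous_on_cong[THEN iffD1, OF refl _ continuous_on_const[of _ 0]]) (auto simp: D_def out)
    ultimately show ?thesis
      unfolding cover using h(2) by (intro continuous_on_open_Un) auto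
  qed
  moreover have dd: "ddir v (\<lambda>z. h z * \<psi> z) = D v" for v
    by (rule ext) (rule ddir_eq[OF der])
  ultimately have "C1_supported (\<lambda>z. h z * \<psi> z) 1"
    using der unfolding C1_supported_def dd by (auto simp: out differentiable_def)
  from integral_dbar_eq_0[OF this] have "(LINT z|lborel. dbar (\<lambda>z. h z * \<psi> z) z) = 0" .
  moreover have "dbar (\<lambda>z. h z * \<psi> z) z = h z * dbar \<psi> z" for z
  proof -
    have "ddir v (\<lambda>z. h z * \<psi> z) z = D v z" for v by (rule ddir_eq[OF der])
    then show ?thesis by (simp only: dbar_def D_def) (simp add: algebra_simps add_divide_distrib)
  qed
  ultimately show ?thesis by simp
qed

lemma Linf_dbar:
  assumes "Linf f" "Linf g"
  shows "Linf (\<lambda>z. (f z + \<i> * g z) / 2)"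
proof -
  obtain C D where CD: "AE z in lebesgue_on disc. cmod (f z) \<le> C" "AE z in lebesgue_on disc. cmod (g z) \<le> D"
    and m: "f \<in> borel_measurable (lebesgue_on disc)" "g \<in> borel_measurable (lebesgue_on disc)"
    using assms by (auto simp: Linf_def)
  have "AE z in lebesgue_on disc. cmod ((f z + \<i> * g z) / 2) \<le> (C + D) / 2"
    using CD
  proof eventually_elim
    case (elim z)
    then show ?case using norm_triangle_ineq[of "f z" "\<i> * g z"] by (simp add: norm_divide norm_mult)
  qed
  moreover have "(\<lambda>z. (f z + \<i> * g z) / 2) \<in> borel_measurable (lebesgue_on disc)"
    using m by measurable
  ultimately show ?thesis unfolding Linf_def by blast
qed

lemma integrable_disc_times:
  assumes A: "continuous_on (cball 0 1) A" and B: "B \<in> borel_measurable borel" "\<And>z. cmod (B z) \<le> C"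
  shows "integrable lborel (\<lambda>z. (indicator disc z *\<^sub>R A z) * B z)"
proof -
  have "bounded (A ` cball 0 1)" by (intro compact_imp_bounded compact_continuous_image A) auto
  then obtain K where K: "0 < K" "\<And>z. z \<in> cball 0 1 \<Longrightarrow> cmod (A z) \<le> K" by (auto simp: bounded_pos)
  have "(\<lambda>z. indicator disc z *\<^sub>R A z) \<in> borel_measurable borel"
    by (intro borel_measurable_continuous_on_indicator continuous_on_subset[OF A]) auto
  then have m: "(\<lambda>z. (indicator disc z *\<^sub>R A z) * B z) \<in> borel_measurable borel"
    using B(1) by (rule borel_measurable_times)
  show ?thesis
  proof (rule bounded_integrable_supported[OF m, where C = "K * C" and R = 1])
    fix z
    have "cmod (indicator disc z *\<^sub>R A z) \<le> K"
      using K(1) K(2)[of z] by (cases "z \<in> disc") auto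
    then show "cmod ((indicator disc z *\<^sub>R A z) * B z) \<le> K * C"
      unfolding norm_mult using B(2)[of z] K(1) by (intro mult_mono) auto
  qed simp
qed

text \<open>
  Since \<open>f - \<nu> * cnj f = h + u\<close> on the disc, the weak form of the equation splits into the weak
  Cauchy--Riemann equation for \<open>h\<close> and the integral identity assumed for \<open>u\<close>.
\<close>

lemma Hp_memberI:
  assumes nu: "Linf \<nu>x" "Linf \<nu>y" "weak_deriv 1 (\<lambda>z. complex_of_real (\<nu> z)) \<nu>x" "weak_deriv \<i> (\<lambda>z. complex_of_real (\<nu> z)) \<nu>y"
    and N: "continuous_on (cball 0 1) N" "\<And>z. z \<in> disc \<Longrightarrow> N z = \<nu> z" "\<And>z. z \<in> cball 0 1 \<Longrightarrow> \<bar>N z\<bar> \<le> \<kappa>" and \<kappa>: "\<kappa> < 1"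
    and b: "disc_density b M" "AE z in lebesgue_on disc. (\<nu>x z + \<i> * \<nu>y z) / 2 = b z"
    and h: "h holomorphic_on S" "open S" "cball 0 1 \<subseteq> S" and u: "continuous_on UNIV u"
    and eq: "\<And>\<psi>. C1_supported \<psi> 1 \<Longrightarrow> (LINT z|lborel. u z * dbar \<psi> z) =
       (LINT z|lborel. b z * cnj (beltrami_inv (indicator disc z * \<nu> z) (indicator disc z *\<^sub>R h z + u z)) * \<psi> z)"
    and p: "1 < p"
  defines "f \<equiv> \<lambda>z. beltrami_inv (N z) (h z + u z)"
  shows "f \<in> Hp p \<nu>" "continuous_on (cball 0 1) f"
proof -
  have ch: "continuous_on (cball 0 1) h"
    using continuous_on_subset[OF holomorphic_on_imp_continuous_on[OF h(1)] h(3)] .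
  have cu: "continuous_on (cball 0 1) u" using u by (rule continuous_on_subset) auto
  have nz: "complex_of_real (1 - (N z)\<^sup>2) \<noteq> 0" if "z \<in> cball 0 1" for z
  proof -
    have "\<bar>N z\<bar> < 1" using N(3)[OF that] \<kappa> by simp
    then have "1 - (N z)\<^sup>2 \<noteq> 0" using abs_square_less_1[of "N z"] by simp
    then show ?thesis using of_real_eq_0_iff by blast
  qed
  show cf: "continuous_on (cball 0 1) f"
    unfolding f_def beltrami_inv_def using nz by (intro continuous_intros ch cu N(1)) blast
  have cfd: "continuous_on disc f" by (rule continuous_on_subset[OF cf]) auto
  have f_eq: "f z = complex_of_real (N z) * cnj (f z) + (h z + u z)" if "z \<in> cball 0 1" for z
    using beltrami_inv_eq[OF N(3)[OF that] \<kappa>, of "h z + u z"] unfolding f_def by (simp add: algebra_simps)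
  have "conj_beltrami \<nu> f"
    unfolding conj_beltrami_def
  proof (rule exI[of _ \<nu>x], rule exI[of _ \<nu>y], intro conjI nu allI impI)
    fix \<psi> assume "test_function \<psi>"
    then have \<psi>: "C1_supported \<psi> 1" by (rule test_function_C1_supported)
    have c\<psi>: "continuous_on UNIV \<psi>" "continuous_on UNIV (dbar \<psi>)"
      using C1_supported_continuous[OF \<psi>] continuous_dbar[OF \<psi>] .
    have m: "\<psi> \<in> borel_measurable borel" "dbar \<psi> \<in> borel_measurable borel" "b \<in> borel_measurable borel"
      using c\<psi> disc_densityD(1)[OF b(1)] by (auto intro: borel_measurable_continuous_onI)
    have d0: "dbar \<psi> z = 0" if "z \<notin> disc" for z using dbar_eq_0_outside[OF \<psi>, of z] that by simp
    obtain C1 where C1: "\<And>z. cmod (\<psi> z) \<le> C1"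
      by (rule continuous_supported_bounded[OF c\<psi>(1), of 1]) (use \<psi> in \<open>auto simp: C1_supported_def\<close>)
    obtain C2 where C2: "\<And>z. cmod (dbar \<psi> z) \<le> C2"
      by (rule continuous_supported_bounded[OF c\<psi>(2), of 1]) (use d0 in auto)
    have mI: "(\<lambda>z. indicator disc z *\<^sub>R f z) \<in> borel_measurable borel"
      "(\<lambda>z. indicator disc z *\<^sub>R (cnj (f z) * complex_of_real (N z))) \<in> borel_measurable borel"
      "(\<lambda>z. indicator disc z *\<^sub>R cnj (f z)) \<in> borel_measurable borel"
      by (intro borel_measurable_continuous_on_indicator continuous_intros cfd continuous_on_subset[OF N(1)]; auto)+
    have bf: "\<And>z. cmod (b z * \<psi> z) \<le> M * C1"
      unfolding norm_mult using disc_densityD(2)[OF b(1)] disc_densityD(4)[OF b(1)] C1 by (intro mult_mono) auto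
    define P Q R where "P z = (indicator disc z *\<^sub>R f z) * dbar \<psi> z"
      and "Q z = (indicator disc z *\<^sub>R (cnj (f z) * complex_of_real (N z))) * dbar \<psi> z"
      and "R z = (indicator disc z *\<^sub>R cnj (f z)) * (b z * \<psi> z)" for z
    have iQ: "integrable lborel Q" unfolding Q_def
      by (rule integrable_disc_times[OF _ m(2) C2]) (intro continuous_intros cf N(1))
    have iR: "integrable lborel R" unfolding R_def
      by (rule integrable_disc_times[OF _ _ bf]) (intro continuous_intros cf, use m in simp)
    have ih: "integrable lborel (\<lambda>z. (indicator disc z *\<^sub>R h z) * dbar \<psi> z)"
      by (rule integrable_disc_times[OF ch m(2) C2])
    have iu: "integrable lborel (\<lambda>z. (indicator disc z *\<^sub>R u z) * dbar \<psi> z)"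
      by (rule integrable_disc_times[OF cu m(2) C2])
    have drop: "(LINT z|lborel. (indicator disc z *\<^sub>R k z) * dbar \<psi> z) = (LINT z|lborel. k z * dbar \<psi> z)" for k :: "complex \<Rightarrow> complex"
      by (intro Bochner_Integration.integral_cong refl) (use d0 in \<open>auto simp: indicator_def\<close>)
    have "(LINT z|lebesgue_on disc. f z * dbar \<psi> z) = (LINT z|lborel. P z)"
      unfolding P_def using LINT_disc[of "\<lambda>z. f z * dbar \<psi> z"] borel_measurable_times[OF mI(1) m(2)]
      by simp
    also have "\<dots> = (LINT z|lborel. Q z + ((indicator disc z *\<^sub>R h z) * dbar \<psi> z + (indicator disc z *\<^sub>R u z) * dbar \<psi> z))"
    proof (intro Bochner_Integration.integral_cong refl)
      fix z
      show "P z = Q z + ((indicator disc z *\<^sub>R h z) * dbar \<psi> z + (indicator disc z *\<^sub>R u z) * dbar \<psi> z)"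
      proof (cases "z \<in> disc")
        case True
        have "P z = (complex_of_real (N z) * cnj (f z) + (h z + u z)) * dbar \<psi> z"
          using f_eq[of z] True by (simp add: P_def)
        then show ?thesis using True by (simp add: Q_def algebra_simps)
      qed (simp add: P_def Q_def)
    qed
    also have "\<dots> = (LINT z|lborel. Q z) + ((LINT z|lborel. (indicator disc z *\<^sub>R h z) * dbar \<psi> z) + (LINT z|lborel. (indicator disc z *\<^sub>R u z) * dbar \<psi> z))"
      using Bochner_Integration.integral_add[OF iQ Bochner_Integration.integrable_add[OF ih iu]]
        Bochner_Integration.integral_add[OF ih iu] by simp
    also have "(LINT z|lborel. (indicator disc z *\<^sub>R h z) * dbar \<psi> z) = 0"
      unfolding drop by (rule integral_holomorphic_dbar_eq_0[OF h \<psi>])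
    also have "(LINT z|lborel. (indicator disc z *\<^sub>R u z) * dbar \<psi> z) = (LINT z|lborel. R z)"
      unfolding drop eq[OF \<psi>]
    proof (intro Bochner_Integration.integral_cong refl)
      fix z
      show "b z * cnj (beltrami_inv (indicator disc z * \<nu> z) (indicator disc z *\<^sub>R h z + u z)) * \<psi> z = R z"
      proof (cases "z \<in> disc")
        case True
        then show ?thesis using N(2)[OF True] by (simp add: R_def f_def)
      next
        case False
        then show ?thesis using disc_densityD(3)[OF b(1) False] by (simp add: R_def)
      qed
    qed
    also have "(LINT z|lborel. Q z) + (0 + (LINT z|lborel. R z)) = (LINT z|lborel. Q z + R z)"
      using Bochner_Integration.integral_add[OF iQ iR] by simp
    also have "\<dots> = (LINT z|lebesgue_on disc. cnj (f z) * (complex_of_real (N z) * dbar \<psi> z + b z * \<psi> z))"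
    proof -
      have QR: "Q z + R z = indicator disc z *\<^sub>R (cnj (f z) * (complex_of_real (N z) * dbar \<psi> z + b z * \<psi> z))" for z
        by (cases "z \<in> disc") (simp_all add: Q_def R_def algebra_simps)
      have "(\<lambda>z. Q z + R z) \<in> borel_measurable borel"
        using iQ iR by (auto dest!: borel_measurable_integrable)
      then show ?thesis unfolding QR by (rule LINT_disc[symmetric])
    qed
    also have "\<dots> = (LINT z|lebesgue_on disc. cnj (f z) * (complex_of_real (\<nu> z) * dbar \<psi> z + (\<nu>x z + \<i> * \<nu>y z) / 2 * \<psi> z))"
    proof (rule LINT_disc_cong_AE)
      show "AE z in lebesgue_on disc. cnj (f z) * (complex_of_real (N z) * dbar \<psi> z + b z * \<psi> z)
        = cnj (f z) * (complex_of_real (\<nu> z) * dbar \<psi> z + (\<nu>x z + \<i> * \<nu>y z) / 2 * \<psi> z)"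
        using b(2) AE_space by eventually_elim (simp add: N(2))
      have mf: "(\<lambda>z. cnj (f z)) \<in> borel_measurable (lebesgue_on disc)"
        by (intro continuous_imp_measurable_on_sets_lebesgue continuous_intros cfd) auto
      have mN: "(\<lambda>z. complex_of_real (N z)) \<in> borel_measurable (lebesgue_on disc)"
        by (intro continuous_imp_measurable_on_sets_lebesgue continuous_intros continuous_on_subset[OF N(1)]) auto
      have m\<nu>: "(\<lambda>z. complex_of_real (\<nu> z)) \<in> borel_measurable (lebesgue_on disc)"
        using mN by (rule measurable_cong[THEN iffD1, rotated]) (simp add: N(2))
      note ml = borel_imp_lebesgue_on[OF m(1), of disc] borel_imp_lebesgue_on[OF m(2), of disc] borel_imp_lebesgue_on[OF m(3), of disc]
      have mx: "(\<lambda>z. (\<nu>x z + \<i> * \<nu>y z) / 2) \<in> borel_measurable (lebesgue_on disc)"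
        using Linf_dbar[OF nu(1,2)] by (simp add: Linf_def)
      show "(\<lambda>z. cnj (f z) * (complex_of_real (N z) * dbar \<psi> z + b z * \<psi> z)) \<in> borel_measurable (lebesgue_on disc)"
        by (intro borel_measurable_times borel_measurable_add mf mN ml)
      show "(\<lambda>z. cnj (f z) * (complex_of_real (\<nu> z) * dbar \<psi> z + (\<nu>x z + \<i> * \<nu>y z) / 2 * \<psi> z)) \<in> borel_measurable (lebesgue_on disc)"
        by (intro borel_measurable_times borel_measurable_add mf m\<nu> ml mx)
    qed
    finally show "(LINT z|lebesgue_on disc. f z * dbar \<psi> z) =
       (LINT z|lebesgue_on disc. cnj (f z) * (complex_of_real (\<nu> z) * dbar \<psi> z + (\<nu>x z + \<i> * \<nu>y z) / 2 * \<psi> z))" .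
  qed
  then show "f \<in> Hp p \<nu>"
    unfolding Hp_def using cfd bounded_mean_imp_Hp_bound[OF cf _ p] by simp
qed

section \<open>Peaking functions\<close>

text \<open>
  A second order pole at distance \<open>\<delta>\<close> outside the boundary point \<open>\<zeta>0\<close>, normalised so that the
  \<open>L\<^sup>p\<close> mass on the circle is bounded below uniformly in \<open>\<delta>\<close>.
\<close>

definition peak :: "real \<Rightarrow> real \<Rightarrow> complex \<Rightarrow> complex \<Rightarrow> complex" where
  "peak p \<delta> \<zeta>0 z = complex_of_real (\<delta> powr (2 - 1 / p)) / (1 + complex_of_real \<delta> - cnj \<zeta>0 * z)\<^sup>2"

context
  fixes p \<delta> :: real and \<zeta>0 :: complex
  assumes p: "1 < p" and \<delta>: "0 < \<delta>" "\<delta> < 1" and \<zeta>0: "\<zeta>0 \<in> circle"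
begin

text \<open>
  As \<open>|\<zeta>0| = 1\<close>, this is the distance from \<open>z\<close> to the pole \<open>(1 + \<delta>) * \<zeta>0\<close>.
\<close>

definition gap :: "complex \<Rightarrow> real" where
  "gap z = cmod (1 + complex_of_real \<delta> - cnj \<zeta>0 * z)"

lemma gap_ge:
  assumes "cmod z \<le> 1"
  shows "\<delta> \<le> gap z" "cmod (z - \<zeta>0) \<le> gap z"
proof -
  define y where "y = cnj \<zeta>0 * z"
  have "cmod y \<le> 1" using assms \<zeta>0 by (simp add: y_def norm_mult)
  then have re: "Re y \<le> 1" using complex_Re_le_cmod[of y] by linarith
  have g: "gap z = cmod (1 + complex_of_real \<delta> - y)" by (simp add: gap_def y_def)
  have "\<delta> \<le> Re (1 + complex_of_real \<delta> - y)" using re by simp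
  also have "\<dots> \<le> gap z" unfolding g by (rule complex_Re_le_cmod)
  finally show "\<delta> \<le> gap z" .
  have "cmod (z - \<zeta>0) = cmod (cnj \<zeta>0 * (z - \<zeta>0))" using \<zeta>0 by (simp add: norm_mult)
  also have "cnj \<zeta>0 * (z - \<zeta>0) = y - 1"
    using \<zeta>0 complex_norm_square[of \<zeta>0] by (simp add: y_def algebra_simps)
  also have "cmod (y - 1) \<le> cmod (1 + complex_of_real \<delta> - y)"
  proof (rule power2_le_imp_le)
    have "(Re y - 1)\<^sup>2 \<le> (1 + \<delta> - Re y)\<^sup>2"
      using re \<delta> by (subst power2_commute) (intro power_mono, auto)
    then show "(cmod (y - 1))\<^sup>2 \<le> (cmod (1 + complex_of_real \<delta> - y))\<^sup>2"
      by (simp add: cmod_power2)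
  qed simp
  finally show "cmod (z - \<zeta>0) \<le> gap z" unfolding g .
qed

lemma gap_pos: "cmod z \<le> 1 \<Longrightarrow> 0 < gap z"
  using gap_ge(1)[of z] \<delta> by linarith

lemma cmod_peak: "cmod (peak p \<delta> \<zeta>0 z) = \<delta> powr (2 - 1 / p) / (gap z)\<^sup>2"
  by (simp add: peak_def gap_def norm_divide norm_power)

lemma peak_holomorphic: "peak p \<delta> \<zeta>0 holomorphic_on ball 0 (1 + \<delta>)"
proof -
  have "1 + complex_of_real \<delta> - cnj \<zeta>0 * z \<noteq> 0" if "z \<in> ball 0 (1 + \<delta>)" for z
  proof
    assume "1 + complex_of_real \<delta> - cnj \<zeta>0 * z = 0"
    then have "complex_of_real (1 + \<delta>) = cnj \<zeta>0 * z" by simp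
    then have "cmod (complex_of_real (1 + \<delta>)) = cmod (cnj \<zeta>0 * z)" by simp
    then have "1 + \<delta> = cmod z" using \<zeta>0 \<delta> by (simp only: norm_mult norm_of_real complex_mod_cnj) simp
    then show False using that by simp
  qed
  then show ?thesis unfolding peak_def[abs_def] by (intro holomorphic_intros) auto
qed

lemma peak_times_distance:
  assumes "cmod z \<le> 1"
  shows "cmod (z - \<zeta>0) * cmod (peak p \<delta> \<zeta>0 z) \<le> \<delta> powr (1 - 1 / p)"
proof -
  note g = gap_ge[OF assms] gap_pos[OF assms]
  have "cmod (z - \<zeta>0) * cmod (peak p \<delta> \<zeta>0 z) \<le> gap z * (\<delta> powr (2 - 1 / p) / (gap z)\<^sup>2)"
    unfolding cmod_peak using g by (intro mult_right_mono) auto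
  also have "\<dots> = \<delta> powr (2 - 1 / p) / gap z" using g by (simp add: power2_eq_square)
  also have "\<dots> \<le> \<delta> powr (2 - 1 / p) / \<delta>" using g \<delta> by (intro divide_left_mono) auto
  also have "\<dots> = \<delta> powr (1 - 1 / p)"
    using \<delta> powr_diff[of \<delta> "2 - 1 / p" 1] by simp
  finally show ?thesis .
qed

lemma peak_off:
  assumes "cmod z \<le> 1" "\<tau> \<le> cmod (z - \<zeta>0)" "0 < \<tau>"
  shows "cmod (peak p \<delta> \<zeta>0 z) \<le> \<delta> powr (1 - 1 / p) / \<tau>"
proof -
  have "\<tau> * cmod (peak p \<delta> \<zeta>0 z) \<le> \<delta> powr (1 - 1 / p)"
    using peak_times_distance[OF assms(1)] mult_right_mono[OF assms(2), of "cmod (peak p \<delta> \<zeta>0 z)"] by simp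
  then show ?thesis using assms(3) by (simp add: field_simps)
qed

text \<open>
  Splitting the pole as \<open>gap powr (- (1 + \<eta>)) * gap powr (- (1 - \<eta>))\<close> and bounding the first factor by its
  value at distance \<open>\<delta>\<close> leaves \<open>\<delta> powr \<eta>\<close> times the kernel \<open>|\<zeta>0 - w| powr (- (1 - \<eta>))\<close>; together with the
  Cauchy kernel its singularities have total order \<open>2 - \<eta> < 2\<close>.
\<close>

lemma peak_potential:
  defines "\<eta> \<equiv> (1 - 1 / p) / 2"
  shows "(LINT w|lborel. cmod (z - w) powr (- 1) * cmod (indicator disc w *\<^sub>R peak p \<delta> \<zeta>0 w)) \<le> \<delta> powr \<eta> * (2 * riesz_bound (2 - \<eta>))"
proof -
  have \<eta>: "0 < \<eta>" "\<eta> < 1/2" "1 - 1 / p = \<eta> + \<eta>" using p by (auto simp: \<eta>_def)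
  let ?r = "\<lambda>z w. indicator disc w * cmod (z - w) powr (- (2 - \<eta>))"
  have i: "integrable lborel (?r z)" for z using \<eta> by (intro integrable_riesz) auto
  have pt: "cmod (z - w) powr (- 1) * cmod (indicator disc w *\<^sub>R peak p \<delta> \<zeta>0 w) \<le> \<delta> powr \<eta> * (?r z w + ?r \<zeta>0 w)" for w
  proof (cases "w \<in> disc \<and> w \<noteq> z")
    case True
    then have w: "cmod w \<le> 1" by simp
    have a: "0 < cmod (z - w)" using True by (metis right_minus_eq zero_less_norm_iff)
    have b: "0 < cmod (\<zeta>0 - w)" using True \<zeta>0 by auto
    note g = gap_ge[OF w] gap_pos[OF w]
    have "cmod (peak p \<delta> \<zeta>0 w) = \<delta> powr (2 - 1 / p) * (gap w powr (- (1 + \<eta>)) * gap w powr (- (1 - \<eta>)))"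
      unfolding cmod_peak using g(3) by (simp add: powr_add[symmetric] powr_minus divide_inverse powr_numeral)
    also have "\<dots> \<le> \<delta> powr (2 - 1 / p) * (\<delta> powr (- (1 + \<eta>)) * cmod (\<zeta>0 - w) powr (- (1 - \<eta>)))"
      using g b \<delta> \<eta> by (intro mult_left_mono mult_mono powr_mono2') (auto simp: norm_minus_commute)
    also have "\<dots> = \<delta> powr \<eta> * cmod (\<zeta>0 - w) powr (- (1 - \<eta>))"
    proof -
      have "2 - 1 / p + - (1 + \<eta>) = \<eta>" using \<eta>(3) by simp
      then show ?thesis by (simp only: mult.assoc[symmetric] powr_add[symmetric])
    qed
    finally have "cmod (z - w) powr (- 1) * cmod (peak p \<delta> \<zeta>0 w)
       \<le> cmod (z - w) powr (- 1) * (\<delta> powr \<eta> * cmod (\<zeta>0 - w) powr (- (1 - \<eta>)))"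
      by (intro mult_left_mono) auto
    also have "\<dots> = \<delta> powr \<eta> * (cmod (z - w) powr (- 1) * cmod (\<zeta>0 - w) powr (- (1 - \<eta>)))"
      by (simp only: mult_ac)
    also have "\<dots> \<le> \<delta> powr \<eta> * (cmod (z - w) powr (- (2 - \<eta>)) + cmod (\<zeta>0 - w) powr (- (2 - \<eta>)))"
      using powr_product_le[OF a b, of 1 "1 - \<eta>"] \<eta> by (intro mult_left_mono) auto
    finally show ?thesis using True by simp
  qed auto
  have i2: "integrable lborel (\<lambda>w. \<delta> powr \<eta> * (?r z w + ?r \<zeta>0 w))"
    by (intro integrable_mult_right Bochner_Integration.integrable_add i)
  have "(LINT w|lborel. cmod (z - w) powr (- 1) * cmod (indicator disc w *\<^sub>R peak p \<delta> \<zeta>0 w))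
     \<le> (LINT w|lborel. \<delta> powr \<eta> * (?r z w + ?r \<zeta>0 w))"
  proof (rule integral_mono'[OF i2 pt])
    show "0 \<le> \<delta> powr \<eta> * (?r z w + ?r \<zeta>0 w)" for w by simp
  qed
  also have "\<dots> = \<delta> powr \<eta> * ((LINT w|lborel. ?r z w) + (LINT w|lborel. ?r \<zeta>0 w))"
    unfolding integral_mult_right_zero by (subst Bochner_Integration.integral_add[OF i i]) simp
  also have "\<dots> \<le> \<delta> powr \<eta> * (riesz_bound (2 - \<eta>) + riesz_bound (2 - \<eta>))"
    using \<eta> by (intro mult_left_mono add_mono integrable_riesz) auto
  finally show ?thesis by simp
qed

text \<open>
  Evaluate Jensen's inequality at the interior point \<open>b = (1 - \<delta>) * \<zeta>0\<close>, at distance \<open>2 * \<delta>\<close> from the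
  pole, where the Poisson kernel is at most \<open>2 / \<delta>\<close>.
\<close>

lemma peak_mass: "4 powr (- p) / 2 \<le> circle_mean (\<lambda>\<zeta>. cmod (peak p \<delta> \<zeta>0 \<zeta>) powr p)"
proof -
  define b where "b = complex_of_real (1 - \<delta>) * \<zeta>0"
  have nb: "cmod b = 1 - \<delta>" unfolding b_def norm_mult norm_of_real using \<zeta>0 \<delta> by simp
  then have b: "cmod b < 1" using \<delta> by simp
  have hol: "peak p \<delta> \<zeta>0 holomorphic_on cball 0 1"
    by (rule holomorphic_on_subset[OF peak_holomorphic]) (use \<delta> in auto)
  have cp: "continuous_on circle (\<lambda>\<zeta>. cmod (peak p \<delta> \<zeta>0 \<zeta>) powr p)"
    using p by (intro powr_continuous_on continuous_on_subset[OF holomorphic_on_imp_continuous_on[OF hol]]) auto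
  have gb: "gap b = 2 * \<delta>"
  proof -
    have "cnj \<zeta>0 * b = complex_of_real (1 - \<delta>)"
      using \<zeta>0 complex_norm_square[of \<zeta>0] by (simp add: b_def mult_ac)
    then have "1 + complex_of_real \<delta> - cnj \<zeta>0 * b = complex_of_real (2 * \<delta>)" by simp
    then have "gap b = cmod (complex_of_real (2 * \<delta>))" by (simp only: gap_def)
    then show ?thesis using \<delta> by (simp only: norm_of_real)
  qed
  have pb: "cmod (peak p \<delta> \<zeta>0 b) powr p = 4 powr (- p) / \<delta>"
  proof -
    have "cmod (peak p \<delta> \<zeta>0 b) = \<delta> powr (2 - 1 / p) / (\<delta> powr 2) / 4"
      unfolding cmod_peak gb using \<delta> by (simp add: power2_eq_square powr_numeral)
    also have "\<dots> = \<delta> powr (- (1 / p)) * 4 powr (- 1)"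
      by (subst powr_diff[symmetric]) (simp add: powr_minus)
    finally have "cmod (peak p \<delta> \<zeta>0 b) powr p = (\<delta> powr (- (1 / p))) powr p * (4 powr (- 1)) powr p"
      by (simp only: powr_mult powr_ge_zero)
    also have "\<dots> = \<delta> powr (- (1 / p) * p) * 4 powr (- 1 * p)" by (simp only: powr_powr)
    also have "\<dots> = \<delta> powr (- 1) * 4 powr (- p)" using p by simp
    finally show ?thesis using \<delta> by (simp add: powr_minus divide_inverse mult.commute)
  qed
  have "4 powr (- p) / \<delta> \<le> circle_mean (\<lambda>\<zeta>. cmod (peak p \<delta> \<zeta>0 \<zeta>) powr p * poisson b \<zeta>)"
    using poisson_jensen[OF hol b p, of 1 0] pb by simp
  also have "\<dots> \<le> circle_mean (\<lambda>\<zeta>. (2 / \<delta>) * cmod (peak p \<delta> \<zeta>0 \<zeta>) powr p)"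
  proof (rule circle_mean_mono)
    fix \<zeta> :: complex assume \<zeta>: "\<zeta> \<in> circle"
    have "\<delta> \<le> cmod (\<zeta> - b)" using norm_triangle_ineq2[of \<zeta> b] \<zeta> nb by simp
    then have "\<delta>\<^sup>2 \<le> (cmod (\<zeta> - b))\<^sup>2" using \<delta> by (intro power_mono) auto
    then have "poisson b \<zeta> \<le> (1 - (1 - \<delta>)\<^sup>2) / \<delta>\<^sup>2"
      unfolding poisson_def nb using \<delta> by (intro divide_left_mono) (auto simp: power_le_one intro!: mult_pos_pos)
    also have "\<dots> = (2 - \<delta>) / \<delta>" using \<delta> by (simp add: power2_eq_square field_simps)
    also have "\<dots> \<le> 2 / \<delta>" using \<delta> by (intro divide_right_mono) auto
    finally show "cmod (peak p \<delta> \<zeta>0 \<zeta>) powr p * poisson b \<zeta> \<le> (2 / \<delta>) * cmod (peak p \<delta> \<zeta>0 \<zeta>) powr p"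
      by (subst mult.commute) (intro mult_right_mono, auto)
  qed (intro continuous_intros cp continuous_poisson b)+
  also have "\<dots> = (2 / \<delta>) * circle_mean (\<lambda>\<zeta>. cmod (peak p \<delta> \<zeta>0 \<zeta>) powr p)" by (rule circle_mean_mult)
  finally show ?thesis using \<delta> by (simp add: field_simps)
qed

end

section \<open>Peaking solutions\<close>

text \<open>
  The harmonic function here is \<open>F = beltrami_inv (N \<zeta>0) h\<close> for a peak \<open>h\<close>, and
  \<open>f = beltrami_inv N (h + u)\<close> is the exact solution. Subtracting \<open>F - N \<zeta>0 * cnj F = h\<close> from
  \<open>f - N * cnj f = h + u\<close> gives
  \<open>(f - F) - N * cnj (f - F) = u + (N - N \<zeta>0) * cnj F\<close>, where the first term on the right is
  bounded by the potential of the peak and the second by \<open>L * |z - \<zeta>0| * |F z|\<close>. The bound \<open>c0\<close> on the mass is uniform in the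
  error \<open>e\<close> and the radius \<open>\<tau>\<close> of concentration.
\<close>

lemma peak_solutions:
  fixes \<nu> N :: "complex \<Rightarrow> real"
  assumes p: "1 < p" and nu: "(\<lambda>z. complex_of_real (\<nu> z)) \<in> W1inf"
    and N: "L-lipschitz_on (cball 0 1) N" "\<And>z. z \<in> disc \<Longrightarrow> N z = \<nu> z" "\<And>z. z \<in> cball 0 1 \<Longrightarrow> \<bar>N z\<bar> \<le> \<kappa>" and \<kappa>: "\<kappa> < 1"
    and \<zeta>0: "\<zeta>0 \<in> circle"
  obtains c0 where "0 < c0"
    "\<And>e \<tau>. 0 < e \<Longrightarrow> 0 < \<tau> \<Longrightarrow> \<exists>f h \<alpha> \<beta>. f \<in> Hp p \<nu> \<and> continuous_on (cball 0 1) f \<and> h holomorphic_on cball 0 1 \<and>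
       c0 \<le> circle_mean (\<lambda>\<zeta>. cmod (\<alpha> * h \<zeta> + \<beta> * cnj (h \<zeta>)) powr p) \<and>
       (\<forall>z\<in>cball 0 1. cmod (f z - (\<alpha> * h z + \<beta> * cnj (h z))) \<le> e) \<and>
       (\<forall>z\<in>cball 0 1. \<tau> \<le> cmod (z - \<zeta>0) \<longrightarrow> cmod (\<alpha> * h z + \<beta> * cnj (h z)) \<le> e)"
proof -
  obtain \<nu>x \<nu>y where nxy: "Linf \<nu>x" "Linf \<nu>y" "weak_deriv 1 (\<lambda>z. complex_of_real (\<nu> z)) \<nu>x" "weak_deriv \<i> (\<lambda>z. complex_of_real (\<nu> z)) \<nu>y"
    using nu by (auto simp: W1inf_def)
  obtain b M where b: "disc_density b M" "AE z in lebesgue_on disc. (\<nu>x z + \<i> * \<nu>y z) / 2 = b z"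
    by (rule Linf_borel_representative[OF Linf_dbar[OF nxy(1,2)]]) (rule that, auto simp: disc_density_def)
  define n where "n z = indicator disc z * \<nu> z" for z
  have cN: "continuous_on (cball 0 1) N" using N(1) by (rule lipschitz_on_continuous_on)
  have \<kappa>0: "0 \<le> \<kappa>" using N(3)[of 0] by simp
  have n: "n \<in> borel_measurable borel" "\<bar>n z\<bar> \<le> \<kappa>" for z
  proof -
    have "(\<lambda>z. indicator disc z *\<^sub>R N z) \<in> borel_measurable borel"
      by (intro borel_measurable_continuous_on_indicator continuous_on_subset[OF cN]) auto
    moreover have "indicator disc z *\<^sub>R N z = n z" for z using N(2)[of z] by (cases "z \<in> disc") (auto simp: n_def)
    ultimately show "n \<in> borel_measurable borel" by simp
    show "\<bar>n z\<bar> \<le> \<kappa>" using N(2,3)[of z] \<kappa>0 by (cases "z \<in> disc") (auto simp: n_def)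
  qed
  show thesis
  proof (rule solve_conj_beltrami[OF b(1) n \<kappa>])
    fix K :: real
    assume K: "0 \<le> K"
      "\<And>h B H. disc_density h B \<Longrightarrow> (\<And>z. (LINT \<zeta>|lborel. cmod (z - \<zeta>) powr (- 1) * cmod (h \<zeta>)) \<le> H) \<Longrightarrow>
        \<exists>u. continuous_on UNIV u \<and> (\<forall>z\<in>cball 0 1. cmod (u z) \<le> K * H) \<and>
          (\<forall>\<psi>. C1_supported \<psi> 1 \<longrightarrow>
            (LINT z|lborel. u z * dbar \<psi> z) = (LINT z|lborel. b z * cnj (beltrami_inv (n z) (h z + u z)) * \<psi> z))"
    define \<eta> where "\<eta> = (1 - 1 / p) / 2"
    have \<eta>: "0 < \<eta>" "1 - 1 / p = 2 * \<eta>" using p by (auto simp: \<eta>_def)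
    have L: "0 \<le> L" using lipschitz_on_nonneg[OF N(1)] .
    define \<alpha> \<beta> where "\<alpha> = 1 / complex_of_real (1 - (N \<zeta>0)\<^sup>2)" and "\<beta> = complex_of_real (N \<zeta>0) / complex_of_real (1 - (N \<zeta>0)\<^sup>2)"
    have N0: "\<bar>N \<zeta>0\<bar> \<le> \<kappa>" using N(3)[of \<zeta>0] \<zeta>0 by simp
    have ab: "\<alpha> * w + \<beta> * cnj w = beltrami_inv (N \<zeta>0) w" for w
      by (simp add: \<alpha>_def \<beta>_def beltrami_inv_def add_divide_distrib)
    define c0 where "c0 = 2 powr (- p) * (4 powr (- p) / 2)"
    show thesis
    proof (rule that[of c0])
      show "0 < c0" by (simp add: c0_def)
      fix e \<tau> :: real assume e: "0 < e" and \<tau>: "0 < \<tau>"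
      (* Both the distance of f to F and the size of F off the peak are at most E * \<delta> powr \<eta>. *)
      define E where "E = (K * (2 * riesz_bound (2 - \<eta>)) + L / (1 - \<kappa>)) / (1 - \<kappa>) + 1 / \<tau> / (1 - \<kappa>)"
      have E: "0 < E" unfolding E_def using K(1) riesz_bound_pos[of "2 - \<eta>"] L \<kappa> \<tau>
        by (intro add_nonneg_pos divide_nonneg_pos add_nonneg_nonneg mult_nonneg_nonneg divide_pos_pos) auto
      define \<delta> where "\<delta> = min (1 / 2) ((e / E) powr (1 / \<eta>))"
      have \<delta>: "0 < \<delta>" "\<delta> < 1" using e E by (auto simp: \<delta>_def)
      have E\<delta>: "E * \<delta> powr \<eta> \<le> e"
      proof -
        have "\<delta> powr \<eta> \<le> ((e / E) powr (1 / \<eta>)) powr \<eta>"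
          using \<delta> \<eta> by (intro powr_mono2) (auto simp: \<delta>_def)
        also have "\<dots> = e / E" using \<eta> e E by (simp add: powr_powr)
        finally show ?thesis using E by (simp add: field_simps)
      qed
      have \<delta>2: "\<delta> powr (1 - 1 / p) \<le> \<delta> powr \<eta>"
        unfolding \<eta>(2) using \<delta> \<eta>(1) by (intro powr_mono') auto
      define h where "h = peak p \<delta> \<zeta>0"
      note pk = p \<delta> \<zeta>0
      have hol: "h holomorphic_on ball 0 (1 + \<delta>)" unfolding h_def by (rule peak_holomorphic[OF pk])
      have sub: "cball 0 1 \<subseteq> ball (0::complex) (1 + \<delta>)" using \<delta> by auto
      have holc: "h holomorphic_on cball 0 1" by (rule holomorphic_on_subset[OF hol sub])
      have ch: "continuous_on (cball 0 1) h" by (rule holomorphic_on_imp_continuous_on[OF holc])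
      define H where "H = \<delta> powr \<eta> * (2 * riesz_bound (2 - \<eta>))"
      obtain B where dh: "disc_density (\<lambda>z. indicator disc z *\<^sub>R h z) B"
      proof -
        have "bounded (h ` cball 0 1)" by (intro compact_imp_bounded compact_continuous_image ch) auto
        then obtain B where B: "0 < B" "\<And>z. z \<in> cball 0 1 \<Longrightarrow> cmod (h z) \<le> B" by (auto simp: bounded_pos)
        have "(\<lambda>z. indicator disc z *\<^sub>R h z) \<in> borel_measurable borel"
          by (intro borel_measurable_continuous_on_indicator continuous_on_subset[OF ch]) auto
        moreover have "cmod (indicator disc z *\<^sub>R h z) \<le> B" for z using B(1) B(2)[of z] by (cases "z \<in> disc") auto
        ultimately show thesis using that[of B] by (simp add: disc_density_def)
      qed
      have pot: "(LINT w|lborel. cmod (z - w) powr (- 1) * cmod (indicator disc w *\<^sub>R h w)) \<le> H" for z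
        unfolding H_def h_def \<eta>_def by (rule peak_potential[OF pk])
      obtain u where u: "continuous_on UNIV u" "\<And>z. z \<in> cball 0 1 \<Longrightarrow> cmod (u z) \<le> K * H"
        "\<And>\<psi>. C1_supported \<psi> 1 \<Longrightarrow>
            (LINT z|lborel. u z * dbar \<psi> z) = (LINT z|lborel. b z * cnj (beltrami_inv (n z) (indicator disc z *\<^sub>R h z + u z)) * \<psi> z)"
        using K(2)[OF dh pot] by blast
      define f where "f z = beltrami_inv (N z) (h z + u z)" for z
      have f: "f \<in> Hp p \<nu>" "continuous_on (cball 0 1) f"
        using Hp_memberI[OF nxy cN N(2,3) \<kappa> b hol open_ball sub u(1) u(3)[unfolded n_def] p]
        unfolding f_def by auto
      define F where "F z = beltrami_inv (N \<zeta>0) (h z)" for z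
      have FF: "\<alpha> * h z + \<beta> * cnj (h z) = F z" for z by (simp add: ab F_def)
      have F_le: "cmod (F z) \<le> cmod (h z) / (1 - \<kappa>)" for z
        unfolding F_def by (rule cmod_beltrami_inv_le[OF N0 \<kappa>])
      have mass: "c0 \<le> circle_mean (\<lambda>\<zeta>. cmod (F \<zeta>) powr p)"
      proof -
        have cc: "continuous_on circle h" by (rule continuous_on_subset[OF ch]) auto
        have cF: "continuous_on circle F" unfolding FF[symmetric] by (intro continuous_intros cc)
        have "c0 \<le> 2 powr (- p) * circle_mean (\<lambda>\<zeta>. cmod (h \<zeta>) powr p)"
          unfolding c0_def h_def by (intro mult_left_mono peak_mass[OF pk]) auto
        also have "\<dots> = circle_mean (\<lambda>\<zeta>. 2 powr (- p) * cmod (h \<zeta>) powr p)" by (rule circle_mean_mult[symmetric])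
        also have "\<dots> \<le> circle_mean (\<lambda>\<zeta>. cmod (F \<zeta>) powr p)"
        proof (rule circle_mean_mono)
          fix \<zeta> :: complex
          have "h \<zeta> = F \<zeta> - complex_of_real (N \<zeta>0) * cnj (F \<zeta>)"
            unfolding F_def by (rule beltrami_inv_eq[OF N0 \<kappa>, symmetric])
          then have "cmod (h \<zeta>) \<le> cmod (F \<zeta>) + cmod (complex_of_real (N \<zeta>0) * cnj (F \<zeta>))"
            using norm_triangle_ineq4 by metis
          also have "\<dots> \<le> cmod (F \<zeta>) + 1 * cmod (F \<zeta>)"
            unfolding norm_mult norm_of_real complex_mod_cnj using N0 \<kappa> by (intro add_left_mono mult_right_mono) auto
          finally have "cmod (h \<zeta>) / 2 \<le> cmod (F \<zeta>)" by simp
          then have "(cmod (h \<zeta>) / 2) powr p \<le> cmod (F \<zeta>) powr p" using p by (intro powr_mono2) auto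
          then show "2 powr (- p) * cmod (h \<zeta>) powr p \<le> cmod (F \<zeta>) powr p"
            by (simp add: powr_divide powr_minus_divide)
        qed (use p in \<open>intro continuous_intros powr_continuous_on cc cF; simp\<close>)+
        finally show ?thesis .
      qed
      have close: "cmod (f z - F z) \<le> e" if z: "z \<in> cball 0 1" for z
      proof -
        have zn: "cmod z \<le> 1" using z by simp
        have 1: "f z - complex_of_real (N z) * cnj (f z) = h z + u z"
          unfolding f_def by (rule beltrami_inv_eq[OF N(3)[OF z] \<kappa>])
        have 2: "F z - complex_of_real (N \<zeta>0) * cnj (F z) = h z"
          unfolding F_def by (rule beltrami_inv_eq[OF N0 \<kappa>])
        have "(f z - F z) - complex_of_real (N z) * cnj (f z - F z)
           = (f z - complex_of_real (N z) * cnj (f z)) - (F z - complex_of_real (N \<zeta>0) * cnj (F z))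
             + complex_of_real (N z - N \<zeta>0) * cnj (F z)"
          by (simp add: algebra_simps)
        also have "\<dots> = u z + complex_of_real (N z - N \<zeta>0) * cnj (F z)" unfolding 1 2 by simp
        finally have eq: "(f z - F z) - complex_of_real (N z) * cnj (f z - F z) = u z + complex_of_real (N z - N \<zeta>0) * cnj (F z)" .
        have "cmod (complex_of_real (N z - N \<zeta>0) * cnj (F z)) \<le> (L * cmod (z - \<zeta>0)) * (cmod (h z) / (1 - \<kappa>))"
        proof -
          have "\<bar>N z - N \<zeta>0\<bar> \<le> L * cmod (z - \<zeta>0)"
            using lipschitz_onD[OF N(1) z, of \<zeta>0] \<zeta>0 by (simp add: dist_norm)
          then show ?thesis unfolding norm_mult norm_of_real complex_mod_cnj
            using F_le[of z] L by (intro mult_mono) auto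
        qed
        also have "\<dots> = L / (1 - \<kappa>) * (cmod (z - \<zeta>0) * cmod (h z))" by simp
        also have "\<dots> \<le> L / (1 - \<kappa>) * \<delta> powr \<eta>"
          using peak_times_distance[OF pk zn] \<delta>2 L \<kappa> unfolding h_def by (intro mult_left_mono) auto
        finally have "cmod (u z + complex_of_real (N z - N \<zeta>0) * cnj (F z)) \<le> K * H + L / (1 - \<kappa>) * \<delta> powr \<eta>"
          using u(2)[OF z] by (intro norm_triangle_le add_mono)
        then have "(1 - \<kappa>) * cmod (f z - F z) \<le> (K * (2 * riesz_bound (2 - \<eta>)) + L / (1 - \<kappa>)) * \<delta> powr \<eta>"
          using cmod_sub_cnj_ge[OF N(3)[OF z], of "f z - F z"] unfolding eq H_def by (simp add: algebra_simps)
        then have "cmod (f z - F z) \<le> (K * (2 * riesz_bound (2 - \<eta>)) + L / (1 - \<kappa>)) / (1 - \<kappa>) * \<delta> powr \<eta>"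
          using \<kappa> by (simp add: pos_le_divide_eq mult.commute)
        also have "\<dots> \<le> E * \<delta> powr \<eta>"
          unfolding E_def using \<tau> \<kappa> by (intro mult_right_mono) auto
        finally show ?thesis using E\<delta> by simp
      qed
      have off: "cmod (F z) \<le> e" if z: "z \<in> cball 0 1" "\<tau> \<le> cmod (z - \<zeta>0)" for z
      proof -
        have "cmod (h z) \<le> \<delta> powr (1 - 1 / p) / \<tau>" unfolding h_def
          by (rule peak_off[OF pk _ z(2) \<tau>]) (use z in simp)
        also have "\<dots> \<le> \<delta> powr \<eta> / \<tau>" using \<delta>2 \<tau> by (intro divide_right_mono) auto
        finally have "cmod (h z) / (1 - \<kappa>) \<le> \<delta> powr \<eta> / \<tau> / (1 - \<kappa>)" using \<kappa> by (intro divide_right_mono) auto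
        then have "cmod (F z) \<le> 1 / \<tau> / (1 - \<kappa>) * \<delta> powr \<eta>" using F_le[of z] by simp
        also have "\<dots> \<le> E * \<delta> powr \<eta>"
          unfolding E_def using K(1) riesz_bound_pos[of "2 - \<eta>"] L \<kappa> by (intro mult_right_mono) auto
        finally show ?thesis using E\<delta> by simp
      qed
      show "\<exists>f h \<alpha> \<beta>. f \<in> Hp p \<nu> \<and> continuous_on (cball 0 1) f \<and> h holomorphic_on cball 0 1 \<and>
         c0 \<le> circle_mean (\<lambda>\<zeta>. cmod (\<alpha> * h \<zeta> + \<beta> * cnj (h \<zeta>)) powr p) \<and>
         (\<forall>z\<in>cball 0 1. cmod (f z - (\<alpha> * h z + \<beta> * cnj (h z))) \<le> e) \<and>
         (\<forall>z\<in>cball 0 1. \<tau> \<le> cmod (z - \<zeta>0) \<longrightarrow> cmod (\<alpha> * h z + \<beta> * cnj (h z)) \<le> e)"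
        by (rule exI[of _ f], rule exI[of _ h], rule exI[of _ \<alpha>], rule exI[of _ \<beta>])
           (use f holc mass close off in \<open>simp add: FF\<close>)
    qed
  qed
qed

section \<open>Isometric composition operators\<close>

theorem proposition5:
  fixes p \<kappa> :: real and \<nu> :: "complex \<Rightarrow> real" and \<phi> :: "complex \<Rightarrow> complex"
  assumes p: "1 < p"
    and kappa: "0 < \<kappa>" "\<kappa> < 1"
    and nu: "(\<lambda>z. complex_of_real (\<nu> z)) \<in> W1inf"
    and nu_bound: "AE z in lebesgue_on disc. \<bar>\<nu> z\<bar> \<le> \<kappa>"
    and phi_maps: "\<phi> ` disc \<subseteq> disc"
    and phi: "\<phi> \<in> W1inf"
    and phi_analytic: "\<phi> analytic_on disc"
    and isometry: "isometry_between (Hp p \<nu>) (tr_norm p) (Hp p (\<nu> \<circ> \<phi>)) (tr_norm p) (comp_op \<phi>)"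
  shows "(\<exists>\<Phi>. continuous_on (cball 0 1) \<Phi> \<and> (\<forall>z\<in>disc. \<Phi> z = \<phi> z) \<and> \<Phi> ` circle \<subseteq> circle)
    \<and> \<phi> 0 = 0"
proof -
  have p0: "0 < p" using p by simp
  have hol: "\<phi> holomorphic_on disc" using phi_analytic by (simp add: analytic_on_open)
  obtain L\<phi> where "L\<phi>-lipschitz_on disc \<phi>" by (rule W1inf_lipschitz[OF phi])
  then obtain \<Phi> where \<Phi>L: "L\<phi>-lipschitz_on (cball 0 1) \<Phi>" and \<Phi>: "\<And>z. z \<in> disc \<Longrightarrow> \<Phi> z = \<phi> z"
    using lipschitz_extension_cball by metis
  have c\<Phi>: "continuous_on (cball 0 1) \<Phi>" using \<Phi>L by (rule lipschitz_on_continuous_on)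
  have closD: "closure disc = cball (0::complex) 1" by simp
  have \<Phi>map: "\<Phi> ` cball 0 1 \<subseteq> cball 0 1"
  proof
    fix w assume "w \<in> \<Phi> ` cball 0 1"
    then obtain z where z: "z \<in> cball 0 1" "w = \<Phi> z" by blast
    have "cmod (\<Phi> z) \<le> 1"
    proof (rule continuous_le_on_closure[where S = disc and f = "\<lambda>z. cmod (\<Phi> z)"])
      show "cmod (\<Phi> x) \<le> 1" if "x \<in> disc" for x
        using phi_maps \<Phi>[OF that] that by (force simp: image_subset_iff)
    qed (use z c\<Phi> in \<open>auto simp: closD intro!: continuous_intros\<close>)
    then show "w \<in> cball 0 1" using z by simp
  qed
  obtain L where "L-lipschitz_on disc (\<lambda>z. complex_of_real (\<nu> z))" by (rule W1inf_lipschitz[OF nu])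
  then obtain U where UL: "L-lipschitz_on (cball 0 1) U" and U: "\<And>z. z \<in> disc \<Longrightarrow> U z = complex_of_real (\<nu> z)"
    using lipschitz_extension_cball by metis
  define N where "N z = Re (U z)" for z
  have NL: "L-lipschitz_on (cball 0 1) N"
  proof (rule lipschitz_onI)
    fix z w :: complex assume "z \<in> cball 0 1" "w \<in> cball 0 1"
    then have "cmod (U z - U w) \<le> L * dist z w" using lipschitz_onD[OF UL] by (simp add: dist_norm)
    then show "dist (N z) (N w) \<le> L * dist z w"
      using abs_Re_le_cmod[of "U z - U w"] by (simp add: N_def dist_norm)
  qed (use lipschitz_on_nonneg[OF UL] in simp)
  have N\<nu>: "N z = \<nu> z" if "z \<in> disc" for z using U[OF that] by (simp add: N_def)
  have cN: "continuous_on (cball 0 1) N" using NL by (rule lipschitz_on_continuous_on)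
  have c\<nu>: "continuous_on disc (\<lambda>z. \<bar>\<nu> z\<bar>)"
  proof -
    have "continuous_on disc N" by (rule continuous_on_subset[OF cN]) auto
    then have "continuous_on disc (\<lambda>z. \<bar>N z\<bar>)" by (intro continuous_intros)
    then show ?thesis by (rule continuous_on_cong[THEN iffD1, rotated 2]) (auto simp: N\<nu>)
  qed
  have N\<kappa>: "\<bar>N z\<bar> \<le> \<kappa>" if z: "z \<in> cball 0 1" for z
  proof (rule continuous_le_on_closure[where S = disc and f = "\<lambda>z. \<bar>N z\<bar>"])
    show "\<bar>N x\<bar> \<le> \<kappa>" if "x \<in> disc" for x
      using AE_disc_le_imp_le[OF c\<nu> nu_bound that] N\<nu>[OF that] by simp
  qed (use z cN in \<open>auto simp: closD intro!: continuous_intros\<close>)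
  have "\<Phi> ` circle \<subseteq> circle \<and> \<phi> 0 = 0"
  proof (rule ccontr)
    assume neg: "\<not> (\<Phi> ` circle \<subseteq> circle \<and> \<phi> 0 = 0)"
    show False
    proof (rule composition_loses_mass[OF hol phi_maps c\<Phi> \<Phi> \<Phi>map p neg])
      fix \<zeta>0 :: complex and q \<tau> K :: real
      assume \<zeta>0: "\<zeta>0 \<in> circle" and q: "0 \<le> q" "q < 1" and \<tau>: "0 < \<tau>" and K: "0 \<le> K"
        and deficit: "\<And>\<alpha> \<beta> h \<epsilon>. h holomorphic_on cball 0 1 \<Longrightarrow> 0 \<le> \<epsilon> \<Longrightarrow>
         (\<And>z. z \<in> cball 0 1 \<Longrightarrow> \<tau> \<le> cmod (z - \<zeta>0) \<Longrightarrow> cmod (\<alpha> * h z + \<beta> * cnj (h z)) powr p \<le> \<epsilon>) \<Longrightarrow>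
         circle_mean (\<lambda>\<zeta>. cmod (\<alpha> * h (\<Phi> \<zeta>) + \<beta> * cnj (h (\<Phi> \<zeta>))) powr p)
         \<le> q * circle_mean (\<lambda>\<zeta>. cmod (\<alpha> * h \<zeta> + \<beta> * cnj (h \<zeta>)) powr p) + K * \<epsilon>"
      show False
      proof (rule peak_solutions[OF p nu NL N\<nu> N\<kappa> kappa(2) \<zeta>0])
        fix c0 :: real
        assume c0: "0 < c0"
          and peaks: "\<And>e \<tau>. 0 < e \<Longrightarrow> 0 < \<tau> \<Longrightarrow> \<exists>f h \<alpha> \<beta>. f \<in> Hp p \<nu> \<and> continuous_on (cball 0 1) f \<and> h holomorphic_on cball 0 1 \<and>
           c0 \<le> circle_mean (\<lambda>\<zeta>. cmod (\<alpha> * h \<zeta> + \<beta> * cnj (h \<zeta>)) powr p) \<and>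
           (\<forall>z\<in>cball 0 1. cmod (f z - (\<alpha> * h z + \<beta> * cnj (h z))) \<le> e) \<and>
           (\<forall>z\<in>cball 0 1. \<tau> \<le> cmod (z - \<zeta>0) \<longrightarrow> cmod (\<alpha> * h z + \<beta> * cnj (h z)) \<le> e)"
        (* q is enlarged to be positive, and s is chosen such that two applications of the perturbed
           triangle inequality enlarge q1 only to Q < 1. *)
        define q1 where "q1 = max q (1/2)"
        have q1: "q \<le> q1" "0 < q1" "q1 < 1" using q by (auto simp: q1_def)
        define Q where "Q = (1 + q1) / 2"
        have Q: "q1 < Q" "Q < 1" using q1 by (auto simp: Q_def)
        define s where "s = (Q / q1) powr (1 / (2 * p)) - 1"
        have Qq: "1 < Q / q1" using Q q1 by simp
        have s: "0 < s" unfolding s_def using Qq p0 by simp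
        define S where "S = (1 + s) powr p"
        have S0: "0 \<le> S" by (simp add: S_def)
        have S2: "S * S * q1 = Q"
        proof -
          have "S = (Q / q1) powr (1 / 2)" using Qq p0 by (simp add: S_def s_def powr_powr)
          then have "S * S = Q / q1" using Qq Q(1) q1(2) by (simp add: powr_add[symmetric])
          then show ?thesis using q1 by simp
        qed
        define W where "W = (1 + 1 / s) powr p"
        define D where "D = S * S * K + S * W + W + 1"
        have W0: "0 \<le> W" by (simp add: W_def)
        have D: "0 < D" unfolding D_def using S0 W0 K by (intro add_nonneg_pos add_nonneg_nonneg mult_nonneg_nonneg) auto
        (* D collects the coefficients of all error terms; with this e they add up to at most half of
           the mass deficit (1 - Q) * c0. *)
        define e where "e = ((1 - Q) * c0 / (2 * D)) powr (1 / p)"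
        have e: "0 < e" unfolding e_def using Q c0 D by simp
        have ep: "D * e powr p = (1 - Q) * c0 / 2"
        proof -
          define Y where "Y = (1 - Q) * c0 / (2 * D)"
          have Y: "0 \<le> Y" using Q c0 D by (simp add: Y_def)
          have "e powr p = Y powr (1 / p * p)" by (simp only: e_def Y_def powr_powr)
          then have "e powr p = Y" using p0 Y by simp
          then show ?thesis using D by (simp add: Y_def)
        qed
        obtain f h \<alpha> \<beta> where f: "f \<in> Hp p \<nu>" "continuous_on (cball 0 1) f" and h: "h holomorphic_on cball 0 1"
          and mass: "c0 \<le> circle_mean (\<lambda>\<zeta>. cmod (\<alpha> * h \<zeta> + \<beta> * cnj (h \<zeta>)) powr p)"
          and close: "\<And>z. z \<in> cball 0 1 \<Longrightarrow> cmod (f z - (\<alpha> * h z + \<beta> * cnj (h z))) \<le> e"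
          and off: "\<And>z. z \<in> cball 0 1 \<Longrightarrow> \<tau> \<le> cmod (z - \<zeta>0) \<Longrightarrow> cmod (\<alpha> * h z + \<beta> * cnj (h z)) \<le> e"
          using peaks[OF e \<tau>] by blast
        define F where "F z = \<alpha> * h z + \<beta> * cnj (h z)" for z
        have cF: "continuous_on (cball 0 1) F"
          unfolding F_def by (intro continuous_intros holomorphic_on_imp_continuous_on h)
        have cf\<Phi>: "continuous_on (cball 0 1) (\<lambda>z. f (\<Phi> z))" and cF\<Phi>: "continuous_on (cball 0 1) (\<lambda>z. F (\<Phi> z))"
          by (rule continuous_on_compose2[OF f(2) c\<Phi> \<Phi>map], rule continuous_on_compose2[OF cF c\<Phi> \<Phi>map])
        have res: "continuous_on circle k" if "continuous_on (cball 0 1) k" for k :: "complex \<Rightarrow> complex"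
          by (rule continuous_on_subset[OF that]) auto
        define A where "A = circle_mean (\<lambda>\<zeta>. cmod (F \<zeta>) powr p)"
        have "tr_norm p (comp_op \<phi> f) = tr_norm p f"
          using isometry f(1) unfolding isometry_between_def by blast
        then have iso: "circle_mean (\<lambda>\<zeta>. cmod (f (\<Phi> \<zeta>)) powr p) = circle_mean (\<lambda>\<zeta>. cmod (f \<zeta>) powr p)"
          by (intro circle_mean_powr_eq_of_tr_norm_eq[where f = "comp_op \<phi> f" and g = f] cf\<Phi> f(2) p)
             (auto simp: comp_op_def \<Phi>)
        have "A \<le> S * circle_mean (\<lambda>\<zeta>. cmod (f \<zeta>) powr p) + W * e powr p"
          unfolding A_def S_def W_def
          by (rule circle_mean_powr_perturb[OF res[OF cF] res[OF f(2)] _ s p0])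
             (use close in \<open>simp add: F_def norm_minus_commute\<close>)
        also have "circle_mean (\<lambda>\<zeta>. cmod (f \<zeta>) powr p) = circle_mean (\<lambda>\<zeta>. cmod (f (\<Phi> \<zeta>)) powr p)" using iso by simp
        also have "S * \<dots> + W * e powr p \<le> S * (S * circle_mean (\<lambda>\<zeta>. cmod (F (\<Phi> \<zeta>)) powr p) + W * e powr p) + W * e powr p"
        proof (intro add_right_mono mult_left_mono S0)
          show "circle_mean (\<lambda>\<zeta>. cmod (f (\<Phi> \<zeta>)) powr p) \<le> S * circle_mean (\<lambda>\<zeta>. cmod (F (\<Phi> \<zeta>)) powr p) + W * e powr p"
            unfolding S_def W_def
          proof (rule circle_mean_powr_perturb[OF res[OF cf\<Phi>] res[OF cF\<Phi>] _ s p0])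
            fix z :: complex assume "z \<in> circle"
            then have "\<Phi> z \<in> cball 0 1" using \<Phi>map by (auto simp: image_subset_iff)
            then show "cmod (f (\<Phi> z) - F (\<Phi> z)) \<le> e" unfolding F_def by (rule close)
          qed
        qed
        also have "\<dots> \<le> S * (S * (q * A + K * e powr p) + W * e powr p) + W * e powr p"
        proof (intro add_right_mono mult_left_mono S0)
          show "circle_mean (\<lambda>\<zeta>. cmod (F (\<Phi> \<zeta>)) powr p) \<le> q * A + K * e powr p"
            unfolding F_def A_def
            by (rule deficit[OF h]) (use off p0 in \<open>auto intro!: powr_mono2\<close>)
        qed
        also have "\<dots> = S * S * q * A + (S * S * K + S * W + W) * e powr p" by (simp add: algebra_simps)
        also have "\<dots> \<le> Q * A + D * e powr p"
        proof (intro add_mono mult_right_mono)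
          show "S * S * q \<le> Q" unfolding S2[symmetric] using q1(1) S0 by (intro mult_left_mono) auto
          show "0 \<le> A" using mass c0 by (simp add: A_def F_def)
        qed (auto simp: D_def)
        also have "\<dots> = Q * A + (1 - Q) * c0 / 2" unfolding ep ..
        finally have "A \<le> Q * A + (1 - Q) * c0 / 2" .
        moreover have "(1 - Q) * A = A - Q * A" by (simp add: algebra_simps)
        moreover have "(1 - Q) * c0 \<le> (1 - Q) * A" using mass Q by (intro mult_left_mono) (auto simp: A_def F_def)
        moreover have "0 < (1 - Q) * c0" using Q c0 by simp
        ultimately show False by linarith
      qed
    qed
  qed
  then show ?thesis using c\<Phi> \<Phi> by blast
qed

end
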